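(* Let $G$ be a finite simple chordal graph on the vertex set $\{x_1,\ldots,x_n\}$, let $\mathbb K$ be a field and $R=\mathbb K[x_1,\ldots,x_n]$. Then for every integer $t\geq 2$, \[\mathrm{reg}(R/J_t(G))=(t-1)\,\nu_t(G).\]
   Context: A graph is chordal if it has no induced cycle of length greater than three. For $W\subseteq V(G)$, $G[W]$ denotes the induced subgraph on $W$, and for $F\subseteq V(G)$, $\mathbf x_F=\prod_{x_i\in F}x_i$. For $t\ge 2$, the $t$-connected ideal of $G$ is $J_t(G)=\langle \mathbf x_C \mid C\subseteq V(G),\ |C|=t,\ G[C]\text{ connected}\rangle\subseteq R$ (it is the Stanley–Reisner ideal of the $t$-independence complex of $G$; it is the zero ideal if no such $C$ exists). A $t$-induced matching of $G$ is a collection $\{C_1,\ldots,C_r\}$ of pairwise disjoint subsets of $V(G)$ with $|C_i|=t$ and $G[C_i]$ connected for each $i$, such that $E(G[\bigcup_i C_i])=\bigcup_i E(G[C_i])$; $\nu_t(G)$ is the maximum size of a $t$-induced matching of $G$ (equivalently, the induced matching number of the hypergraph whose edges are the $t$-subsets $C$ with $G[C]$ connected). $\mathrm{reg}$ denotes Castelnuovo–Mumford regularity. *)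

theory Defs
  imports "HOL-Library.Poly_Mapping" "HOL-Library.Disjoint_Sets" "Jordan_Normal_Form.Matrix_Kernel"
begin

section \<open>Graphs\<close>

text \<open>A graph is given by its set of edges; the vertex set is the whole (finite) vertex type.\<close>

definition simple_graph :: "'v set set \<Rightarrow> bool" where
  "simple_graph E \<longleftrightarrow> (\<forall>e\<in>E. card e = 2)"

definition induced_edges :: "'v set set \<Rightarrow> 'v set \<Rightarrow> 'v set set" where
  "induced_edges E W = {e \<in> E. e \<subseteq> W}"

definition induced_connected :: "'v set set \<Rightarrow> 'v set \<Rightarrow> bool" where
  "induced_connected E W \<longleftrightarrow>
     W \<noteq> {} \<and> (\<forall>u\<in>W. \<forall>v\<in>W. (u, v) \<in> {(a, b). {a, b} \<in> induced_edges E W}\<^sup>*)"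

definition induced_cycle :: "'v set set \<Rightarrow> 'v list \<Rightarrow> bool" where
  "induced_cycle E xs \<longleftrightarrow>
     length xs \<ge> 3 \<and> distinct xs \<and>
     induced_edges E (set xs) = {{xs ! i, xs ! (Suc i mod length xs)} |i. i < length xs}"

definition chordal :: "'v set set \<Rightarrow> bool" where
  "chordal E \<longleftrightarrow> \<not> (\<exists>xs. induced_cycle E xs \<and> length xs > 3)"

definition t_connected_sets :: "nat \<Rightarrow> 'v set set \<Rightarrow> 'v set set" where
  "t_connected_sets t E = {C. card C = t \<and> induced_connected E C}"

definition t_induced_matching :: "nat \<Rightarrow> 'v set set \<Rightarrow> 'v set set \<Rightarrow> bool" where
  "t_induced_matching t E M \<longleftrightarrow>
     M \<subseteq> t_connected_sets t E \<and> disjoint M \<and>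
     induced_edges E (\<Union>M) = (\<Union>C\<in>M. induced_edges E C)"

definition t_induced_matching_number :: "nat \<Rightarrow> 'v::finite set set \<Rightarrow> nat" where
  "t_induced_matching_number t E = Max (card ` {M. t_induced_matching t E M})"


section \<open>Polynomial rings and the \<open>t\<close>-connected ideal\<close>

text \<open>
  The polynomial ring over \<open>'k\<close> whose variables are the elements of \<open>'v\<close>, as the monoid algebra
  of the exponent vectors \<open>'v \<Rightarrow>\<^sub>0 nat\<close>.
\<close>

type_synonym ('v, 'k) mpoly = "('v \<Rightarrow>\<^sub>0 nat) \<Rightarrow>\<^sub>0 'k"

definition var :: "'v \<Rightarrow> ('v, 'k::comm_ring_1) mpoly" where
  "var x = Poly_Mapping.single (Poly_Mapping.single x 1) 1"

definition ideal_generated :: "'a::comm_ring_1 set \<Rightarrow> 'a set" where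
  "ideal_generated S = module.span (*) S"

definition t_connected_ideal :: "nat \<Rightarrow> 'v set set \<Rightarrow> ('v, 'k::comm_ring_1) mpoly set" where
  "t_connected_ideal t E = ideal_generated ((\<lambda>C. \<Prod>x\<in>C. var x) ` t_connected_sets t E)"

definition mdegree :: "('v::finite \<Rightarrow>\<^sub>0 nat) \<Rightarrow> nat" where
  "mdegree m = (\<Sum>x\<in>UNIV. Poly_Mapping.lookup m x)"

text \<open>Zero is homogeneous of every degree, and it is the only form of negative degree.\<close>

definition homogeneous :: "('v::finite, 'k::comm_ring_1) mpoly \<Rightarrow> int \<Rightarrow> bool" where
  "homogeneous f e \<longleftrightarrow> (\<forall>m\<in>Poly_Mapping.keys f. int (mdegree m) = e)"


section \<open>Graded free resolutions and regularity\<close>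

definition mat_range :: "'a::comm_ring_1 mat \<Rightarrow> 'a vec set" where
  "mat_range A = (\<lambda>v. A *\<^sub>v v) ` carrier_vec (dim_col A)"

text \<open>
  A graded free resolution
  \<open>\<dots> \<rightarrow> F\<^sub>2 \<rightarrow> F\<^sub>1 \<rightarrow> F\<^sub>0 \<rightarrow> R/I \<rightarrow> 0\<close> of \<open>R/I\<close> by free modules of finite rank.
  The list \<open>degs i\<close> holds the degrees of the basis elements of \<open>F\<^sub>i\<close>, so that
  \<open>F\<^sub>i\<close> is the direct sum of the \<open>R(-d)\<close> for \<open>d\<close> in \<open>degs i\<close>.  The matrix \<open>A (Suc i)\<close>
  represents \<open>F\<^bsub>i+1\<^esub> \<rightarrow> F\<^sub>i\<close>.  The row \<open>A 0\<close> represents \<open>F\<^sub>0 \<rightarrow> R\<close>, and the augmentation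
  is its composition with \<open>R \<rightarrow> R/I\<close>: the third and fourth conditions below express
  surjectivity of the augmentation and exactness at \<open>F\<^sub>0\<close>.
\<close>

definition graded_free_resolution ::
    "('v::finite, 'k::field) mpoly set \<Rightarrow> (nat \<Rightarrow> int list) \<Rightarrow> (nat \<Rightarrow> ('v, 'k) mpoly mat) \<Rightarrow> bool" where
  "graded_free_resolution I degs A \<longleftrightarrow>
     (A 0 \<in> carrier_mat 1 (length (degs 0)) \<and>
      (\<forall>k < length (degs 0). homogeneous (A 0 $$ (0, k)) (degs 0 ! k))) \<and>
     (\<forall>i. A (Suc i) \<in> carrier_mat (length (degs i)) (length (degs (Suc i))) \<and>
        (\<forall>l < length (degs i). \<forall>k < length (degs (Suc i)).
           homogeneous (A (Suc i) $$ (l, k)) (degs (Suc i) ! k - degs i ! l))) \<and>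
     (\<forall>f. \<exists>v \<in> carrier_vec (length (degs 0)). f - (A 0 *\<^sub>v v) $ 0 \<in> I) \<and>
     mat_range (A 1) = {v \<in> carrier_vec (length (degs 0)). (A 0 *\<^sub>v v) $ 0 \<in> I} \<and>
     (\<forall>i. mat_range (A (Suc (Suc i))) = mat_kernel (A (Suc i)))"

text \<open>
  Minimality says that the image of \<open>F\<^bsub>i+1\<^esub>\<close> lies in \<open>\<mm> F\<^sub>i\<close>, where \<open>\<mm>\<close> is generated by
  the variables.  No such condition is imposed on the augmentation row \<open>A 0\<close>.
\<close>

definition minimal_graded_free_resolution ::
    "('v::finite, 'k::field) mpoly set \<Rightarrow> (nat \<Rightarrow> int list) \<Rightarrow> (nat \<Rightarrow> ('v, 'k) mpoly mat) \<Rightarrow> bool" where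
  "minimal_graded_free_resolution I degs A \<longleftrightarrow>
     graded_free_resolution I degs A \<and>
     (\<forall>i. \<forall>l < length (degs i). \<forall>k < length (degs (Suc i)).
        A (Suc i) $$ (l, k) \<in> ideal_generated (range var))"

text \<open>
  For a homogeneous ideal \<open>I\<close> a minimal graded free resolution of \<open>R/I\<close> exists and is unique up
  to isomorphism, so the graded Betti number \<open>\<beta>\<^bsub>i,j\<^esub>(R/I)\<close> does not depend on the choice.
\<close>

definition resolution_degrees :: "('v::finite, 'k::field) mpoly set \<Rightarrow> nat \<Rightarrow> int list" where
  "resolution_degrees I = (SOME degs. \<exists>A. minimal_graded_free_resolution I degs A)"

definition graded_betti :: "('v::finite, 'k::field) mpoly set \<Rightarrow> nat \<Rightarrow> int \<Rightarrow> nat" where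
  "graded_betti I i j = count_list (resolution_degrees I i) j"

text \<open>
  The Castelnuovo--Mumford regularity of \<open>R/I\<close> for a proper homogeneous ideal \<open>I\<close>.  The set is
  then nonempty, and it is finite because minimal resolutions over \<open>R\<close> have finite length.
\<close>

definition quotient_regularity :: "('v::finite, 'k::field) mpoly set \<Rightarrow> int" where
  "quotient_regularity I = Max {j - int i |i j. graded_betti I i j \<noteq> 0}"

end

theory Submission
  imports Defs
begin

text \<open>
  Upper bound: let \<open>v\<close> be a simplicial vertex of \<open>G[W]\<close> (Dirac).  Starting from \<open>J\<^sub>t(G[W - v])\<close>, add the
  generators \<open>x\<^sub>C\<close> with \<open>v \<in> C\<close> one at a time.  As \<open>v\<close> is simplicial, every colon ideal by \<open>x\<^sub>C\<close> is generated
  by the neighbours of \<open>C\<close> together with \<open>J\<^sub>t(G[W - N[C]])\<close>, and \<open>C\<close> extends every \<open>t\<close>-induced matching of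
  \<open>G[W - N[C]]\<close>.  Iterated mapping cones then give a finite graded free resolution in which every degree
  \<open>j\<close> in homological position \<open>i\<close> satisfies \<open>j - i \<le> (t - 1) \<nu>\<^sub>t(G)\<close>.

  Lower bound: for a maximum \<open>t\<close>-induced matching \<open>M\<close>, restricting \<open>J\<^sub>t(G)\<close> to the variables in \<open>\<Union>M\<close> leaves the
  ideal of the regular sequence \<open>x\<^sub>C\<close>, \<open>C \<in> M\<close>, whose Koszul resolution has degree \<open>t |M|\<close> in position \<open>|M|\<close>.

  Both bounds pass to the minimal resolution by one principle: if restriction of variables retracts
  one ideal onto another, then each degree of a minimal resolution of the smaller one occurs, in the
  same position, in every resolution of the larger one.
\<close>

section \<open>Polynomials\<close>

lift_definition restrict_keys :: "('a \<Rightarrow> bool) \<Rightarrow> ('a \<Rightarrow>\<^sub>0 'b::zero) \<Rightarrow> ('a \<Rightarrow>\<^sub>0 'b)"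
  is "\<lambda>P f m. if P m then f m else 0"
  by (rule finite_subset) auto

lemma lookup_restrict_keys:
  "Poly_Mapping.lookup (restrict_keys P f) m = (if P m then Poly_Mapping.lookup f m else 0)"
  by transfer simp

lemma keys_restrict_keys: "Poly_Mapping.keys (restrict_keys P f) = {m \<in> Poly_Mapping.keys f. P m}"
  by (auto simp: in_keys_iff lookup_restrict_keys split: if_splits)

lemma restrict_keys_zero [simp]: "restrict_keys P 0 = 0"
  by (rule poly_mapping_eqI) (simp add: lookup_restrict_keys)

lemma restrict_keys_add:
  "restrict_keys P (f + g) = restrict_keys P f + restrict_keys P (g :: 'a \<Rightarrow>\<^sub>0 'b::comm_monoid_add)"
  by (rule poly_mapping_eqI) (simp add: lookup_restrict_keys lookup_add)

lemma restrict_keys_diff: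
  "restrict_keys P (f - g) = restrict_keys P f - restrict_keys P (g :: 'a \<Rightarrow>\<^sub>0 'b::ab_group_add)"
  by (rule poly_mapping_eqI) (simp add: lookup_restrict_keys lookup_minus)

lemma restrict_keys_sum:
  "restrict_keys P (sum f S) = (\<Sum>s\<in>S. restrict_keys P (f s :: 'a \<Rightarrow>\<^sub>0 'b::comm_monoid_add))"
  by (induction S rule: infinite_finite_induct) (auto simp: restrict_keys_add)

lemma restrict_keys_eq_self: "(\<And>m. m \<in> Poly_Mapping.keys f \<Longrightarrow> P m) \<Longrightarrow> restrict_keys P f = f"
  by (rule poly_mapping_eqI) (auto simp: lookup_restrict_keys in_keys_iff)

lemma restrict_keys_eq_zero: "(\<And>m. m \<in> Poly_Mapping.keys f \<Longrightarrow> \<not> P m) \<Longrightarrow> restrict_keys P f = 0"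
  by (rule poly_mapping_eqI) (auto simp: lookup_restrict_keys in_keys_iff)

lemma restrict_keys_split:
  "f = restrict_keys P f + restrict_keys (\<lambda>m. \<not> P m) (f :: 'a \<Rightarrow>\<^sub>0 'b::comm_monoid_add)"
  by (rule poly_mapping_eqI) (auto simp: lookup_restrict_keys lookup_add)

lemma keys_mult_cases:
  assumes "m \<in> Poly_Mapping.keys (f * g)"
  obtains a b where "m = a + b" "a \<in> Poly_Mapping.keys f" "b \<in> Poly_Mapping.keys g"
  using assms keys_mult[of f g] by blast

lemma keys_nat_add: "Poly_Mapping.keys (a + b) = Poly_Mapping.keys a \<union> Poly_Mapping.keys (b :: 'v \<Rightarrow>\<^sub>0 nat)"
  by (auto simp: in_keys_iff lookup_add)

lemma restrict_keys_mult:
  fixes f g :: "'a::comm_monoid_add \<Rightarrow>\<^sub>0 'k::comm_ring_1"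
  assumes "\<And>m n. m \<in> Poly_Mapping.keys f \<Longrightarrow> P (m + n) \<longleftrightarrow> Q n"
  shows "restrict_keys P (f * g) = f * restrict_keys Q g"
proof -
  have "f * g = f * restrict_keys Q g + f * restrict_keys (\<lambda>n. \<not> Q n) g"
    using restrict_keys_split[of g Q] by (metis distrib_left)
  moreover have "restrict_keys P (f * restrict_keys Q g) = f * restrict_keys Q g"
    by (rule restrict_keys_eq_self, erule keys_mult_cases) (auto simp: keys_restrict_keys assms)
  moreover have "restrict_keys P (f * restrict_keys (\<lambda>n. \<not> Q n) g) = 0"
    by (rule restrict_keys_eq_zero, erule keys_mult_cases) (auto simp: keys_restrict_keys assms)
  ultimately show ?thesis
    by (simp add: restrict_keys_add)
qed

definition restrict_vars :: "'v set \<Rightarrow> ('v, 'k::comm_ring_1) mpoly \<Rightarrow> ('v, 'k) mpoly" where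
  "restrict_vars W = restrict_keys (\<lambda>m. Poly_Mapping.keys m \<subseteq> W)"

lemma restrict_vars_simps [simp]:
  "restrict_vars W 0 = 0"
  "restrict_vars W 1 = 1"
  "restrict_vars W (f + g) = restrict_vars W f + restrict_vars W g"
  "restrict_vars W (f - g) = restrict_vars W f - restrict_vars W g"
  by (auto simp: restrict_vars_def restrict_keys_add restrict_keys_diff intro!: restrict_keys_eq_self)

lemma restrict_vars_mult [simp]:
  "restrict_vars W (f * g) = restrict_vars W f * restrict_vars W g"
proof -
  let ?P = "\<lambda>m::'a \<Rightarrow>\<^sub>0 nat. Poly_Mapping.keys m \<subseteq> W"
  have "f * g = restrict_keys ?P f * g + restrict_keys (\<lambda>m. \<not> ?P m) f * g"
    using restrict_keys_split[of f ?P] by (metis distrib_right)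
  moreover have "restrict_keys ?P (restrict_keys ?P f * g) = restrict_keys ?P f * restrict_keys ?P g"
    by (rule restrict_keys_mult) (auto simp: keys_restrict_keys keys_nat_add)
  moreover have "restrict_keys ?P (restrict_keys (\<lambda>m. \<not> ?P m) f * g) = 0"
    by (rule restrict_keys_eq_zero, erule keys_mult_cases)
      (auto simp: keys_restrict_keys keys_nat_add)
  ultimately show ?thesis
    by (simp add: restrict_vars_def restrict_keys_add)
qed

lemma lookup_mult_zero:
  fixes f g :: "('v, 'k::comm_ring_1) mpoly"
  shows "Poly_Mapping.lookup (f * g) 0 = Poly_Mapping.lookup f 0 * Poly_Mapping.lookup g 0"
proof -
  have eq: "restrict_keys ((=) 0) h = Poly_Mapping.single 0 (Poly_Mapping.lookup h 0)"
    for h :: "('v, 'k) mpoly"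
    by (rule poly_mapping_eqI) (auto simp: lookup_restrict_keys lookup_single)
  have "restrict_keys ((=) 0) h = restrict_vars {} h" for h :: "('v, 'k) mpoly"
    unfolding restrict_vars_def by (rule poly_mapping_eqI) (auto simp: lookup_restrict_keys)
  then have "restrict_keys ((=) 0) (f * g) = restrict_keys ((=) 0) f * restrict_keys ((=) 0) g"
    by simp
  then show ?thesis
    unfolding eq by (metis mult_single add_0 lookup_single_eq)
qed

lemma mdegree_add: "mdegree (a + b) = mdegree a + mdegree b"
  by (simp add: mdegree_def lookup_add sum.distrib)

lemma mdegree_zero [simp]: "mdegree 0 = 0"
  by (simp add: mdegree_def)

lemma homogeneous_simps [simp]:
  "homogeneous 0 e" "homogeneous 1 0"
  by (auto simp: homogeneous_def)

lemma homogeneous_add: "homogeneous f e \<Longrightarrow> homogeneous g e \<Longrightarrow> homogeneous (f + g) e"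
  using keys_add[of f g] by (auto simp: homogeneous_def)

lemma homogeneous_uminus: "homogeneous f e \<Longrightarrow> homogeneous (- f) e"
  by (auto simp: homogeneous_def in_keys_iff)

lemma homogeneous_diff: "homogeneous f e \<Longrightarrow> homogeneous g e \<Longrightarrow> homogeneous (f - g) e"
  using homogeneous_add[of f e "- g"] homogeneous_uminus[of g e] by simp

lemma homogeneous_sum: "(\<And>s. s \<in> S \<Longrightarrow> homogeneous (f s) e) \<Longrightarrow> homogeneous (sum f S) e"
  by (induction S rule: infinite_finite_induct) (auto intro: homogeneous_add)

lemma homogeneous_mult: "homogeneous f a \<Longrightarrow> homogeneous g b \<Longrightarrow> a + b = e \<Longrightarrow> homogeneous (f * g) e"
  by (auto simp: homogeneous_def mdegree_add elim!: keys_mult_cases)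

lemma homogeneous_restrict_keys: "homogeneous f e \<Longrightarrow> homogeneous (restrict_keys P f) e"
  by (auto simp: homogeneous_def keys_restrict_keys)

lemma homogeneous_single_zero [simp]: "homogeneous (Poly_Mapping.single 0 c) 0"
  by (auto simp: homogeneous_def)

definition hom_part :: "int \<Rightarrow> ('v::finite, 'k::comm_ring_1) mpoly \<Rightarrow> ('v, 'k) mpoly" where
  "hom_part e = restrict_keys (\<lambda>m. int (mdegree m) = e)"

lemma homogeneous_hom_part: "homogeneous (hom_part e f) e"
  by (auto simp: homogeneous_def hom_part_def keys_restrict_keys)

lemma hom_part_eq_self: "homogeneous f e \<Longrightarrow> hom_part e f = f"
  by (auto simp: homogeneous_def hom_part_def intro: restrict_keys_eq_self)

lemma hom_part_mult: "homogeneous f a \<Longrightarrow> hom_part e (f * g) = f * hom_part (e - a) g"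
  unfolding hom_part_def by (rule restrict_keys_mult) (auto simp: homogeneous_def mdegree_add)

lemma hom_part_sum: "hom_part e (sum f S) = (\<Sum>s\<in>S. hom_part e (f s))"
  by (simp add: hom_part_def restrict_keys_sum)

lemma homogeneous_const:
  assumes "homogeneous f e" "Poly_Mapping.lookup f 0 \<noteq> 0"
  shows "e = 0"
  using assms by (force simp: homogeneous_def in_keys_iff)

lemma homogeneous_zero_const:
  fixes f :: "('v::finite, 'k::comm_ring_1) mpoly"
  assumes "homogeneous f 0"
  shows "f = Poly_Mapping.single 0 (Poly_Mapping.lookup f 0)"
proof (rule poly_mapping_eqI)
  fix m
  have "m = 0" if "Poly_Mapping.lookup f m \<noteq> 0"
  proof -
    have "mdegree m = 0" using that assms by (force simp: homogeneous_def in_keys_iff)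
    then show "m = 0"
      by (intro poly_mapping_eqI) (auto simp: mdegree_def)
  qed
  then show "Poly_Mapping.lookup f m = Poly_Mapping.lookup (Poly_Mapping.single 0 (Poly_Mapping.lookup f 0)) m"
    by (auto simp: lookup_single when_def)
qed

section \<open>Squarefree monomial ideals\<close>

abbreviation sqf_monomial :: "'v set \<Rightarrow> ('v, 'k::comm_ring_1) mpoly" where
  "sqf_monomial C \<equiv> \<Prod>x\<in>C. var x"

definition sqf_exponent :: "'v::finite set \<Rightarrow> 'v \<Rightarrow>\<^sub>0 nat" where
  "sqf_exponent C = (\<Sum>x\<in>C. Poly_Mapping.single x 1)"

lemma lookup_sqf_exponent: "Poly_Mapping.lookup (sqf_exponent C) x = (if x \<in> C then 1 else 0)"
  by (auto simp: sqf_exponent_def lookup_sum lookup_single when_def)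

lemma keys_sqf_exponent [simp]: "Poly_Mapping.keys (sqf_exponent C) = C"
  by (auto simp: in_keys_iff lookup_sqf_exponent split: if_splits)

lemma sqf_monomial_eq: "sqf_monomial C = Poly_Mapping.single (sqf_exponent C) 1"
proof -
  have "finite C" by simp
  then show ?thesis
    by (induction C) (auto simp: sqf_exponent_def var_def mult_single)
qed

lemma keys_sqf_monomial [simp]:
  "Poly_Mapping.keys (sqf_monomial C :: ('v::finite, 'k::comm_ring_1) mpoly) = {sqf_exponent C}"
  by (simp add: sqf_monomial_eq)

lemma mdegree_sqf_exponent: "mdegree (sqf_exponent C) = card C"
  by (simp add: mdegree_def lookup_sqf_exponent sum.If_cases)

lemma homogeneous_sqf_monomial: "homogeneous (sqf_monomial C) (int (card C))"
  by (simp add: homogeneous_def mdegree_sqf_exponent)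

lemma lookup_single_mult:
  fixes f :: "('v, 'k::comm_ring_1) mpoly"
  shows "Poly_Mapping.lookup (Poly_Mapping.single a 1 * f) (a + m) = Poly_Mapping.lookup f m"
proof -
  have "restrict_keys ((=) (a + m)) (Poly_Mapping.single a 1 * f)
      = Poly_Mapping.single a 1 * restrict_keys ((=) m) f"
    by (rule restrict_keys_mult) auto
  also have "restrict_keys ((=) m) f = Poly_Mapping.single m (Poly_Mapping.lookup f m)"
    by (rule poly_mapping_eqI) (auto simp: lookup_restrict_keys lookup_single)
  finally have "Poly_Mapping.lookup (restrict_keys ((=) (a + m)) (Poly_Mapping.single a 1 * f)) (a + m)
      = Poly_Mapping.lookup (Poly_Mapping.single (a + m) (Poly_Mapping.lookup f m)) (a + m)"
    by (simp add: mult_single)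
  then show ?thesis
    by (simp add: lookup_restrict_keys)
qed

lemma keys_single_mult:
  fixes f :: "('v, 'k::comm_ring_1) mpoly"
  shows "Poly_Mapping.keys (Poly_Mapping.single a 1 * f) = (+) a ` Poly_Mapping.keys f"
proof (intro equalityI subsetI)
  fix n assume "n \<in> Poly_Mapping.keys (Poly_Mapping.single a 1 * f)"
  then show "n \<in> (+) a ` Poly_Mapping.keys f"
    by (auto elim!: keys_mult_cases split: if_splits)
next
  fix n assume "n \<in> (+) a ` Poly_Mapping.keys f"
  then show "n \<in> Poly_Mapping.keys (Poly_Mapping.single a 1 * f)"
    by (auto simp: in_keys_iff lookup_single_mult)
qed

definition sqf_ideal :: "'v::finite set set \<Rightarrow> ('v, 'k::comm_ring_1) mpoly set" where
  "sqf_ideal F = {f. \<forall>m\<in>Poly_Mapping.keys f. \<exists>C\<in>F. C \<subseteq> Poly_Mapping.keys m}"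

text \<open>
  Closure under restriction of the support is what monomial ideals have beyond arbitrary ideals;
  it covers at once passing to homogeneous parts and discarding variables.
\<close>

definition restrictable_ideal :: "('v, 'k::comm_ring_1) mpoly set \<Rightarrow> bool" where
  "restrictable_ideal I \<longleftrightarrow> 0 \<in> I \<and> (\<forall>f\<in>I. \<forall>g\<in>I. f + g \<in> I) \<and> (\<forall>f\<in>I. \<forall>g. f * g \<in> I) \<and>
     (\<forall>f\<in>I. \<forall>P. restrict_keys P f \<in> I)"

lemma restrictable_idealD:
  assumes "restrictable_ideal I"
  shows "0 \<in> I" "f \<in> I \<Longrightarrow> g \<in> I \<Longrightarrow> f + g \<in> I" "f \<in> I \<Longrightarrow> f * g \<in> I" "f \<in> I \<Longrightarrow> g * f \<in> I"
    "f \<in> I \<Longrightarrow> restrict_keys P f \<in> I" "f \<in> I \<Longrightarrow> - f \<in> I" "f \<in> I \<Longrightarrow> g \<in> I \<Longrightarrow> f - g \<in> I"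
proof -
  have I: "0 \<in> I" "\<And>f g. f \<in> I \<Longrightarrow> g \<in> I \<Longrightarrow> f + g \<in> I" "\<And>f g. f \<in> I \<Longrightarrow> f * g \<in> I"
    "\<And>f P. f \<in> I \<Longrightarrow> restrict_keys P f \<in> I"
    using assms by (auto simp: restrictable_ideal_def)
  show "0 \<in> I" "f \<in> I \<Longrightarrow> g \<in> I \<Longrightarrow> f + g \<in> I" "f \<in> I \<Longrightarrow> f * g \<in> I" "f \<in> I \<Longrightarrow> restrict_keys P f \<in> I"
    by (fact I)+
  show "f \<in> I \<Longrightarrow> g * f \<in> I" using I(3)[of f g] by (simp add: mult.commute)
  show m: "f \<in> I \<Longrightarrow> - f \<in> I" for f using I(3)[of f "- 1"] by simp
  show "f \<in> I \<Longrightarrow> g \<in> I \<Longrightarrow> f - g \<in> I" using I(2)[of f "- g"] m[of g] by simp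
qed

lemma restrictable_ideal_sum:
  "restrictable_ideal I \<Longrightarrow> (\<And>s. s \<in> S \<Longrightarrow> f s \<in> I) \<Longrightarrow> sum f S \<in> I"
  by (induction S rule: infinite_finite_induct) (auto simp: restrictable_idealD)

lemma restrictable_ideal_zero: "restrictable_ideal {0}"
  by (auto simp: restrictable_ideal_def)

lemma restrictable_ideal_sqf_ideal: "restrictable_ideal (sqf_ideal F)"
proof -
  have "f + g \<in> sqf_ideal F" if "f \<in> sqf_ideal F" "g \<in> sqf_ideal F" for f g :: "('a, 'b) mpoly"
    using that keys_add[of f g] by (auto simp: sqf_ideal_def)
  moreover have "f * g \<in> sqf_ideal F" if "f \<in> sqf_ideal F" for f g :: "('a, 'b) mpoly"
    unfolding sqf_ideal_def
  proof (intro CollectI ballI)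
    fix m assume "m \<in> Poly_Mapping.keys (f * g)"
    then obtain a b where m: "m = a + b" and a: "a \<in> Poly_Mapping.keys f" by (rule keys_mult_cases)
    from that a obtain C where "C \<in> F" "C \<subseteq> Poly_Mapping.keys a" by (auto simp: sqf_ideal_def)
    then show "\<exists>C\<in>F. C \<subseteq> Poly_Mapping.keys m" by (auto simp: m keys_nat_add)
  qed
  moreover have "restrict_keys P f \<in> sqf_ideal F" if "f \<in> sqf_ideal F" for f :: "('a, 'b) mpoly" and P
    using that by (simp add: sqf_ideal_def keys_restrict_keys)
  moreover have "(0 :: ('a, 'b) mpoly) \<in> sqf_ideal F"
    by (simp add: sqf_ideal_def)
  ultimately show ?thesis
    unfolding restrictable_ideal_def by blast
qed

lemma sqf_monomial_in_sqf_ideal: "C \<in> F \<Longrightarrow> sqf_monomial C \<in> sqf_ideal F"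
  by (auto simp: sqf_ideal_def)

lemma mpoly_sum_singles:
  "f = (\<Sum>m\<in>Poly_Mapping.keys f. Poly_Mapping.single m (Poly_Mapping.lookup f m))"
  by (rule poly_mapping_eqI) (auto simp: lookup_sum lookup_single when_def in_keys_iff)

lemma ideal_generated_sqf:
  "ideal_generated (sqf_monomial ` F) = (sqf_ideal F :: ('v::finite, 'k::comm_ring_1) mpoly set)"
proof -
  interpret M: module "(*) :: ('v, 'k) mpoly \<Rightarrow> _"
    by unfold_locales (simp_all add: distrib_left distrib_right mult.assoc)
  note R = restrictable_idealD[OF restrictable_ideal_sqf_ideal]
  show ?thesis
    unfolding ideal_generated_def
  proof (intro equalityI subsetI)
    fix f :: "('v, 'k) mpoly" assume "f \<in> M.span (sqf_monomial ` F)"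
    then show "f \<in> sqf_ideal F"
      by (induction rule: M.span_induct_alt) (auto simp: R sqf_monomial_in_sqf_ideal)
  next
    fix f :: "('v, 'k) mpoly" assume f: "f \<in> sqf_ideal F"
    have "Poly_Mapping.single m c \<in> M.span (sqf_monomial ` F)" if m: "m \<in> Poly_Mapping.keys f" for m c
    proof -
      obtain C where C: "C \<in> F" "C \<subseteq> Poly_Mapping.keys m" using f m by (auto simp: sqf_ideal_def)
      have "m = (m - sqf_exponent C) + sqf_exponent C"
        using C(2) by (intro poly_mapping_eqI) (auto simp: lookup_add lookup_minus lookup_sqf_exponent in_keys_iff Suc_leI)
      then have "Poly_Mapping.single m c = Poly_Mapping.single (m - sqf_exponent C) c * sqf_monomial C"
        by (simp add: sqf_monomial_eq mult_single)
      then show ?thesis using C(1) by (auto intro: M.span_scale M.span_base)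
    qed
    then show "f \<in> M.span (sqf_monomial ` F)"
      by (subst mpoly_sum_singles) (auto intro: M.span_sum)
  qed
qed

lemma ideal_generated_vars:
  "ideal_generated (range var) = {f :: ('v::finite, 'k::comm_ring_1) mpoly. Poly_Mapping.lookup f 0 = 0}"
proof -
  have "range var = sqf_monomial ` range (\<lambda>x::'v. {x})"
    by (simp add: image_image)
  moreover have "sqf_ideal (range (\<lambda>x::'v. {x})) = {f :: ('v, 'k) mpoly. Poly_Mapping.lookup f 0 = 0}"
  proof -
    have "(\<exists>C\<in>range (\<lambda>x. {x}). C \<subseteq> Poly_Mapping.keys m) \<longleftrightarrow> m \<noteq> 0" for m :: "'v \<Rightarrow>\<^sub>0 nat"
      using in_keys_iff[of _ m] by (auto simp: poly_mapping_eq_iff fun_eq_iff)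
    then show ?thesis by (auto simp: sqf_ideal_def in_keys_iff)
  qed
  ultimately show ?thesis by (metis ideal_generated_sqf)
qed

lemma sqf_ideal_colon:
  "sqf_monomial C * f \<in> sqf_ideal F \<longleftrightarrow> f \<in> sqf_ideal ((\<lambda>D. D - C) ` F)"
  by (simp add: sqf_ideal_def sqf_monomial_eq keys_single_mult keys_nat_add Diff_subset_conv)

lemma sqf_ideal_eqI:
  assumes "\<And>C. C \<in> F \<Longrightarrow> \<exists>D\<in>H. D \<subseteq> C" "\<And>D. D \<in> H \<Longrightarrow> \<exists>C\<in>F. C \<subseteq> D"
  shows "sqf_ideal F = sqf_ideal H"
  using assms unfolding sqf_ideal_def by (meson order_trans)

lemma sqf_ideal_insert:
  fixes f :: "('v::finite, 'k::comm_ring_1) mpoly"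
  assumes "f \<in> sqf_ideal (insert C F)"
  obtains g h where "g \<in> sqf_ideal F" "f = g + sqf_monomial C * h"
proof -
  interpret M: module "(*) :: ('v, 'k) mpoly \<Rightarrow> _"
    by unfold_locales (simp_all add: distrib_left distrib_right mult.assoc)
  let ?P = "\<lambda>m::'v \<Rightarrow>\<^sub>0 nat. C \<subseteq> Poly_Mapping.keys m"
  have "restrict_keys ?P f \<in> sqf_ideal {C}" by (auto simp: sqf_ideal_def keys_restrict_keys)
  then have "restrict_keys ?P f \<in> ideal_generated (sqf_monomial ` {C})"
    by (simp only: ideal_generated_sqf)
  then obtain h where "restrict_keys ?P f = h * sqf_monomial C"
    by (auto simp: ideal_generated_def M.span_singleton)
  moreover have "restrict_keys (\<lambda>m. \<not> ?P m) f \<in> sqf_ideal F"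
    using assms by (auto simp: sqf_ideal_def keys_restrict_keys)
  ultimately show ?thesis
    using that restrict_keys_split[of f ?P] by (metis add.commute mult.commute)
qed

lemma restrict_vars_sqf_ideal:
  assumes "f \<in> sqf_ideal F" "\<And>C. C \<in> F \<Longrightarrow> C \<subseteq> W \<Longrightarrow> \<exists>D\<in>H. D \<subseteq> C"
  shows "restrict_vars W f \<in> sqf_ideal H"
  using assms unfolding sqf_ideal_def restrict_vars_def
  by (auto simp: keys_restrict_keys) (meson order_trans)

section \<open>Graded matrices\<close>

lemma index_mult_mat_sum:
  assumes "A \<in> carrier_mat n m" "B \<in> carrier_mat m p" "i < n" "j < p"
  shows "(A * B) $$ (i, j) = (\<Sum>k<m. A $$ (i, k) * B $$ (k, j))"
  using assms by (auto simp: scalar_prod_def atLeast0LessThan intro: sum.cong)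

lemma index_mult_mat_vec_sum:
  assumes "A \<in> carrier_mat n m" "v \<in> carrier_vec m" "i < n"
  shows "(A *\<^sub>v v) $ i = (\<Sum>k<m. A $$ (i, k) * v $ k)"
  using assms by (auto simp: scalar_prod_def atLeast0LessThan intro: sum.cong)

definition mat_in :: "'a set \<Rightarrow> 'a mat \<Rightarrow> bool" where
  "mat_in J M \<longleftrightarrow> (\<forall>i<dim_row M. \<forall>j<dim_col M. M $$ (i, j) \<in> J)"

definition vec_in :: "'a set \<Rightarrow> 'a vec \<Rightarrow> bool" where
  "vec_in J v \<longleftrightarrow> (\<forall>i<dim_vec v. v $ i \<in> J)"

lemma mat_in_zero_iff: "M \<in> carrier_mat n m \<Longrightarrow> mat_in {0} M \<longleftrightarrow> M = 0\<^sub>m n m"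
  by (auto simp: mat_in_def)

lemma mat_diff_add_cancel:
  fixes A B :: "'a::group_add mat"
  shows "A \<in> carrier_mat n m \<Longrightarrow> B \<in> carrier_mat n m \<Longrightarrow> A - B + B = A"
  by (intro eq_matI) auto

lemma mat_in_zero_diff:
  fixes A B :: "'a::group_add mat"
  assumes "A \<in> carrier_mat n m" "B \<in> carrier_mat n m" "mat_in {0} (A - B)"
  shows "A = B"
proof (rule eq_matI)
  fix i j assume "i < dim_row B" "j < dim_col B"
  then have "(A - B) $$ (i, j) = 0" using assms by (simp add: mat_in_def)
  then show "A $$ (i, j) = B $$ (i, j)" using \<open>i < _\<close> \<open>j < _\<close> by simp
qed (use assms in auto)

lemma mat_in_zeroI: "restrictable_ideal J \<Longrightarrow> mat_in J (0\<^sub>m n m)"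
  by (auto simp: mat_in_def restrictable_idealD)

lemma vec_in_zero_iff: "v \<in> carrier_vec n \<Longrightarrow> vec_in {0} v \<longleftrightarrow> v = 0\<^sub>v n"
  by (auto simp: vec_in_def)

lemma mat_in_mono: "J \<subseteq> J' \<Longrightarrow> mat_in J M \<Longrightarrow> mat_in J' M"
  by (auto simp: mat_in_def)

lemma mat_in_add:
  "restrictable_ideal J \<Longrightarrow> A \<in> carrier_mat n m \<Longrightarrow> B \<in> carrier_mat n m \<Longrightarrow> mat_in J A \<Longrightarrow> mat_in J B
    \<Longrightarrow> mat_in J (A + B)"
  by (auto simp: mat_in_def restrictable_idealD)

lemma mat_in_diff:
  "restrictable_ideal J \<Longrightarrow> A \<in> carrier_mat n m \<Longrightarrow> B \<in> carrier_mat n m \<Longrightarrow> mat_in J A \<Longrightarrow> mat_in J B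
    \<Longrightarrow> mat_in J (A - B)"
  by (auto simp: mat_in_def restrictable_idealD)

lemma mat_in_mult_left:
  assumes "restrictable_ideal J" "A \<in> carrier_mat n m" "B \<in> carrier_mat m p" "mat_in J B"
  shows "mat_in J (A * B)"
  unfolding mat_in_def using assms
  by (auto simp: index_mult_mat_sum[of A n m B p] mat_in_def simp del: index_mult_mat(1)
      intro!: restrictable_ideal_sum restrictable_idealD)

lemma mat_in_mult_right:
  assumes "restrictable_ideal J" "A \<in> carrier_mat n m" "B \<in> carrier_mat m p" "mat_in J A"
  shows "mat_in J (A * B)"
  unfolding mat_in_def using assms
  by (auto simp: index_mult_mat_sum[of A n m B p] mat_in_def simp del: index_mult_mat(1)
      intro!: restrictable_ideal_sum restrictable_idealD(3))

lemma vec_in_add: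
  "restrictable_ideal J \<Longrightarrow> v \<in> carrier_vec n \<Longrightarrow> w \<in> carrier_vec n \<Longrightarrow> vec_in J v \<Longrightarrow> vec_in J w
    \<Longrightarrow> vec_in J (v + w)"
  by (auto simp: vec_in_def restrictable_idealD)

lemma vec_in_diff:
  "restrictable_ideal J \<Longrightarrow> v \<in> carrier_vec n \<Longrightarrow> w \<in> carrier_vec n \<Longrightarrow> vec_in J v \<Longrightarrow> vec_in J w
    \<Longrightarrow> vec_in J (v - w)"
  by (auto simp: vec_in_def restrictable_idealD)

lemma vec_in_mult:
  assumes "restrictable_ideal J" "A \<in> carrier_mat n m" "v \<in> carrier_vec m" "vec_in J v"
  shows "vec_in J (A *\<^sub>v v)"
  unfolding vec_in_def using assms
  by (auto simp: index_mult_mat_vec_sum[of A n m v] vec_in_def simp del: index_mult_mat_vec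
      intro!: restrictable_ideal_sum restrictable_idealD)

lemma mat_in_mult_vec:
  assumes "restrictable_ideal J" "A \<in> carrier_mat n m" "v \<in> carrier_vec m" "mat_in J A"
  shows "vec_in J (A *\<^sub>v v)"
  unfolding vec_in_def using assms
  by (auto simp: index_mult_mat_vec_sum[of A n m v] mat_in_def simp del: index_mult_mat_vec
      intro!: restrictable_ideal_sum restrictable_idealD(3))

definition gmat :: "int list \<Rightarrow> int list \<Rightarrow> ('v::finite, 'k::comm_ring_1) mpoly mat \<Rightarrow> bool" where
  "gmat ds es M \<longleftrightarrow> M \<in> carrier_mat (length ds) (length es) \<and>
     (\<forall>l<length ds. \<forall>k<length es. homogeneous (M $$ (l, k)) (es ! k - ds ! l))"

lemma gmat_carrier: "gmat ds es M \<Longrightarrow> M \<in> carrier_mat (length ds) (length es)"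
  by (simp add: gmat_def)

lemma gmat_mult:
  assumes "gmat ds es A" "gmat es fs B"
  shows "gmat ds fs (A * B)"
  using assms unfolding gmat_def
  by (auto simp: index_mult_mat_sum[of A "length ds" "length es" B "length fs"]
      simp del: index_mult_mat(1) intro!: homogeneous_sum homogeneous_mult)

lemma gmat_diff: "gmat ds es A \<Longrightarrow> gmat ds es B \<Longrightarrow> gmat ds es (A - B)"
  by (auto simp: gmat_def intro!: homogeneous_diff)

lemma gmat_one: "gmat ds ds (1\<^sub>m (length ds))"
  by (auto simp: gmat_def)

lemma gmat_zero: "gmat ds es (0\<^sub>m (length ds) (length es))"
  by (auto simp: gmat_def)

section \<open>Resolutions augmented by the ring\<close>

text \<open>
  Index \<open>0\<close> is the ring itself and index \<open>Suc i\<close> is the \<open>i\<close>-th module of the resolution.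
  Working modulo \<open>I\<close> at index \<open>0\<close> and modulo \<open>0\<close> elsewhere treats the augmentation and the
  differentials uniformly.
\<close>

definition level_ideal :: "('v::finite, 'k::comm_ring_1) mpoly set \<Rightarrow> nat \<Rightarrow> ('v, 'k) mpoly set" where
  "level_ideal I i = (if i = 0 then I else {0})"

lemma level_ideal_simps [simp]:
  "level_ideal I 0 = I" "level_ideal I (Suc i) = {0}"
  by (auto simp: level_ideal_def)

lemma restrictable_level_ideal: "restrictable_ideal I \<Longrightarrow> restrictable_ideal (level_ideal I i)"
  by (simp add: level_ideal_def restrictable_ideal_zero)

definition gres ::
  "('v::finite, 'k::comm_ring_1) mpoly set \<Rightarrow> (nat \<Rightarrow> int list) \<Rightarrow> (nat \<Rightarrow> ('v, 'k) mpoly mat) \<Rightarrow> bool" where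
  "gres I dg A \<longleftrightarrow> dg 0 = [0] \<and> (\<forall>i. gmat (dg i) (dg (Suc i)) (A i)) \<and>
     (\<forall>i. mat_in (level_ideal I i) (A i * A (Suc i))) \<and>
     (\<forall>i. \<forall>v\<in>carrier_vec (length (dg i)).
        (\<forall>j. i = Suc j \<longrightarrow> vec_in (level_ideal I j) (A j *\<^sub>v v)) \<longrightarrow>
        (\<exists>w\<in>carrier_vec (length (dg (Suc i))). vec_in (level_ideal I i) (A i *\<^sub>v w - v)))"

definition minimal_diffs :: "(nat \<Rightarrow> ('v::finite, 'k::comm_ring_1) mpoly mat) \<Rightarrow> bool" where
  "minimal_diffs A \<longleftrightarrow> (\<forall>i. mat_in {f. Poly_Mapping.lookup f 0 = 0} (A (Suc i)))"

lemma gresD: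
  assumes "gres I dg A"
  shows "dg 0 = [0]" "gmat (dg i) (dg (Suc i)) (A i)"
    "A i \<in> carrier_mat (length (dg i)) (length (dg (Suc i)))"
    "mat_in (level_ideal I i) (A i * A (Suc i))"
  using assms by (auto simp: gres_def gmat_carrier)

lemma gres_mult_zero:
  assumes "gres I dg A"
  shows "A (Suc i) * A (Suc (Suc i)) = 0\<^sub>m (length (dg (Suc i))) (length (dg (Suc (Suc (Suc i)))))"
proof -
  have "A (Suc i) * A (Suc (Suc i)) \<in> carrier_mat (length (dg (Suc i))) (length (dg (Suc (Suc (Suc i)))))"
    using gresD(3)[OF assms] by (metis mult_carrier_mat)
  then show ?thesis using gresD(4)[OF assms, of "Suc i"] by (simp add: mat_in_zero_iff)
qed

lemma gres_exact:
  assumes "gres I dg A" "v \<in> carrier_vec (length (dg i))"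
    "\<And>j. i = Suc j \<Longrightarrow> vec_in (level_ideal I j) (A j *\<^sub>v v)"
  obtains w where "w \<in> carrier_vec (length (dg (Suc i)))" "vec_in (level_ideal I i) (A i *\<^sub>v w - v)"
proof -
  have "\<forall>j. i = Suc j \<longrightarrow> vec_in (level_ideal I j) (A j *\<^sub>v v)" using assms(3) by blast
  then show ?thesis using assms(1,2) that unfolding gres_def by blast
qed

lemma gres_lift:
  fixes A :: "nat \<Rightarrow> ('v::finite, 'k::comm_ring_1) mpoly mat"
  assumes A: "gres I dg A" and I: "restrictable_ideal I" and M: "gmat (dg i) es M"
    and cyc: "\<And>j. i = Suc j \<Longrightarrow> mat_in (level_ideal I j) (A j * M)"
  obtains B where "gmat (dg (Suc i)) es B" "mat_in (level_ideal I i) (A i * B - M)"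
proof -
  let ?n = "length (dg i)" and ?m = "length (dg (Suc i))" and ?p = "length es"
  have cM: "M \<in> carrier_mat ?n ?p" and cA: "A i \<in> carrier_mat ?n ?m"
    using M gresD(3)[OF A] by (auto simp: gmat_carrier)
  have "\<exists>w\<in>carrier_vec ?m. vec_in (level_ideal I i) (A i *\<^sub>v w - col M k)" if k: "k < ?p" for k
  proof (rule gres_exact[OF A])
    show "col M k \<in> carrier_vec ?n" using cM k by auto
    fix j assume j: "i = Suc j"
    have "A j *\<^sub>v col M k = col (A j * M) k" using cM k by auto
    then show "vec_in (level_ideal I j) (A j *\<^sub>v col M k)"
      using cyc[OF j] cM k by (auto simp: vec_in_def mat_in_def)
  qed blast
  then obtain w where w: "\<And>k. k < ?p \<Longrightarrow> w k \<in> carrier_vec ?m"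
    "\<And>k. k < ?p \<Longrightarrow> vec_in (level_ideal I i) (A i *\<^sub>v w k - col M k)"
    by metis
  define B where "B = mat ?m ?p (\<lambda>(l, k). hom_part (es ! k - dg (Suc i) ! l) (w k $ l))"
  have cB: "B \<in> carrier_mat ?m ?p" by (simp add: B_def)
  have "gmat (dg (Suc i)) es B"
    using cB by (auto simp: gmat_def B_def homogeneous_hom_part)
  moreover have "mat_in (level_ideal I i) (A i * B - M)"
    unfolding mat_in_def
  proof (intro allI impI)
    fix l k assume "l < dim_row (A i * B - M)" "k < dim_col (A i * B - M)"
    then have l: "l < ?n" and k: "k < ?p" using cM by auto
    let ?e = "es ! k - dg i ! l"
    have hA: "homogeneous (A i $$ (l, r)) (dg (Suc i) ! r - dg i ! l)" if "r < ?m" for r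
      using gresD(2)[OF A, of i] l that by (auto simp: gmat_def)
    have "hom_part ?e ((A i *\<^sub>v w k) $ l) = (\<Sum>r<?m. hom_part ?e (A i $$ (l, r) * w k $ r))"
      using cA w(1)[OF k] l by (simp add: index_mult_mat_vec_sum[of _ ?n ?m] hom_part_sum del: index_mult_mat_vec)
    also have "\<dots> = (\<Sum>r<?m. A i $$ (l, r) * B $$ (r, k))"
      using k by (intro sum.cong refl) (auto simp: hom_part_mult[OF hA] B_def)
    also have "\<dots> = (A i * B) $$ (l, k)"
      using cA cB l k by (simp add: index_mult_mat_sum[of _ ?n ?m _ ?p] del: index_mult_mat(1))
    finally have 1: "(A i * B) $$ (l, k) = hom_part ?e ((A i *\<^sub>v w k) $ l)" ..
    have 2: "M $$ (l, k) = hom_part ?e (M $$ (l, k))"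
      using M l k by (simp add: hom_part_eq_self gmat_def)
    have "(A i * B - M) $$ (l, k) = (A i * B) $$ (l, k) - M $$ (l, k)"
      using cM cA cB l k by simp
    also have "\<dots> = hom_part ?e ((A i *\<^sub>v w k - col M k) $ l)"
      unfolding 1 by (subst 2) (use cM cA l k in \<open>simp add: hom_part_def restrict_keys_diff\<close>)
    finally show "(A i * B - M) $$ (l, k) \<in> level_ideal I i"
      using w(2)[OF k] cM l k restrictable_level_ideal[OF I]
      by (simp add: vec_in_def hom_part_def restrictable_idealD)
  qed
  ultimately show ?thesis using that by blast
qed

lemma chain_map_lift:
  fixes A B :: "nat \<Rightarrow> ('v::finite, 'k::comm_ring_1) mpoly mat"
  assumes A: "gres I dg A" and I: "restrictable_ideal I"
    and B: "\<And>i. gmat (db i) (db (Suc i)) (B i)"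
    and Phi0: "gmat (dg 0) (db 0) Z" "mat_in I (Z * (B 0 * B 1))"
    and BB: "\<And>i. B (Suc i) * B (Suc (Suc i)) = 0\<^sub>m (length (db (Suc i))) (length (db (Suc (Suc (Suc i)))))"
  obtains \<Phi> where "\<Phi> 0 = Z" "\<And>i. gmat (dg i) (db i) (\<Phi> i)"
    "\<And>i. mat_in (level_ideal I i) (A i * \<Phi> (Suc i) - \<Phi> i * B i)"
proof -
  let ?a = "\<lambda>i. length (dg i)" and ?b = "\<lambda>i. length (db i)"
  define P where "P i F \<longleftrightarrow> gmat (dg i) (db i) F \<and> (i = 0 \<longrightarrow> F = Z) \<and>
     (\<forall>j. i = Suc j \<longrightarrow> mat_in (level_ideal I j) (A j * (F * B i)))" for i F
  define Q where "Q i F F' \<longleftrightarrow> mat_in (level_ideal I i) (A i * F' - F * B i)" for i F F'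
  have cA: "A i \<in> carrier_mat (?a i) (?a (Suc i))" for i by (rule gresD(3)[OF A])
  have cB: "B i \<in> carrier_mat (?b i) (?b (Suc i))" for i using B by (auto simp: gmat_carrier)
  have "\<exists>\<Phi>. \<forall>i. P i (\<Phi> i) \<and> Q i (\<Phi> i) (\<Phi> (Suc i))"
  proof (rule dependent_nat_choice)
    show "\<exists>F. P 0 F" using Phi0 by (auto simp: P_def)
    fix F i assume "P i F"
    then have F: "gmat (dg i) (db i) F" "i = 0 \<Longrightarrow> F = Z"
      "\<And>j. i = Suc j \<Longrightarrow> mat_in (level_ideal I j) (A j * (F * B i))"
      by (auto simp: P_def)
    have cF: "F \<in> carrier_mat (?a i) (?b i)" using F(1) by (rule gmat_carrier)
    obtain F' where F': "gmat (dg (Suc i)) (db (Suc i)) F'"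
      "mat_in (level_ideal I i) (A i * F' - F * B i)"
      using gres_lift[OF A I gmat_mult[OF F(1) B] F(3)] by blast
    have cF': "F' \<in> carrier_mat (?a (Suc i)) (?b (Suc i))" using F'(1) by (rule gmat_carrier)
    note J = restrictable_level_ideal[OF I, of i]
    have "mat_in (level_ideal I i) (F * (B i * B (Suc i)))"
    proof (cases i)
      case 0 then show ?thesis using F(2) Phi0(2) by simp
    next
      case (Suc j)
      have "F * (B i * B (Suc i)) = 0\<^sub>m (?a i) (?b (Suc (Suc i)))"
        using cF BB[of j] by (simp add: Suc)
      then show ?thesis using J by (simp add: mat_in_zeroI)
    qed
    moreover have "mat_in (level_ideal I i) ((A i * F' - F * B i) * B (Suc i))"
      by (rule mat_in_mult_right[OF J minus_carrier_mat[OF mult_carrier_mat[OF cF cB]] cB F'(2)])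
    moreover have "(A i * F' - F * B i) * B (Suc i) \<in> carrier_mat (?a i) (?b (Suc (Suc i)))"
      by (rule mult_carrier_mat[OF minus_carrier_mat[OF mult_carrier_mat[OF cF cB]] cB])
    moreover have "F * (B i * B (Suc i)) \<in> carrier_mat (?a i) (?b (Suc (Suc i)))"
      by (rule mult_carrier_mat[OF cF mult_carrier_mat[OF cB cB]])
    ultimately have "mat_in (level_ideal I i) ((A i * F' - F * B i) * B (Suc i) + F * (B i * B (Suc i)))"
      using mat_in_add[OF J] by blast
    also have "(A i * F' - F * B i) * B (Suc i) + F * (B i * B (Suc i)) = A i * (F' * B (Suc i))"
    proof -
      have "(A i * F' - F * B i) * B (Suc i) = A i * F' * B (Suc i) - F * B i * B (Suc i)"
        by (rule minus_mult_distrib_mat[OF mult_carrier_mat[OF cA cF'] mult_carrier_mat[OF cF cB] cB])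
      moreover have "A i * F' * B (Suc i) = A i * (F' * B (Suc i))"
        by (rule assoc_mult_mat[OF cA cF' cB])
      moreover have "F * B i * B (Suc i) = F * (B i * B (Suc i))"
        by (rule assoc_mult_mat[OF cF cB cB])
      ultimately show ?thesis
        using mat_diff_add_cancel[OF mult_carrier_mat[OF cA mult_carrier_mat[OF cF' cB]]
            mult_carrier_mat[OF cF mult_carrier_mat[OF cB cB]]] by simp
    qed
    finally show "\<exists>F'. P (Suc i) F' \<and> Q i F F'" using F' by (auto simp: P_def Q_def)
  qed
  then obtain \<Phi> where "\<And>i. P i (\<Phi> i)" "\<And>i. Q i (\<Phi> i) (\<Phi> (Suc i))" by blast
  then show ?thesis using that[of \<Phi>] by (simp add: P_def Q_def)
qed

lemma chain_map_null_homotopic: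
  fixes A T :: "nat \<Rightarrow> ('v::finite, 'k::comm_ring_1) mpoly mat"
  assumes A: "gres I dg A" and I: "restrictable_ideal I"
    and T: "\<And>i. gmat (dg i) (dg i) (T i)" and T0: "T 0 = 0\<^sub>m 1 1"
    and comm: "\<And>i. mat_in (level_ideal I i) (A i * T (Suc i) - T i * A i)"
  obtains h where "h 0 = 0\<^sub>m (length (dg 1)) 1" "\<And>i. h i \<in> carrier_mat (length (dg (Suc i))) (length (dg i))"
    "\<And>i. T (Suc i) = A (Suc i) * h (Suc i) + h i * A i"
proof -
  let ?a = "\<lambda>i. length (dg i)"
  have cA: "A i \<in> carrier_mat (?a i) (?a (Suc i))" for i by (rule gresD(3)[OF A])
  have cT: "T i \<in> carrier_mat (?a i) (?a i)" for i using T by (auto simp: gmat_carrier)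
  have a0: "?a 0 = 1" using gresD(1)[OF A] by simp
  define P where "P i h \<longleftrightarrow> gmat (dg (Suc i)) (dg i) h \<and> (i = 0 \<longrightarrow> h = 0\<^sub>m (?a 1) 1) \<and>
     mat_in (level_ideal I i) (A i * (T (Suc i) - h * A i))" for i h
  define Q where "Q i h h' \<longleftrightarrow> T (Suc i) = A (Suc i) * h' + h * A i" for i h h'
  have "\<exists>h. \<forall>i. P i (h i) \<and> Q i (h i) (h (Suc i))"
  proof (rule dependent_nat_choice)
    have "gmat (dg (Suc 0)) (dg 0) (0\<^sub>m (?a 1) 1 :: ('v, 'k) mpoly mat)"
      using gmat_zero[of "dg (Suc 0)" "dg 0"] a0 by simp
    moreover have "A 0 * (T (Suc 0) - 0\<^sub>m (?a 1) 1 * A 0) = A 0 * T (Suc 0) - T 0 * A 0"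
      using cA[of 0] cT[of "Suc 0"] a0 unfolding T0
      by (intro eq_matI) (auto simp: minus_add_uminus_mat)
    ultimately show "\<exists>h. P 0 h" using comm[of 0] unfolding P_def by (intro exI[of _ "0\<^sub>m (?a 1) 1"]) simp
  next
    fix h i assume "P i h"
    then have h: "gmat (dg (Suc i)) (dg i) h" "i = 0 \<Longrightarrow> h = 0\<^sub>m (?a 1) 1"
      "mat_in (level_ideal I i) (A i * (T (Suc i) - h * A i))"
      by (auto simp: P_def)
    have ch: "h \<in> carrier_mat (?a (Suc i)) (?a i)" using h(1) by (rule gmat_carrier)
    have chA: "h * A i \<in> carrier_mat (?a (Suc i)) (?a (Suc i))" by (rule mult_carrier_mat[OF ch cA])
    have "gmat (dg (Suc i)) (dg (Suc i)) (T (Suc i) - h * A i)"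
      by (rule gmat_diff[OF T gmat_mult[OF h(1) gresD(2)[OF A]]])
    from gres_lift[OF A I this] h(3) obtain h' where h': "gmat (dg (Suc (Suc i))) (dg (Suc i)) h'"
      "mat_in {0} (A (Suc i) * h' - (T (Suc i) - h * A i))"
      by auto
    have ch': "h' \<in> carrier_mat (?a (Suc (Suc i))) (?a (Suc i))" using h'(1) by (rule gmat_carrier)
    have cAh: "A (Suc i) * h' \<in> carrier_mat (?a (Suc i)) (?a (Suc i))" by (rule mult_carrier_mat[OF cA ch'])
    have "A (Suc i) * h' = T (Suc i) - h * A i"
      using mat_in_zero_diff[OF cAh minus_carrier_mat[OF chA] h'(2)] .
    then have T1: "T (Suc i) = A (Suc i) * h' + h * A i"
      using mat_diff_add_cancel[OF cT[of "Suc i"] chA] by simp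
    have 0: "A (Suc i) * T (Suc (Suc i)) = T (Suc i) * A (Suc i)"
      using mat_in_zero_diff[OF mult_carrier_mat[OF cA cT] mult_carrier_mat[OF cT cA]] comm[of "Suc i"]
      by (simp only: level_ideal_simps)
    have hAA: "h * (A i * A (Suc i)) = 0\<^sub>m (?a (Suc i)) (?a (Suc (Suc i)))"
    proof (cases i)
      case 0 then show ?thesis using h(2) cA[of 0] cA[of 1] a0 by simp
    next
      case (Suc j) then show ?thesis using gres_mult_zero[OF A, of j] ch by simp
    qed
    have "A (Suc i) * (T (Suc (Suc i)) - h' * A (Suc i))
        = A (Suc i) * T (Suc (Suc i)) - A (Suc i) * (h' * A (Suc i))"
      by (rule mult_minus_distrib_mat[OF cA cT mult_carrier_mat[OF ch' cA]])
    also have "A (Suc i) * (h' * A (Suc i)) = A (Suc i) * h' * A (Suc i)"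
      by (rule assoc_mult_mat[OF cA ch' cA, symmetric])
    also have "A (Suc i) * T (Suc (Suc i)) = A (Suc i) * h' * A (Suc i) + h * A i * A (Suc i)"
      unfolding 0 T1 by (rule add_mult_distrib_mat[OF cAh chA cA])
    also have "h * A i * A (Suc i) = 0\<^sub>m (?a (Suc i)) (?a (Suc (Suc i)))"
      using assoc_mult_mat[OF ch cA cA] hAA by simp
    finally have "A (Suc i) * (T (Suc (Suc i)) - h' * A (Suc i)) = 0\<^sub>m (?a (Suc i)) (?a (Suc (Suc i)))"
      using mult_carrier_mat[OF cAh cA] by simp
    then have "mat_in {0} (A (Suc i) * (T (Suc (Suc i)) - h' * A (Suc i)))"
      by (simp add: mat_in_def)
    then show "\<exists>h'. P (Suc i) h' \<and> Q i h h'" using h'(1) T1 by (auto simp: P_def Q_def)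
  qed
  then obtain h where "\<And>i. P i (h i)" "\<And>i. Q i (h i) (h (Suc i))" by blast
  then show ?thesis using that[of h] by (auto simp: P_def Q_def gmat_carrier)
qed

lemma minimal_null_homotopic_const:
  fixes A T :: "nat \<Rightarrow> ('v::finite, 'k::comm_ring_1) mpoly mat"
  assumes A: "gres I dg A" and I: "restrictable_ideal I" and min: "minimal_diffs A"
    and T: "\<And>i. gmat (dg i) (dg i) (T i)" and T0: "T 0 = 0\<^sub>m 1 1"
    and comm: "\<And>i. mat_in (level_ideal I i) (A i * T (Suc i) - T i * A i)"
    and k: "k < length (dg (Suc i))"
  shows "Poly_Mapping.lookup (T (Suc i) $$ (k, k)) 0 = 0"
proof -
  let ?a = "\<lambda>i. length (dg i)"
  have cA: "A i \<in> carrier_mat (?a i) (?a (Suc i))" for i by (rule gresD(3)[OF A])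
  have a0: "?a 0 = 1" using gresD(1)[OF A] by simp
  obtain h where h: "h 0 = 0\<^sub>m (?a 1) 1" "\<And>i. h i \<in> carrier_mat (?a (Suc i)) (?a i)"
    "\<And>i. T (Suc i) = A (Suc i) * h (Suc i) + h i * A i"
    using chain_map_null_homotopic[OF A I T T0 comm] by metis
  have m: "Poly_Mapping.lookup (A (Suc i) $$ (l, r)) 0 = 0" if "l < ?a (Suc i)" "r < ?a (Suc (Suc i))" for i l r
    using min cA[of "Suc i"] that unfolding minimal_diffs_def mat_in_def by auto
  have "Poly_Mapping.lookup ((A (Suc i) * h (Suc i)) $$ (k, k)) 0 = 0"
    using k by (simp add: index_mult_mat_sum[OF cA h(2)] lookup_sum lookup_mult_zero m del: index_mult_mat(1))
  moreover have "Poly_Mapping.lookup ((h i * A i) $$ (k, k)) 0 = 0"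
  proof (cases i)
    case 0 then show ?thesis using k h(1) cA[of 0] a0 by simp
  next
    case (Suc j) then show ?thesis
      using k by (simp add: index_mult_mat_sum[OF h(2) cA] lookup_sum lookup_mult_zero m del: index_mult_mat(1))
  qed
  moreover have "T (Suc i) $$ (k, k) = (A (Suc i) * h (Suc i)) $$ (k, k) + (h i * A i) $$ (k, k)"
    using k h(2)[of i] cA[of i] by (simp add: h(3) del: index_mult_mat(1))
  ultimately show ?thesis by (simp add: lookup_add)
qed

section \<open>Comparison of degrees\<close>

lemma mat_diff_add_diff:
  fixes X Y Z :: "'a::ab_group_add mat"
  assumes "X \<in> carrier_mat n m" "Y \<in> carrier_mat n m" "Z \<in> carrier_mat n m"
  shows "X - Y + (Y - Z) = X - Z"
  using assms by (intro eq_matI) auto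

lemma mat_diff_diff_cancel:
  fixes X Y Z :: "'a::ab_group_add mat"
  assumes "X \<in> carrier_mat n m" "Y \<in> carrier_mat n m" "Z \<in> carrier_mat n m"
  shows "X - Z - (Y - Z) = X - Y"
  using assms by (intro eq_matI) auto

lemma chain_square_mult:
  assumes J: "restrictable_ideal J"
    and c: "A \<in> carrier_mat n0 n1" "P' \<in> carrier_mat n1 m1" "P \<in> carrier_mat n0 m0"
      "B \<in> carrier_mat m0 m1" "Q' \<in> carrier_mat m1 p1" "Q \<in> carrier_mat m0 p0" "C \<in> carrier_mat p0 p1"
    and sq: "mat_in J (A * P' - P * B)" "mat_in J (B * Q' - Q * C)"
  shows "mat_in J (A * (P' * Q') - (P * Q) * C)"
proof -
  have cs: "A * P' \<in> carrier_mat n0 m1" "P * B \<in> carrier_mat n0 m1" "B * Q' \<in> carrier_mat m0 p1"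
    "Q * C \<in> carrier_mat m0 p1"
    using c by auto
  have "mat_in J ((A * P' - P * B) * Q')"
    by (rule mat_in_mult_right[OF J minus_carrier_mat[OF cs(2)] c(5) sq(1)])
  moreover have "mat_in J (P * (B * Q' - Q * C))"
    by (rule mat_in_mult_left[OF J c(3) minus_carrier_mat[OF cs(4)] sq(2)])
  ultimately have "mat_in J ((A * P' - P * B) * Q' + P * (B * Q' - Q * C))"
    by (rule mat_in_add[OF J mult_carrier_mat[OF minus_carrier_mat[OF cs(2)] c(5)]
        mult_carrier_mat[OF c(3) minus_carrier_mat[OF cs(4)]]])
  also have "(A * P' - P * B) * Q' = A * (P' * Q') - P * (B * Q')"
    using c by (simp add: minus_mult_distrib_mat[OF cs(1,2) c(5)] assoc_mult_mat[OF c(1,2,5)]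
        assoc_mult_mat[OF c(3,4,5)])
  also have "P * (B * Q' - Q * C) = P * (B * Q') - P * Q * C"
    by (simp add: mult_minus_distrib_mat[OF c(3) cs(3,4)] assoc_mult_mat[OF c(3,6,7)])
  also have "A * (P' * Q') - P * (B * Q') + (P * (B * Q') - P * Q * C) = A * (P' * Q') - P * Q * C"
    by (rule mat_diff_add_diff) (use c cs in auto)
  finally show ?thesis .
qed

lemma ring_hom_restrict_vars: "ring_hom (restrict_vars W :: ('v, 'k::comm_ring_1) mpoly \<Rightarrow> _)"
  by unfold_locales simp_all

lemma map_mat_restrict_vars_mult:
  fixes A B :: "('v, 'k::comm_ring_1) mpoly mat"
  assumes "A \<in> carrier_mat n m" "B \<in> carrier_mat m p"
  shows "map_mat (restrict_vars W) (A * B) = map_mat (restrict_vars W) A * map_mat (restrict_vars W) B"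
proof -
  interpret ring_hom "restrict_vars W :: ('v, 'k) mpoly \<Rightarrow> _" by (rule ring_hom_restrict_vars)
  show ?thesis by (rule mat_hom_mult[OF assms])
qed

lemma map_mat_restrict_vars_diff:
  "A \<in> carrier_mat n m \<Longrightarrow> B \<in> carrier_mat n m \<Longrightarrow>
    map_mat (restrict_vars W) (A - B) = map_mat (restrict_vars W) A - map_mat (restrict_vars W) B"
  by (intro eq_matI) auto

lemma gmat_restrict_vars: "gmat ds es M \<Longrightarrow> gmat ds es (map_mat (restrict_vars W) M)"
  by (auto simp: gmat_def restrict_vars_def homogeneous_restrict_keys)

lemma mat_in_map_mat: "mat_in J M \<Longrightarrow> (\<And>f. f \<in> J \<Longrightarrow> g f \<in> J') \<Longrightarrow> mat_in J' (map_mat g M)"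
  by (auto simp: mat_in_def)

text \<open>
  Restricting variables turns a resolution over a larger ideal into a complex, through which the
  identity of the minimal resolution factors up to homotopy; the homotopy vanishes modulo the
  variables.
\<close>

lemma minimal_degrees_subset:
  fixes A B :: "nat \<Rightarrow> ('v::finite, 'k::field) mpoly mat"
  assumes A: "gres I dA A" and I: "restrictable_ideal I" and min: "minimal_diffs A"
    and B: "gres I' dB B" and I': "restrictable_ideal I'" and sub: "I \<subseteq> I'"
    and fixed: "\<And>i. map_mat (restrict_vars W) (A i) = A i"
    and retr: "\<And>f. f \<in> I' \<Longrightarrow> restrict_vars W f \<in> I"
  shows "set (dA i) \<subseteq> set (dB i)"
proof (cases i)
  case 0 then show ?thesis using gresD(1)[OF A] gresD(1)[OF B] by simp
next
  case (Suc i')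
  let ?r = "map_mat (restrict_vars W)" and ?a = "\<lambda>i. length (dA i)" and ?b = "\<lambda>i. length (dB i)"
  have cA: "A i \<in> carrier_mat (?a i) (?a (Suc i))" for i by (rule gresD(3)[OF A])
  have cB: "B i \<in> carrier_mat (?b i) (?b (Suc i))" for i by (rule gresD(3)[OF B])
  have d0: "dA 0 = [0]" "dB 0 = [0]" using gresD(1)[OF A] gresD(1)[OF B] by auto
  have g1: "gmat [0] [0] (1\<^sub>m 1 :: ('v, 'k) mpoly mat)" using gmat_one[of "[0]"] by simp
  have cAA: "A i * A (Suc i) \<in> carrier_mat (?a i) (?a (Suc (Suc i)))" for i
    by (rule mult_carrier_mat[OF cA cA])
  have cBB: "B i * B (Suc i) \<in> carrier_mat (?b i) (?b (Suc (Suc i)))" for i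
    by (rule mult_carrier_mat[OF cB cB])
  have 1: "mat_in I' (1\<^sub>m 1 * (A 0 * A 1))"
    using cAA[of 0] gresD(4)[OF A, of 0] mat_in_mono[OF sub] left_mult_one_mat[of "A 0 * A 1" 1] by (simp add: d0)
  obtain F where F: "F 0 = 1\<^sub>m 1" "\<And>i. gmat (dB i) (dA i) (F i)"
    "\<And>i. mat_in (level_ideal I' i) (B i * F (Suc i) - F i * A i)"
  proof (rule chain_map_lift[OF B I', where B = A and db = dA and Z = "1\<^sub>m 1"])
    show "gmat (dA i) (dA (Suc i)) (A i)" for i by (rule gresD(2)[OF A])
    show "gmat (dB 0) (dA 0) (1\<^sub>m 1 :: ('v, 'k) mpoly mat)" using g1 by (simp only: d0)
    show "mat_in I' (1\<^sub>m 1 * (A 0 * A 1))" by (rule 1)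
  qed (rule gres_mult_zero[OF A], rule that)
  have cF: "F i \<in> carrier_mat (?b i) (?a i)" for i using F(2) by (rule gmat_carrier)
  have crB: "?r (B i) \<in> carrier_mat (?b i) (?b (Suc i))" for i using cB by simp
  have crF: "?r (F i) \<in> carrier_mat (?b i) (?a i)" for i using cF by simp
  have retr': "f \<in> level_ideal I' i \<Longrightarrow> restrict_vars W f \<in> level_ideal I i" for f i
    using retr by (auto simp: level_ideal_def)
  have rBB: "?r (B i) * ?r (B (Suc i)) = ?r (B i * B (Suc i))" for i
    by (rule map_mat_restrict_vars_mult[OF cB cB, symmetric])
  have 2: "mat_in I (1\<^sub>m 1 * (?r (B 0) * ?r (B 1)))"
    using cBB[of 0] gresD(4)[OF B, of 0] mat_in_map_mat[OF _ retr, where M = "B 0 * B 1"] rBB[of 0]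
      left_mult_one_mat[of "?r (B 0) * ?r (B 1)" 1] mult_carrier_mat[OF crB crB, of 0]
    by (simp add: d0)
  have 3: "?r (B (Suc i)) * ?r (B (Suc (Suc i))) = 0\<^sub>m (?b (Suc i)) (?b (Suc (Suc (Suc i))))" for i
    unfolding rBB gres_mult_zero[OF B] by (intro eq_matI) auto
  obtain G where G: "G 0 = 1\<^sub>m 1" "\<And>i. gmat (dA i) (dB i) (G i)"
    "\<And>i. mat_in (level_ideal I i) (A i * G (Suc i) - G i * ?r (B i))"
  proof (rule chain_map_lift[OF A I, where B = "\<lambda>i. ?r (B i)" and db = dB and Z = "1\<^sub>m 1"])
    show "gmat (dB i) (dB (Suc i)) (?r (B i))" for i by (intro gmat_restrict_vars gresD(2)[OF B])
    show "gmat (dA 0) (dB 0) (1\<^sub>m 1 :: ('v, 'k) mpoly mat)" using g1 by (simp only: d0)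
    show "mat_in I (1\<^sub>m 1 * (?r (B 0) * ?r (B 1)))" by (rule 2)
  qed (rule 3, rule that)
  have cG: "G i \<in> carrier_mat (?a i) (?b i)" for i using G(2) by (rule gmat_carrier)
  have rF: "mat_in (level_ideal I i) (?r (B i) * ?r (F (Suc i)) - ?r (F i) * A i)" for i
  proof -
    have "?r (B i * F (Suc i) - F i * A i) = ?r (B i) * ?r (F (Suc i)) - ?r (F i) * A i"
      by (simp only: map_mat_restrict_vars_diff[OF mult_carrier_mat[OF cB cF] mult_carrier_mat[OF cF cA]]
          map_mat_restrict_vars_mult[OF cB cF] map_mat_restrict_vars_mult[OF cF cA] fixed)
    then show ?thesis using mat_in_map_mat[OF F(3)[of i], where g = "restrict_vars W", OF retr'] by (simp only:)
  qed
  define T where "T i = G i * ?r (F i) - 1\<^sub>m (?a i)" for i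
  have cGF: "G i * ?r (F i) \<in> carrier_mat (?a i) (?a i)" for i by (rule mult_carrier_mat[OF cG crF])
  have T: "gmat (dA i) (dA i) (T i)" for i
    unfolding T_def by (intro gmat_diff gmat_mult[OF G(2) gmat_restrict_vars[OF F(2)]] gmat_one)
  have r1: "?r (1\<^sub>m 1) = (1\<^sub>m 1 :: ('v, 'k) mpoly mat)" by (intro eq_matI) auto
  have T0: "T 0 = 0\<^sub>m 1 1" by (simp add: T_def F(1) G(1) r1[unfolded One_nat_def] d0)
  have comm: "mat_in (level_ideal I i) (A i * T (Suc i) - T i * A i)" for i
  proof -
    have sq: "mat_in (level_ideal I i) (A i * (G (Suc i) * ?r (F (Suc i))) - (G i * ?r (F i)) * A i)"
      by (rule chain_square_mult[OF restrictable_level_ideal[OF I] cA cG cG crB crF crF cA G(3) rF])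
    have "A i * T (Suc i) = A i * (G (Suc i) * ?r (F (Suc i))) - A i"
      unfolding T_def mult_minus_distrib_mat[OF cA cGF one_carrier_mat] using cA[of i] by simp
    moreover have "T i * A i = (G i * ?r (F i)) * A i - A i"
      unfolding T_def minus_mult_distrib_mat[OF cGF one_carrier_mat cA] using cA[of i] by simp
    ultimately have "A i * T (Suc i) - T i * A i = A i * (G (Suc i) * ?r (F (Suc i))) - (G i * ?r (F i)) * A i"
      using mat_diff_diff_cancel[OF mult_carrier_mat[OF cA cGF] mult_carrier_mat[OF cGF cA] cA] by (simp only:)
    with sq show ?thesis by (simp only:)
  qed
  show ?thesis
  proof
    fix d assume "d \<in> set (dA i)"
    then obtain k where k: "k < ?a i" "d = dA i ! k" by (auto simp: in_set_conv_nth)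
    have "Poly_Mapping.lookup (T i $$ (k, k)) 0 = 0"
      using minimal_null_homotopic_const[OF A I min T T0 comm] k Suc by auto
    then have "Poly_Mapping.lookup ((G i * ?r (F i)) $$ (k, k)) 0 = 1"
      using k cGF[of i] by (simp add: T_def lookup_minus del: index_mult_mat(1))
    then have "(\<Sum>l<?b i. Poly_Mapping.lookup (G i $$ (k, l)) 0 * Poly_Mapping.lookup (?r (F i) $$ (l, k)) 0) \<noteq> 0"
      using k by (simp add: index_mult_mat_sum[OF cG crF] lookup_sum lookup_mult_zero del: index_mult_mat(1) index_map_mat(1))
    then obtain l where l: "l < ?b i" "Poly_Mapping.lookup (?r (F i) $$ (l, k)) 0 \<noteq> 0"
      by (metis (no_types, lifting) lessThan_iff mult_zero_right sum.not_neutral_contains_not_neutral)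
    have "homogeneous (?r (F i) $$ (l, k)) (dA i ! k - dB i ! l)"
      using gmat_restrict_vars[OF F(2)] l k unfolding gmat_def by blast
    then have "dA i ! k = dB i ! l" using homogeneous_const l(2) by fastforce
    then show "d \<in> set (dB i)" using l k by simp
  qed
qed

section \<open>Mapping cones\<close>

lemma mat_in_four_block:
  assumes "A \<in> carrier_mat n m" "B \<in> carrier_mat n m'" "C \<in> carrier_mat n' m" "D \<in> carrier_mat n' m'"
    "mat_in J A" "mat_in J B" "mat_in J C" "mat_in J D"
  shows "mat_in J (four_block_mat A B C D)"
  using assms unfolding mat_in_def by (auto simp: Let_def)

lemma gmat_four_block:
  assumes "gmat ds es A" "gmat ds es' B" "gmat ds' es C" "gmat ds' es' D"
  shows "gmat (ds @ ds') (es @ es') (four_block_mat A B C D)"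
  using assms unfolding gmat_def by (auto simp: nth_append)

lemma gmat_uminus: "gmat ds es A \<Longrightarrow> gmat ds es (- A)"
  by (auto simp: gmat_def homogeneous_uminus)

lemma gmat_shift: "gmat ds es A \<Longrightarrow> gmat (map ((+) c) ds) (map ((+) c) es) A"
  by (auto simp: gmat_def)

lemma mat_in_uminus: "restrictable_ideal J \<Longrightarrow> mat_in J A \<Longrightarrow> mat_in J (- A)"
  by (auto simp: mat_in_def restrictable_idealD)

fun cone_shift :: "int \<Rightarrow> (nat \<Rightarrow> int list) \<Rightarrow> nat \<Rightarrow> int list" where
  "cone_shift c dg 0 = []"
| "cone_shift c dg (Suc 0) = []"
| "cone_shift c dg (Suc (Suc i)) = map ((+) c) (dg (Suc i))"

definition cone_degrees :: "int \<Rightarrow> (nat \<Rightarrow> int list) \<Rightarrow> (nat \<Rightarrow> int list) \<Rightarrow> nat \<Rightarrow> int list" where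
  "cone_degrees c dg dg' i = dg i @ cone_shift c dg' i"

definition cone_corner :: "(nat \<Rightarrow> 'a::zero mat) \<Rightarrow> nat \<Rightarrow> 'a mat" where
  "cone_corner Phi i = (if i = 0 then 0\<^sub>m 1 0 else Phi i)"

fun cone_tail :: "(nat \<Rightarrow> int list) \<Rightarrow> (nat \<Rightarrow> 'a::ring_1 mat) \<Rightarrow> nat \<Rightarrow> 'a mat" where
  "cone_tail dg A 0 = 0\<^sub>m 0 0"
| "cone_tail dg A (Suc 0) = 0\<^sub>m 0 (length (dg 1))"
| "cone_tail dg A (Suc (Suc i)) = - A (Suc i)"

definition cone_diff ::
  "(nat \<Rightarrow> int list) \<Rightarrow> (nat \<Rightarrow> 'a::ring_1 mat) \<Rightarrow> (nat \<Rightarrow> 'a mat) \<Rightarrow> (nat \<Rightarrow> 'a mat) \<Rightarrow> nat \<Rightarrow> 'a mat" where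
  "cone_diff dg' A A' Phi i =
     four_block_mat (A i) (cone_corner Phi i)
       (0\<^sub>m (length (cone_shift 0 dg' i)) (dim_col (A i))) (cone_tail dg' A' i)"

lemma length_cone_shift: "length (cone_shift c dg i) = length (cone_shift 0 dg i)"
  by (cases "(c, dg, i)" rule: cone_shift.cases) auto

lemma all_less_add_iff: "(\<forall>i<n + m. P i) \<longleftrightarrow> (\<forall>i<n. P i) \<and> (\<forall>i<m. P (n + i))" for n m :: nat
  by (metis add_less_cancel_left le_add_diff_inverse linorder_not_less trans_less_add1)

lemma vec_in_append: "vec_in J (v @\<^sub>v w) \<longleftrightarrow> vec_in J v \<and> vec_in J w"
  by (simp add: vec_in_def all_less_add_iff)

lemma vec_in_zero_diff:
  fixes v w :: "'a::group_add vec"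
  assumes "v \<in> carrier_vec n" "w \<in> carrier_vec n" "vec_in {0} (v - w)"
  shows "v = w"
proof (rule eq_vecI)
  fix i assume i: "i < dim_vec w"
  then have "(v - w) $ i = 0" using assms by (simp add: vec_in_def)
  then show "v $ i = w $ i" using i by simp
qed (use assms in auto)

lemma vec_diff_add_cancel:
  fixes v w :: "'a::group_add vec"
  shows "v \<in> carrier_vec n \<Longrightarrow> w \<in> carrier_vec n \<Longrightarrow> v - w + w = v"
  by (intro eq_vecI) auto

lemma vec_add_uminus_cancel:
  fixes v w :: "'a::group_add vec"
  shows "v \<in> carrier_vec n \<Longrightarrow> w \<in> carrier_vec n \<Longrightarrow> v + w + - w = v"
  by (intro eq_vecI) (auto simp: add.assoc)

lemma vec_append_split:
  assumes "v \<in> carrier_vec (n + m)"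
  obtains a b where "v = a @\<^sub>v b" "a \<in> carrier_vec n" "b \<in> carrier_vec m"
  by (rule that[OF vec_first_last_append[OF assms, symmetric]]) auto

lemma gres_cone:
  fixes A A' Phi :: "nat \<Rightarrow> ('v::finite, 'k::comm_ring_1) mpoly mat"
  assumes A: "gres I dg A" and I: "restrictable_ideal I"
    and A': "gres I' dg' A'" and I': "restrictable_ideal I'"
    and K: "restrictable_ideal K" "I \<subseteq> K" "x \<in> K"
    and split: "\<And>f. f \<in> K \<Longrightarrow> \<exists>g h. g \<in> I \<and> f = g + x * h"
    and colon: "\<And>f. x * f \<in> I \<longleftrightarrow> f \<in> I'"
    and Phi: "\<And>i. gmat (dg i) (map ((+) c) (dg' i)) (Phi i)" "Phi 0 = mat 1 1 (\<lambda>_. x)"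
      "\<And>i. mat_in (level_ideal I i) (A i * Phi (Suc i) - Phi i * A' i)"
  shows "gres K (cone_degrees c dg dg') (cone_diff dg' A A' Phi)"
proof -
  let ?a = "\<lambda>i. length (dg i)" and ?b = "\<lambda>i. length (dg' i)" and ?e = "\<lambda>i. length (cone_shift 0 dg' i)"
  let ?U = "cone_corner Phi" and ?V = "cone_tail dg' A'" and ?C = "cone_diff dg' A A' Phi"
  note [simp] = length_cone_shift[of c dg']
  have cA: "A i \<in> carrier_mat (?a i) (?a (Suc i))" for i by (rule gresD(3)[OF A])
  have cA': "A' i \<in> carrier_mat (?b i) (?b (Suc i))" for i by (rule gresD(3)[OF A'])
  have cPhi: "Phi i \<in> carrier_mat (?a i) (?b i)" for i using gmat_carrier[OF Phi(1)] by simp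
  have d0: "dg 0 = [0]" "dg' 0 = [0]" using gresD(1)[OF A] gresD(1)[OF A'] by auto
  have gU: "gmat (dg i) (cone_shift c dg' (Suc i)) (?U i)" for i
  proof (cases i)
    case 0 then show ?thesis by (auto simp: cone_corner_def gmat_def d0)
  next
    case (Suc j) then show ?thesis using Phi(1)[of i] by (simp add: cone_corner_def)
  qed
  have gV: "gmat (cone_shift c dg' i) (cone_shift c dg' (Suc i)) (?V i)" for i
  proof -
    consider "i = 0" | "i = Suc 0" | j where "i = Suc (Suc j)" by (metis not0_implies_Suc)
    then show ?thesis
    proof cases
      case 3
      then show ?thesis by (simp add: gmat_uminus[OF gmat_shift[OF gresD(2)[OF A']]])
    qed (simp_all add: gmat_def)
  qed
  have cU: "?U i \<in> carrier_mat (?a i) (?e (Suc i))" for i using gmat_carrier[OF gU[of i]] by simp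
  have cV: "?V i \<in> carrier_mat (?e i) (?e (Suc i))" for i using gmat_carrier[OF gV[of i]] by simp
  have C: "?C i = four_block_mat (A i) (?U i) (0\<^sub>m (?e i) (?a (Suc i))) (?V i)" for i
    using cA[of i] by (simp add: cone_diff_def)
  have c0: "0\<^sub>m (?e i) (?a (Suc i)) \<in> carrier_mat (?e i) (?a (Suc i))" for i by simp
  have gC: "gmat (cone_degrees c dg dg' i) (cone_degrees c dg dg' (Suc i)) (?C i)" for i
    unfolding C cone_degrees_def
    by (intro gmat_four_block gresD(2)[OF A] gU gV) (simp add: gmat_def)
  have sq: "A (Suc i) * Phi (Suc (Suc i)) = Phi (Suc i) * A' (Suc i)" for i
    using mat_in_zero_diff[OF mult_carrier_mat[OF cA cPhi] mult_carrier_mat[OF cPhi cA']] Phi(3)[of "Suc i"]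
    by (simp only: level_ideal_simps)
  have cc: "mat_in (level_ideal K i) (?C i * ?C (Suc i))" for i
  proof -
    note JK = restrictable_level_ideal[OF K(1), of i]
    have eq: "?C i * ?C (Suc i) = four_block_mat
        (A i * A (Suc i) + ?U i * 0\<^sub>m (?e (Suc i)) (?a (Suc (Suc i)))) (A i * ?U (Suc i) + ?U i * ?V (Suc i))
        (0\<^sub>m (?e i) (?a (Suc i)) * A (Suc i) + ?V i * 0\<^sub>m (?e (Suc i)) (?a (Suc (Suc i))))
        (0\<^sub>m (?e i) (?a (Suc i)) * ?U (Suc i) + ?V i * ?V (Suc i))"
      unfolding C by (rule mult_four_block_mat[OF cA cU c0 cV cA cU c0 cV])
    have 1: "mat_in (level_ideal K i) (A i * A (Suc i) + ?U i * 0\<^sub>m (?e (Suc i)) (?a (Suc (Suc i))))"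
    proof -
      have "mat_in (level_ideal K i) (A i * A (Suc i))"
        by (rule mat_in_mono[OF _ gresD(4)[OF A]]) (use K(2) in \<open>auto simp: level_ideal_def\<close>)
      moreover have "A i * A (Suc i) + ?U i * 0\<^sub>m (?e (Suc i)) (?a (Suc (Suc i))) = A i * A (Suc i)"
        using mult_carrier_mat[OF cA cA, of i] cU[of i] cA[of i] cA[of "Suc i"] by simp
      ultimately show ?thesis by simp
    qed
    have 3: "mat_in (level_ideal K i) (0\<^sub>m (?e i) (?a (Suc i)) * A (Suc i) + ?V i * 0\<^sub>m (?e (Suc i)) (?a (Suc (Suc i))))"
      using cA[of "Suc i"] cV[of i] mat_in_zeroI[OF JK] by simp
    have 4: "mat_in (level_ideal K i) (0\<^sub>m (?e i) (?a (Suc i)) * ?U (Suc i) + ?V i * ?V (Suc i))"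
    proof -
      have "?V i * ?V (Suc i) = 0\<^sub>m (?e i) (?e (Suc (Suc i)))"
      proof -
        consider "i = 0" | "i = Suc 0" | j where "i = Suc (Suc j)" by (metis not0_implies_Suc)
        then show ?thesis
        proof cases
          case 3
          then show ?thesis using gres_mult_zero[OF A', of j] cA'[of "Suc j"] cA'[of "Suc (Suc j)"] by simp
        next
          case 2
          then show ?thesis using cA'[of 1] by (intro eq_matI) auto
        qed simp
      qed
      then show ?thesis using cU[of "Suc i"] mat_in_zeroI[OF JK] by simp
    qed
    have 2: "mat_in (level_ideal K i) (A i * ?U (Suc i) + ?U i * ?V (Suc i))"
    proof (cases i)
      case 0
      have "mat_in K (A 0 * Phi 1 - Phi 0 * A' 0)" using mat_in_mono[OF K(2)] Phi(3)[of 0] by simp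
      moreover have "mat_in K (Phi 0 * A' 0)"
        by (rule mat_in_mult_right[OF K(1) cPhi cA']) (simp add: Phi(2) mat_in_def K(3))
      ultimately have "mat_in K (A 0 * Phi 1 - Phi 0 * A' 0 + Phi 0 * A' 0)"
        using mat_in_add[OF K(1) minus_carrier_mat] mult_carrier_mat[OF cPhi cA'] by blast
      also have "A 0 * Phi 1 - Phi 0 * A' 0 + Phi 0 * A' 0 = A 0 * Phi 1"
        using mat_diff_add_cancel[OF mult_carrier_mat[OF cA cPhi] mult_carrier_mat[OF cPhi cA'], of 0] by simp
      finally have "mat_in K (A 0 * Phi 1)" .
      moreover have "?U 0 * ?V 1 = 0\<^sub>m 1 (?b 1)" by (simp add: cone_corner_def d0)
      moreover have "A 0 * Phi 1 \<in> carrier_mat 1 (?b 1)" using mult_carrier_mat[OF cA cPhi, of 0] by (simp add: d0)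
      ultimately show ?thesis unfolding 0 by (simp add: cone_corner_def)
    next
      case (Suc j)
      have "A i * ?U (Suc i) + ?U i * ?V (Suc i) = 0\<^sub>m (?a i) (?b (Suc i))"
        using sq[of j] cPhi[of "Suc j"] cA'[of "Suc j"]
        by (intro eq_matI) (auto simp: Suc cone_corner_def)
      then show ?thesis using mat_in_zeroI[OF JK] by simp
    qed
    show ?thesis unfolding eq
      by (rule mat_in_four_block[OF add_carrier_mat[OF mult_carrier_mat[OF cU c0]]
            add_carrier_mat[OF mult_carrier_mat[OF cU cV]] add_carrier_mat[OF mult_carrier_mat[OF cV c0]]
            add_carrier_mat[OF mult_carrier_mat[OF cV cV]] 1 2 3 4])
  qed
  have ex: "\<exists>w\<in>carrier_vec (length (cone_degrees c dg dg' (Suc i))). vec_in (level_ideal K i) (?C i *\<^sub>v w - v)"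
    if v: "v \<in> carrier_vec (length (cone_degrees c dg dg' i))"
      and cyc: "\<And>j. i = Suc j \<Longrightarrow> vec_in (level_ideal K j) (?C j *\<^sub>v v)" for i v
  proof -
    have Cv: "?C i *\<^sub>v (w @\<^sub>v u) = (A i *\<^sub>v w + ?U i *\<^sub>v u) @\<^sub>v (?V i *\<^sub>v u)"
      if w: "w \<in> carrier_vec (?a (Suc i))" and u: "u \<in> carrier_vec (?e (Suc i))" for w u i
    proof -
      have "0\<^sub>m (?e i) (?a (Suc i)) *\<^sub>v w + ?V i *\<^sub>v u = ?V i *\<^sub>v u"
        using cV[of i] u w by (intro eq_vecI) (auto simp: scalar_prod_def)
      then show ?thesis
        unfolding C using four_block_mat_mult_vec[OF cA cU c0 cV w u] by simp
    qed
    have C0: "?C 0 = A 0"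
      using cA[of 0] by (intro eq_matI) (auto simp: C cone_corner_def d0)
    have A0Phi: "(A 0 *\<^sub>v (Phi 1 *\<^sub>v u)) $ 0 - x * (A' 0 *\<^sub>v u) $ 0 \<in> I" if u: "u \<in> carrier_vec (?b 1)" for u
    proof -
      have c1: "A 0 * Phi 1 \<in> carrier_mat 1 (?b 1)" "Phi 0 * A' 0 \<in> carrier_mat 1 (?b 1)"
        using mult_carrier_mat[OF cA cPhi, of 0] mult_carrier_mat[OF cPhi cA', of 0] by (simp_all add: d0)
      have "vec_in I ((A 0 * Phi 1 - Phi 0 * A' 0) *\<^sub>v u)"
        by (rule mat_in_mult_vec[OF I minus_carrier_mat[OF c1(2)] u]) (use Phi(3)[of 0] in simp)
      also have "(A 0 * Phi 1 - Phi 0 * A' 0) *\<^sub>v u = A 0 *\<^sub>v (Phi 1 *\<^sub>v u) - Phi 0 *\<^sub>v (A' 0 *\<^sub>v u)"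
        using minus_mult_distrib_mat_vec[OF c1 u] assoc_mult_mat_vec[OF cA, of "Phi 1" 0]
          assoc_mult_mat_vec[OF cPhi cA', of u 0] cPhi[of 1] u by simp
      finally have "(A 0 *\<^sub>v (Phi 1 *\<^sub>v u) - Phi 0 *\<^sub>v (A' 0 *\<^sub>v u)) $ 0 \<in> I"
        using cPhi[of 0] by (simp add: vec_in_def d0 del: index_mult_mat_vec)
      moreover have "(Phi 0 *\<^sub>v (A' 0 *\<^sub>v u)) $ 0 = x * (A' 0 *\<^sub>v u) $ 0"
        using cA'[of 0] u index_mult_mat_vec_sum[OF cPhi[of 0], of "A' 0 *\<^sub>v u" 0]
        by (simp add: d0 Phi(2) del: index_mult_mat_vec)
      ultimately show ?thesis
        using cPhi[of 0] by (simp add: d0 del: index_mult_mat_vec)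
    qed
    consider "i = 0" | "i = Suc 0" | j where "i = Suc (Suc j)" by (metis not0_implies_Suc)
    then show ?thesis
    proof cases
      case 1
      then have "v \<in> carrier_vec (?a 0)" using v by (simp add: cone_degrees_def)
      then obtain w where "w \<in> carrier_vec (?a 1)" "vec_in I (A 0 *\<^sub>v w - v)"
        using gres_exact[OF A, of v 0] by auto
      then show ?thesis
        using K(2) by (auto simp: 1 C0 cone_degrees_def vec_in_def simp del: index_minus_vec intro!: bexI[of _ w])
    next
      case 2
      then have v1: "v \<in> carrier_vec (?a 1)" using v by (simp add: cone_degrees_def)
      have "(A 0 *\<^sub>v v) $ 0 \<in> K" using cyc[of 0] 2 cA[of 0] by (simp add: C0 vec_in_def d0 del: index_mult_mat_vec)
      then obtain g h where gh: "g \<in> I" "(A 0 *\<^sub>v v) $ 0 = g + x * h" using split by blast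
      obtain u where u: "u \<in> carrier_vec (?b 1)" "vec_in I' (A' 0 *\<^sub>v u - vec 1 (\<lambda>_. h))"
        using gres_exact[OF A', of "vec 1 (\<lambda>_. h)" 0] by (auto simp: d0)
      have "(A' 0 *\<^sub>v u) $ 0 - h \<in> I'" using u(2) by (simp add: vec_in_def del: index_mult_mat_vec)
      then have "x * ((A' 0 *\<^sub>v u) $ 0 - h) \<in> I" by (simp only: colon)
      then have "g - ((A 0 *\<^sub>v (Phi 1 *\<^sub>v u)) $ 0 - x * (A' 0 *\<^sub>v u) $ 0) - x * ((A' 0 *\<^sub>v u) $ 0 - h) \<in> I"
        using gh(1) A0Phi[OF u(1)] restrictable_idealD(7)[OF I] by blast
      also have "g - ((A 0 *\<^sub>v (Phi 1 *\<^sub>v u)) $ 0 - x * (A' 0 *\<^sub>v u) $ 0) - x * ((A' 0 *\<^sub>v u) $ 0 - h)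
          = (A 0 *\<^sub>v v) $ 0 - (A 0 *\<^sub>v (Phi 1 *\<^sub>v u)) $ 0"
        unfolding gh(2) by (simp add: algebra_simps del: index_mult_mat_vec)
      finally have I0: "(A 0 *\<^sub>v v) $ 0 - (A 0 *\<^sub>v (Phi 1 *\<^sub>v u)) $ 0 \<in> I" .
      have cPu: "Phi 1 *\<^sub>v u \<in> carrier_vec (?a 1)" using cPhi[of 1] by (intro carrier_vecI) simp
      have "vec_in I (A 0 *\<^sub>v (v - Phi 1 *\<^sub>v u))"
        using mult_minus_distrib_mat_vec[OF cA v1[unfolded One_nat_def] cPu[unfolded One_nat_def]] I0 cA[of 0]
        by (simp add: vec_in_def d0 del: index_mult_mat_vec)
      then obtain w where w: "w \<in> carrier_vec (?a 2)" "vec_in {0} (A 1 *\<^sub>v w - (v - Phi 1 *\<^sub>v u))"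
        using gres_exact[OF A, of "v - Phi 1 *\<^sub>v u" 1] minus_carrier_vec[OF v1 cPu]
        by (auto simp: numeral_2_eq_2)
      have cAw: "A 1 *\<^sub>v w \<in> carrier_vec (?a 1)" using cA[of 1] by (intro carrier_vecI) simp
      have "A 1 *\<^sub>v w = v - Phi 1 *\<^sub>v u"
        using vec_in_zero_diff[OF cAw minus_carrier_vec[OF v1 cPu] w(2)] .
      then have Aw: "A 1 *\<^sub>v w + Phi 1 *\<^sub>v u = v" using vec_diff_add_cancel[OF v1 cPu] by (simp only:)
      have "?C 1 *\<^sub>v (w @\<^sub>v u) = v @\<^sub>v (0\<^sub>v 0)"
        using Cv[of w 1 u] w(1) u(1) Aw by (auto simp: numeral_2_eq_2 cone_corner_def)
      also have "\<dots> = v" by (intro eq_vecI) auto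
      finally have "vec_in {0} (?C 1 *\<^sub>v (w @\<^sub>v u) - v)" using v1 by (simp add: vec_in_def)
      moreover have "w @\<^sub>v u \<in> carrier_vec (length (cone_degrees c dg dg' 2))"
        using w(1) u(1) by (auto simp: cone_degrees_def numeral_2_eq_2)
      ultimately show ?thesis unfolding 2 by (auto simp: numeral_2_eq_2)
    next
      case (3 j)
      obtain a b where ab: "v = a @\<^sub>v b" "a \<in> carrier_vec (?a (Suc (Suc j)))" "b \<in> carrier_vec (?b (Suc j))"
        using vec_append_split[of v "?a i" "?e i"] v by (auto simp: 3 cone_degrees_def)
      have "vec_in {0} ((A (Suc j) *\<^sub>v a + Phi (Suc j) *\<^sub>v b) @\<^sub>v (?V (Suc j) *\<^sub>v b))"
        using cyc[OF 3] Cv[of a "Suc j" b] ab by (simp add: cone_corner_def)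
      then have z: "vec_in {0} (A (Suc j) *\<^sub>v a + Phi (Suc j) *\<^sub>v b)" "vec_in {0} (?V (Suc j) *\<^sub>v b)"
        by (simp_all add: vec_in_append)
      have cAa: "A (Suc j) *\<^sub>v a \<in> carrier_vec (?a (Suc j))" using cA[of "Suc j"] by (intro carrier_vecI) simp
      have cPb: "Phi (Suc j) *\<^sub>v b \<in> carrier_vec (?a (Suc j))" using cPhi[of "Suc j"] by (intro carrier_vecI) simp
      have z1: "A (Suc j) *\<^sub>v a + Phi (Suc j) *\<^sub>v b = 0\<^sub>v (?a (Suc j))"
        using z(1) vec_in_zero_iff add_carrier_vec[OF cAa cPb] by blast
      have "vec_in (level_ideal I' j) (A' j *\<^sub>v b)"
      proof (cases j)
        case 0
        have "A 0 *\<^sub>v (A 1 *\<^sub>v a) + A 0 *\<^sub>v (Phi 1 *\<^sub>v b) = 0\<^sub>v 1"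
        proof -
          have "A 0 *\<^sub>v 0\<^sub>v (?a 1) = 0\<^sub>v 1" using cA[of 0] by (intro eq_vecI) (auto simp: d0 scalar_prod_def)
          then show ?thesis
            using arg_cong[OF z1, of "\<lambda>v. A 0 *\<^sub>v v"] mult_add_distrib_mat_vec[OF cA, of _ 0] cAa cPb cA[of 0]
            by (auto simp: 0 d0)
        qed
        then have "(A 0 *\<^sub>v (A 1 *\<^sub>v a) + A 0 *\<^sub>v (Phi 1 *\<^sub>v b)) $ 0 = 0" by simp
        then have s: "(A 0 *\<^sub>v (A 1 *\<^sub>v a)) $ 0 + (A 0 *\<^sub>v (Phi 1 *\<^sub>v b)) $ 0 = 0"
          using cA[of 0] by (simp add: d0 del: index_mult_mat_vec)
        have "vec_in I ((A 0 * A 1) *\<^sub>v a)"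
          by (rule mat_in_mult_vec[OF I mult_carrier_mat[OF cA]]) (use gresD(4)[OF A, of 0] cA[of 1] ab 0 in auto)
        also have "(A 0 * A 1) *\<^sub>v a = A 0 *\<^sub>v (A 1 *\<^sub>v a)"
          using assoc_mult_mat_vec[OF cA, of "A 1" 0] cA[of 1] ab 0 by auto
        finally have AA: "(A 0 *\<^sub>v (A 1 *\<^sub>v a)) $ 0 \<in> I" using cA[of 0] by (simp add: vec_in_def d0 del: index_mult_mat_vec)
        have "- (A 0 *\<^sub>v (A 1 *\<^sub>v a)) $ 0 - ((A 0 *\<^sub>v (Phi 1 *\<^sub>v b)) $ 0 - x * (A' 0 *\<^sub>v b) $ 0) \<in> I"
          using A0Phi[of b] ab 0 AA restrictable_idealD(6,7)[OF I] by simp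
        also have "- (A 0 *\<^sub>v (A 1 *\<^sub>v a)) $ 0 - ((A 0 *\<^sub>v (Phi 1 *\<^sub>v b)) $ 0 - x * (A' 0 *\<^sub>v b) $ 0)
            = x * (A' 0 *\<^sub>v b) $ 0"
          using s by (simp add: algebra_simps eq_neg_iff_add_eq_0 del: index_mult_mat_vec)
        finally show ?thesis using cA'[of 0] by (simp add: 0 vec_in_def d0 colon del: index_mult_mat_vec)
      next
        case (Suc l)
        have "vec_in {0} (- (A' j) *\<^sub>v b)" using z(2) by (simp add: Suc)
        then show ?thesis using cA'[of j] ab(3) Suc by (auto simp: vec_in_def)
      qed
      then obtain u where u: "u \<in> carrier_vec (?b (Suc (Suc j)))" "vec_in {0} (A' (Suc j) *\<^sub>v u - b)"
        using gres_exact[OF A' ab(3)] by auto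
      have cAu: "A' (Suc j) *\<^sub>v u \<in> carrier_vec (?b (Suc j))" using cA'[of "Suc j"] by (intro carrier_vecI) simp
      have u': "A' (Suc j) *\<^sub>v u = b" by (rule vec_in_zero_diff[OF cAu ab(3) u(2)])
      have cPu: "Phi (Suc (Suc j)) *\<^sub>v u \<in> carrier_vec (?a (Suc (Suc j)))" using cPhi[of "Suc (Suc j)"] by (intro carrier_vecI) simp
      have "A (Suc j) *\<^sub>v (a + Phi (Suc (Suc j)) *\<^sub>v u) = A (Suc j) *\<^sub>v a + (A (Suc j) * Phi (Suc (Suc j))) *\<^sub>v u"
        using mult_add_distrib_mat_vec[OF cA ab(2) cPu] assoc_mult_mat_vec[OF cA cPhi u(1)] by simp
      also have "\<dots> = A (Suc j) *\<^sub>v a + Phi (Suc j) *\<^sub>v (A' (Suc j) *\<^sub>v u)"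
        unfolding sq using assoc_mult_mat_vec[OF cPhi cA' u(1)] by simp
      finally have "A (Suc j) *\<^sub>v (a + Phi (Suc (Suc j)) *\<^sub>v u) = 0\<^sub>v (?a (Suc j))"
        using z1 u' by simp
      then have "vec_in {0} (A (Suc j) *\<^sub>v (a + Phi (Suc (Suc j)) *\<^sub>v u))"
        by (simp add: vec_in_def)
      then obtain w where w: "w \<in> carrier_vec (?a (Suc i))" "vec_in {0} (A i *\<^sub>v w - (a + Phi i *\<^sub>v u))"
        using gres_exact[OF A add_carrier_vec[OF ab(2) cPu]] by (auto simp: 3)
      have cAw: "A i *\<^sub>v w \<in> carrier_vec (?a i)" using cA[of i] by (intro carrier_vecI) simp
      have "A i *\<^sub>v w = a + Phi i *\<^sub>v u"
        using vec_in_zero_diff[OF cAw _ w(2)] add_carrier_vec[OF ab(2) cPu] 3 by simp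
      moreover have "Phi i *\<^sub>v (- u) = - (Phi i *\<^sub>v u)"
        using cPhi[of i] u(1) by (intro eq_vecI) (auto simp: 3)
      ultimately have 1: "A i *\<^sub>v w + Phi i *\<^sub>v (- u) = a"
        using vec_add_uminus_cancel[OF ab(2) cPu] 3 by (simp only:)
      have "- A' (Suc j) *\<^sub>v (- u) = A' (Suc j) *\<^sub>v u"
        using cA'[of "Suc j"] u(1) by (intro eq_vecI) auto
      then have "?C i *\<^sub>v (w @\<^sub>v (- u)) = a @\<^sub>v b"
        using Cv[of w i "- u"] w(1) u(1) 1 u' by (simp add: 3 cone_corner_def)
      then have "vec_in {0} (?C i *\<^sub>v (w @\<^sub>v (- u)) - v)"
        using ab by (simp add: vec_in_def)
      moreover have "w @\<^sub>v (- u) \<in> carrier_vec (length (cone_degrees c dg dg' (Suc i)))"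
        using w(1) u(1) by (auto simp: cone_degrees_def 3)
      ultimately show ?thesis unfolding 3 by auto
    qed
  qed
  show ?thesis unfolding gres_def
    using gC cc ex by (auto simp: cone_degrees_def d0)
qed

section \<open>Graded free resolutions of quotients\<close>

lemma mat_col_unit_vec:
  fixes A :: "'a::semiring_1 mat"
  assumes "A \<in> carrier_mat n m" "k < m"
  shows "A *\<^sub>v unit_vec m k = col A k"
  using assms by (intro eq_vecI) auto

lemma gres_of_graded_free_resolution:
  fixes A :: "nat \<Rightarrow> ('v::finite, 'k::field) mpoly mat"
  assumes r: "graded_free_resolution I degs A" and I: "restrictable_ideal I"
  shows "gres I (case_nat [0] degs) A"
proof -
  let ?dg = "case_nat [0] degs"
  have r0: "A 0 \<in> carrier_mat 1 (length (degs 0))"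
    "\<And>k. k < length (degs 0) \<Longrightarrow> homogeneous (A 0 $$ (0, k)) (degs 0 ! k)"
    and r1: "\<And>i. A (Suc i) \<in> carrier_mat (length (degs i)) (length (degs (Suc i)))"
    "\<And>i l k. l < length (degs i) \<Longrightarrow> k < length (degs (Suc i)) \<Longrightarrow>
      homogeneous (A (Suc i) $$ (l, k)) (degs (Suc i) ! k - degs i ! l)"
    and r2: "\<And>f. \<exists>v \<in> carrier_vec (length (degs 0)). f - (A 0 *\<^sub>v v) $ 0 \<in> I"
    and r3: "mat_range (A 1) = {v \<in> carrier_vec (length (degs 0)). (A 0 *\<^sub>v v) $ 0 \<in> I}"
    and r4: "\<And>i. mat_range (A (Suc (Suc i))) = mat_kernel (A (Suc i))"
    using r unfolding graded_free_resolution_def by auto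
  have g: "gmat (?dg i) (?dg (Suc i)) (A i)" for i
    using r0 r1 by (cases i) (auto simp: gmat_def)
  have cA: "A i \<in> carrier_mat (length (?dg i)) (length (?dg (Suc i)))" for i
    using g by (rule gmat_carrier)
  have range: "vec_in (level_ideal I i) (A i *\<^sub>v v) \<longleftrightarrow> v \<in> mat_range (A (Suc i))"
    if v: "v \<in> carrier_vec (length (?dg (Suc i)))" for i v
  proof (cases i)
    case 0
    then show ?thesis using v r0(1) r3 by (auto simp: vec_in_def simp del: index_mult_mat_vec)
  next
    case (Suc j)
    have "A i *\<^sub>v v \<in> carrier_vec (length (?dg i))" using cA[of i] by (intro carrier_vecI) simp
    then show ?thesis using v r4[of j] cA[of i] by (simp add: mat_kernel_def vec_in_zero_iff Suc)
  qed
  have "mat_in (level_ideal I i) (A i * A (Suc i))" for i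
    unfolding mat_in_def
  proof (intro allI impI)
    fix l k assume lk: "l < dim_row (A i * A (Suc i))" "k < dim_col (A i * A (Suc i))"
    have "col (A (Suc i)) k \<in> mat_range (A (Suc i))"
      using mat_col_unit_vec[OF cA, of k "Suc i"] lk cA[of "Suc i"] unfolding mat_range_def by (metis carrier_matD(2) image_eqI index_mult_mat(3) unit_vec_carrier)
    then have "vec_in (level_ideal I i) (A i *\<^sub>v col (A (Suc i)) k)"
      using range[of "col (A (Suc i)) k" i] cA[of "Suc i"] by (auto simp: carrier_vecI)
    then show "(A i * A (Suc i)) $$ (l, k) \<in> level_ideal I i"
      using lk by (auto simp: vec_in_def)
  qed
  moreover have "\<exists>w\<in>carrier_vec (length (?dg (Suc i))). vec_in (level_ideal I i) (A i *\<^sub>v w - v)"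
    if v: "v \<in> carrier_vec (length (?dg i))"
      and cyc: "\<And>j. i = Suc j \<Longrightarrow> vec_in (level_ideal I j) (A j *\<^sub>v v)" for i v
  proof (cases i)
    case 0
    obtain w where w: "w \<in> carrier_vec (length (degs 0))" "v $ 0 - (A 0 *\<^sub>v w) $ 0 \<in> I"
      using r2 by blast
    have "- (v $ 0 - (A 0 *\<^sub>v w) $ 0) \<in> I" using restrictable_idealD(6)[OF I w(2)] .
    then have "vec_in I (A 0 *\<^sub>v w - v)"
      using r0 v by (simp add: vec_in_def 0 del: index_mult_mat_vec)
    then show ?thesis using w(1) by (auto simp: 0)
  next
    case (Suc j)
    then have "v \<in> mat_range (A i)" using range[of v j] cyc v by simp
    then obtain w where w: "w \<in> carrier_vec (dim_col (A i))" "v = A i *\<^sub>v w"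
      by (auto simp: mat_range_def)
    have "vec_in (level_ideal I i) (A i *\<^sub>v w - v)" by (simp add: w(2) vec_in_def Suc)
    then show ?thesis using w(1) cA[of i] by auto
  qed
  ultimately show ?thesis using g by (simp add: gres_def)
qed

lemma graded_free_resolution_of_gres:
  fixes A :: "nat \<Rightarrow> ('v::finite, 'k::field) mpoly mat"
  assumes A: "gres I dg A" and I: "restrictable_ideal I"
  shows "graded_free_resolution I (\<lambda>i. dg (Suc i)) A"
proof -
  have cA: "A i \<in> carrier_mat (length (dg i)) (length (dg (Suc i)))" for i by (rule gresD(3)[OF A])
  have d0: "dg 0 = [0]" by (rule gresD(1)[OF A])
  have cAv: "A i *\<^sub>v v \<in> carrier_vec (length (dg i))" for i v using cA[of i] by (intro carrier_vecI) simp
  have g: "homogeneous (A i $$ (l, k)) (dg (Suc i) ! k - dg i ! l)"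
    if "l < length (dg i)" "k < length (dg (Suc i))" for i l k
    using gresD(2)[OF A, of i] that by (auto simp: gmat_def)
  have "\<exists>v \<in> carrier_vec (length (dg (Suc 0))). f - (A 0 *\<^sub>v v) $ 0 \<in> I" for f
  proof -
    obtain w where w: "w \<in> carrier_vec (length (dg (Suc 0)))" "vec_in I (A 0 *\<^sub>v w - vec 1 (\<lambda>_. f))"
      using gres_exact[OF A, of "vec 1 (\<lambda>_. f)" 0] by (auto simp: d0)
    have "(A 0 *\<^sub>v w) $ 0 - f \<in> I" using w(2) by (simp add: vec_in_def del: index_mult_mat_vec)
    then have "- ((A 0 *\<^sub>v w) $ 0 - f) \<in> I" by (rule restrictable_idealD(6)[OF I])
    then show ?thesis using w(1) by auto
  qed
  moreover have range: "v \<in> mat_range (A (Suc i)) \<longleftrightarrow>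
      v \<in> carrier_vec (length (dg (Suc i))) \<and> vec_in (level_ideal I i) (A i *\<^sub>v v)" (is "?l \<longleftrightarrow> ?r") for i v
  proof
    assume ?l
    then obtain u where u: "u \<in> carrier_vec (length (dg (Suc (Suc i))))" "v = A (Suc i) *\<^sub>v u"
      using cA[of "Suc i"] by (auto simp: mat_range_def)
    have "vec_in (level_ideal I i) ((A i * A (Suc i)) *\<^sub>v u)"
      by (rule mat_in_mult_vec[OF restrictable_level_ideal[OF I] mult_carrier_mat[OF cA cA] u(1) gresD(4)[OF A]])
    then show ?r using cAv u assoc_mult_mat_vec[OF cA cA u(1)] by simp
  next
    assume r: ?r
    then obtain w where w: "w \<in> carrier_vec (length (dg (Suc (Suc i))))" "vec_in {0} (A (Suc i) *\<^sub>v w - v)"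
      using gres_exact[OF A, of v "Suc i"] by auto
    have "A (Suc i) *\<^sub>v w = v" using vec_in_zero_diff[OF cAv _ w(2)] r by blast
    then show ?l using w(1) cA[of "Suc i"] unfolding mat_range_def by auto
  qed
  moreover have "mat_range (A 1) = {v \<in> carrier_vec (length (dg (Suc 0))). (A 0 *\<^sub>v v) $ 0 \<in> I}"
    using range[of _ 0] cA[of 0] by (auto simp: vec_in_def d0 simp del: index_mult_mat_vec)
  moreover have "mat_range (A (Suc (Suc i))) = mat_kernel (A (Suc i))" for i
    using range[of _ "Suc i"] cA[of "Suc i"] vec_in_zero_iff[OF cAv[of "Suc i"]] by (auto simp: mat_kernel_def)
  ultimately show ?thesis
    unfolding graded_free_resolution_def using cA g cA[of 0] g[of 0 0] by (auto simp: d0)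
qed

lemma mat_in_carrier:
  "M \<in> carrier_mat n m \<Longrightarrow> mat_in J M \<longleftrightarrow> (\<forall>l<n. \<forall>k<m. M $$ (l, k) \<in> J)"
  by (auto simp: mat_in_def)

lemma minimal_gres_of_minimal_graded_free_resolution:
  fixes A :: "nat \<Rightarrow> ('v::finite, 'k::field) mpoly mat"
  assumes "minimal_graded_free_resolution I degs A" "restrictable_ideal I"
  shows "gres I (case_nat [0] degs) A" "minimal_diffs A"
proof -
  show g: "gres I (case_nat [0] degs) A"
    using assms gres_of_graded_free_resolution by (auto simp: minimal_graded_free_resolution_def)
  show "minimal_diffs A"
    using assms(1) mat_in_carrier[OF gresD(3)[OF g]]
    by (simp add: minimal_diffs_def minimal_graded_free_resolution_def ideal_generated_vars)
qed

lemma minimal_graded_free_resolution_of_gres: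
  fixes A :: "nat \<Rightarrow> ('v::finite, 'k::field) mpoly mat"
  assumes "gres I dg A" "minimal_diffs A" "restrictable_ideal I"
  shows "minimal_graded_free_resolution I (\<lambda>i. dg (Suc i)) A"
  using assms graded_free_resolution_of_gres mat_in_carrier[OF gresD(3)[OF assms(1)]]
  by (simp add: minimal_diffs_def minimal_graded_free_resolution_def ideal_generated_vars)

section \<open>Existence of minimal resolutions\<close>

lemma mat_diff_zero:
  fixes A :: "'a::group_add mat"
  shows "A \<in> carrier_mat n m \<Longrightarrow> A - 0\<^sub>m n m = A"
  by (intro eq_matI) auto

lemma mat_in_diff_iff:
  assumes "restrictable_ideal J" "A \<in> carrier_mat n m" "B \<in> carrier_mat n m" "mat_in J (A - B)"
  shows "mat_in J A \<longleftrightarrow> mat_in J B"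
proof
  assume "mat_in J A"
  then have "mat_in J (A - (A - B))"
    by (rule mat_in_diff[OF assms(1,2) minus_carrier_mat[OF assms(3)] _ assms(4)])
  also have "A - (A - B) = B" using assms(2,3) by (intro eq_matI) auto
  finally show "mat_in J B" .
next
  assume "mat_in J B"
  then have "mat_in J (A - B + B)"
    by (rule mat_in_add[OF assms(1) minus_carrier_mat[OF assms(3)] assms(3,4)])
  then show "mat_in J A" using mat_diff_add_cancel[OF assms(2,3)] by simp
qed

lemma vec_in_diff_iff:
  assumes "restrictable_ideal J" "v \<in> carrier_vec n" "w \<in> carrier_vec n" "vec_in J (v - w)"
  shows "vec_in J v \<longleftrightarrow> vec_in J w"
proof
  assume "vec_in J v"
  then have "vec_in J (v - (v - w))"
    by (rule vec_in_diff[OF assms(1,2) minus_carrier_vec[OF assms(2,3)] _ assms(4)])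
  also have "v - (v - w) = w" using assms(2,3) by (intro eq_vecI) auto
  finally show "vec_in J w" .
next
  assume "vec_in J w"
  then have "vec_in J (v - w + w)"
    by (rule vec_in_add[OF assms(1) minus_carrier_vec[OF assms(2,3)] assms(3,4)])
  then show "vec_in J v" using vec_diff_add_cancel[OF assms(2,3)] by simp
qed

lemma vec_diff_add_diff:
  fixes u v w :: "'a::ab_group_add vec"
  assumes "u \<in> carrier_vec n" "v \<in> carrier_vec n" "w \<in> carrier_vec n"
  shows "u - v + (v - w) = u - w"
  using assms by (intro eq_vecI) auto

lemma gres_summand:
  fixes A S T :: "nat \<Rightarrow> ('v::finite, 'k::comm_ring_1) mpoly mat"
  assumes A: "gres I dg A" and I: "restrictable_ideal I" and d0: "dg' 0 = [0]"
    and S: "\<And>i. gmat (dg i) (dg' i) (S i)" and T: "\<And>i. gmat (dg' i) (dg i) (T i)"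
    and TS: "\<And>i. T i * S i = 1\<^sub>m (length (dg' i))"
    and comm: "\<And>i. mat_in (level_ideal I i) (A i * (S (Suc i) * T (Suc i)) - (S i * T i) * A i)"
  shows "gres I dg' (\<lambda>i. T i * (A i * S (Suc i)))"
proof -
  let ?a = "\<lambda>i. length (dg i)" and ?b = "\<lambda>i. length (dg' i)"
  define B where "B i = T i * (A i * S (Suc i))" for i
  have cA: "A i \<in> carrier_mat (?a i) (?a (Suc i))" for i by (rule gresD(3)[OF A])
  have cS: "S i \<in> carrier_mat (?a i) (?b i)" for i using S by (rule gmat_carrier)
  have cT: "T i \<in> carrier_mat (?b i) (?a i)" for i using T by (rule gmat_carrier)
  have gB: "gmat (dg' i) (dg' (Suc i)) (B i)" for i
    unfolding B_def by (intro gmat_mult[OF T] gmat_mult[OF gresD(2)[OF A]] S)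
  have cB: "B i \<in> carrier_mat (?b i) (?b (Suc i))" for i using gB by (rule gmat_carrier)
  note J = restrictable_level_ideal[OF I]
  have cAS: "A i * S (Suc i) \<in> carrier_mat (?a i) (?b (Suc i))" for i by (rule mult_carrier_mat[OF cA cS])
  have cTA: "T i * A i \<in> carrier_mat (?b i) (?a (Suc i))" for i by (rule mult_carrier_mat[OF cT cA])
  have cST: "S i * T i \<in> carrier_mat (?a i) (?a i)" for i by (rule mult_carrier_mat[OF cS cT])
  have cSB: "S i * B i \<in> carrier_mat (?a i) (?b (Suc i))" for i by (rule mult_carrier_mat[OF cS cB])
  have cBT: "B i * T (Suc i) \<in> carrier_mat (?b i) (?a (Suc i))" for i by (rule mult_carrier_mat[OF cB cT])
  have c1: "mat_in (level_ideal I i) (A i * S (Suc i) - S i * B i)" for i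
  proof -
    have "mat_in (level_ideal I i) ((A i * (S (Suc i) * T (Suc i)) - (S i * T i) * A i) * S (Suc i))"
      by (rule mat_in_mult_right[OF J minus_carrier_mat[OF mult_carrier_mat[OF cST cA]] cS comm])
    also have "(A i * (S (Suc i) * T (Suc i)) - (S i * T i) * A i) * S (Suc i)
        = A i * (S (Suc i) * T (Suc i)) * S (Suc i) - (S i * T i) * A i * S (Suc i)"
      by (rule minus_mult_distrib_mat[OF mult_carrier_mat[OF cA cST] mult_carrier_mat[OF cST cA] cS])
    also have "A i * (S (Suc i) * T (Suc i)) * S (Suc i) = A i * S (Suc i)"
      using assoc_mult_mat[OF cA cST cS] assoc_mult_mat[OF cS cT cS] TS right_mult_one_mat[OF cS] by simp
    also have "(S i * T i) * A i * S (Suc i) = S i * B i"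
      unfolding B_def using assoc_mult_mat[OF cST cA cS] assoc_mult_mat[OF cS cT cAS] by simp
    finally show ?thesis .
  qed
  have c2: "mat_in (level_ideal I i) (B i * T (Suc i) - T i * A i)" for i
  proof -
    have "mat_in (level_ideal I i) (T i * (A i * (S (Suc i) * T (Suc i)) - (S i * T i) * A i))"
      by (rule mat_in_mult_left[OF J cT minus_carrier_mat[OF mult_carrier_mat[OF cST cA]] comm])
    also have "T i * (A i * (S (Suc i) * T (Suc i)) - (S i * T i) * A i)
        = T i * (A i * (S (Suc i) * T (Suc i))) - T i * ((S i * T i) * A i)"
      by (rule mult_minus_distrib_mat[OF cT mult_carrier_mat[OF cA cST] mult_carrier_mat[OF cST cA]])
    also have "T i * (A i * (S (Suc i) * T (Suc i))) = B i * T (Suc i)"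
      unfolding B_def using assoc_mult_mat[OF cT cAS cT] assoc_mult_mat[OF cA cS cT] by simp
    also have "T i * ((S i * T i) * A i) = T i * (S i * T i) * A i"
      by (rule assoc_mult_mat[OF cT cST cA, symmetric])
    also have "T i * (S i * T i) = T i * S i * T i"
      by (rule assoc_mult_mat[OF cT cS cT, symmetric])
    also have "\<dots> = T i"
      unfolding TS by (rule left_mult_one_mat[OF cT])
    finally show ?thesis .
  qed
  have SBB: "mat_in (level_ideal I i) (B i * B (Suc i))" for i
  proof -
    have SB: "S (Suc i) * B (Suc i) = A (Suc i) * S (Suc (Suc i))"
      by (rule mat_in_zero_diff[OF cAS cSB, symmetric]) (use c1[of "Suc i"] in simp)
    have "mat_in (level_ideal I i) ((A i * A (Suc i)) * S (Suc (Suc i)))"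
      by (rule mat_in_mult_right[OF J mult_carrier_mat[OF cA cA] cS gresD(4)[OF A]])
    also have "(A i * A (Suc i)) * S (Suc (Suc i)) = A i * S (Suc i) * B (Suc i)"
      using assoc_mult_mat[OF cA cA cS] assoc_mult_mat[OF cA cS cB] SB by simp
    finally have 1: "mat_in (level_ideal I i) (A i * S (Suc i) * B (Suc i))" .
    have "mat_in (level_ideal I i) ((A i * S (Suc i) - S i * B i) * B (Suc i))"
      by (rule mat_in_mult_right[OF J minus_carrier_mat[OF cSB] cB c1])
    also have "(A i * S (Suc i) - S i * B i) * B (Suc i) = A i * S (Suc i) * B (Suc i) - S i * B i * B (Suc i)"
      by (rule minus_mult_distrib_mat[OF cAS cSB cB])
    finally have "mat_in (level_ideal I i) (S i * B i * B (Suc i))"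
      using mat_in_diff_iff[OF J mult_carrier_mat[OF cAS cB] mult_carrier_mat[OF cSB cB]] 1 by blast
    then have "mat_in (level_ideal I i) (T i * (S i * B i * B (Suc i)))"
      by (rule mat_in_mult_left[OF J cT mult_carrier_mat[OF cSB cB]])
    also have "T i * (S i * B i * B (Suc i)) = T i * S i * (B i * B (Suc i))"
      using assoc_mult_mat[OF cS cB cB] assoc_mult_mat[OF cT cS mult_carrier_mat[OF cB cB]] by simp
    also have "\<dots> = B i * B (Suc i)"
      unfolding TS by (rule left_mult_one_mat[OF mult_carrier_mat[OF cB cB]])
    finally show ?thesis .
  qed
  have ex: "\<exists>w\<in>carrier_vec (?b (Suc i)). vec_in (level_ideal I i) (B i *\<^sub>v w - v)"
    if v: "v \<in> carrier_vec (?b i)"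
      and cyc: "\<And>j. i = Suc j \<Longrightarrow> vec_in (level_ideal I j) (B j *\<^sub>v v)" for i v
  proof -
    have cSv: "S i *\<^sub>v v \<in> carrier_vec (?a i)" by (rule mult_mat_vec_carrier[OF cS v])
    obtain w where w: "w \<in> carrier_vec (?a (Suc i))" "vec_in (level_ideal I i) (A i *\<^sub>v w - S i *\<^sub>v v)"
    proof (rule gres_exact[OF A cSv])
      fix j assume j: "i = Suc j"
      have v': "v \<in> carrier_vec (?b (Suc j))" using v j by simp
      have "vec_in (level_ideal I j) (S j *\<^sub>v (B j *\<^sub>v v))"
        by (rule vec_in_mult[OF J cS mult_mat_vec_carrier[OF cB v'] cyc[OF j]])
      moreover have "vec_in (level_ideal I j) ((A j * S (Suc j) - S j * B j) *\<^sub>v v)"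
        by (rule mat_in_mult_vec[OF J minus_carrier_mat[OF cSB] v' c1])
      moreover have "(A j * S (Suc j) - S j * B j) *\<^sub>v v = A j *\<^sub>v (S (Suc j) *\<^sub>v v) - S j *\<^sub>v (B j *\<^sub>v v)"
        using minus_mult_distrib_mat_vec[OF cAS cSB v'] assoc_mult_mat_vec[OF cA cS v']
          assoc_mult_mat_vec[OF cS cB v'] by simp
      ultimately show "vec_in (level_ideal I j) (A j *\<^sub>v (S i *\<^sub>v v))"
        using vec_in_diff_iff[OF J mult_mat_vec_carrier[OF cA mult_mat_vec_carrier[OF cS v']]
            mult_mat_vec_carrier[OF cS mult_mat_vec_carrier[OF cB v']]] j by simp
    qed
    have cAw: "A i *\<^sub>v w \<in> carrier_vec (?a i)" by (rule mult_mat_vec_carrier[OF cA w(1)])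
    have cTw: "T (Suc i) *\<^sub>v w \<in> carrier_vec (?b (Suc i))" by (rule mult_mat_vec_carrier[OF cT w(1)])
    have "vec_in (level_ideal I i) (T i *\<^sub>v (A i *\<^sub>v w - S i *\<^sub>v v))"
      by (rule vec_in_mult[OF J cT minus_carrier_vec[OF cAw cSv] w(2)])
    also have "T i *\<^sub>v (A i *\<^sub>v w - S i *\<^sub>v v) = T i *\<^sub>v (A i *\<^sub>v w) - v"
      using mult_minus_distrib_mat_vec[OF cT cAw cSv] assoc_mult_mat_vec[OF cT cS v] TS v by simp
    finally have 1: "vec_in (level_ideal I i) (T i *\<^sub>v (A i *\<^sub>v w) - v)" .
    have "vec_in (level_ideal I i) ((B i * T (Suc i) - T i * A i) *\<^sub>v w)"
      by (rule mat_in_mult_vec[OF J minus_carrier_mat[OF cTA] w(1) c2])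
    also have "(B i * T (Suc i) - T i * A i) *\<^sub>v w = B i *\<^sub>v (T (Suc i) *\<^sub>v w) - T i *\<^sub>v (A i *\<^sub>v w)"
      using minus_mult_distrib_mat_vec[OF cBT cTA w(1)] assoc_mult_mat_vec[OF cB cT w(1)]
        assoc_mult_mat_vec[OF cT cA w(1)] by simp
    finally have 2: "vec_in (level_ideal I i) (B i *\<^sub>v (T (Suc i) *\<^sub>v w) - T i *\<^sub>v (A i *\<^sub>v w))" .
    have cc: "B i *\<^sub>v (T (Suc i) *\<^sub>v w) \<in> carrier_vec (?b i)" "T i *\<^sub>v (A i *\<^sub>v w) \<in> carrier_vec (?b i)"
      by (rule mult_mat_vec_carrier[OF cB cTw], rule mult_mat_vec_carrier[OF cT cAw])
    have "vec_in (level_ideal I i)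
        (B i *\<^sub>v (T (Suc i) *\<^sub>v w) - T i *\<^sub>v (A i *\<^sub>v w) + (T i *\<^sub>v (A i *\<^sub>v w) - v))"
      by (rule vec_in_add[OF J minus_carrier_vec[OF cc] minus_carrier_vec[OF cc(2) v] 2 1])
    also have "B i *\<^sub>v (T (Suc i) *\<^sub>v w) - T i *\<^sub>v (A i *\<^sub>v w) + (T i *\<^sub>v (A i *\<^sub>v w) - v) = B i *\<^sub>v (T (Suc i) *\<^sub>v w) - v"
      by (rule vec_diff_add_diff[OF cc v])
    finally show ?thesis using cTw by blast
  qed
  show ?thesis
    unfolding gres_def B_def[symmetric] using d0 gB SBB ex by simp
qed

definition skip :: "nat \<Rightarrow> nat \<Rightarrow> nat" where
  "skip l j = (if j < l then j else Suc j)"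

definition drop_nth :: "nat \<Rightarrow> 'a list \<Rightarrow> 'a list" where
  "drop_nth l xs = map (\<lambda>j. xs ! skip l j) [0..<length xs - 1]"

definition skip_mat :: "nat \<Rightarrow> nat \<Rightarrow> 'a::zero_neq_one mat" where
  "skip_mat n l = mat n (n - 1) (\<lambda>(a, j). if a = skip l j then 1 else 0)"

lemma length_drop_nth [simp]: "length (drop_nth l xs) = length xs - 1"
  by (simp add: drop_nth_def)

lemma skip_mat_carrier: "skip_mat n l \<in> carrier_mat n (n - 1)"
  by (simp add: skip_mat_def)

lemma gmat_skip_mat: "gmat ds (drop_nth l ds) (skip_mat (length ds) l)"
  by (auto simp: gmat_def skip_mat_def drop_nth_def)

lemma gmat_skip_mat_transpose: "gmat (drop_nth l ds) ds (transpose_mat (skip_mat (length ds) l))"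
  by (auto simp: gmat_def skip_mat_def drop_nth_def)

lemma skip_less: "l < n \<Longrightarrow> j < n - 1 \<Longrightarrow> skip l j < n"
  by (auto simp: skip_def)

lemma transpose_skip_mat_mult:
  fixes M :: "'a::comm_ring_1 mat"
  assumes "M \<in> carrier_mat n m" "l < n" "j < n - 1" "b < m"
  shows "(transpose_mat (skip_mat n l) * M) $$ (j, b) = M $$ (skip l j, b)"
proof -
  have "(transpose_mat (skip_mat n l) * M) $$ (j, b)
      = (\<Sum>r<n. transpose_mat (skip_mat n l) $$ (j, r) * M $$ (r, b))"
    by (rule index_mult_mat_sum[OF _ assms(1,3,4)]) (simp add: skip_mat_def)
  also have "\<dots> = (\<Sum>r<n. if r = skip l j then M $$ (r, b) else 0)"
    using assms by (intro sum.cong) (auto simp: skip_mat_def)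
  also have "\<dots> = M $$ (skip l j, b)"
    using skip_less[OF assms(2,3)] by simp
  finally show ?thesis .
qed

lemma skip_mat_mult:
  fixes M :: "'a::comm_ring_1 mat"
  assumes "M \<in> carrier_mat (n - 1) m" "l < n" "a < n" "b < m"
  shows "(skip_mat n l * M) $$ (a, b) = (if a = l then 0 else M $$ (if a < l then a else a - 1, b))"
proof -
  let ?u = "if a < l then a else a - 1"
  have eq: "a = skip l j \<longleftrightarrow> a \<noteq> l \<and> j = ?u" for j
    by (auto simp: skip_def)
  have "(skip_mat n l * M) $$ (a, b) = (\<Sum>r<n - 1. skip_mat n l $$ (a, r) * M $$ (r, b))"
    by (rule index_mult_mat_sum[OF skip_mat_carrier assms(1,3,4)])
  also have "\<dots> = (\<Sum>r<n - 1. if r = ?u then (if a = l then 0 else M $$ (r, b)) else 0)"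
    using assms by (intro sum.cong) (auto simp: skip_mat_def eq simp del: One_nat_def)
  also have "\<dots> = (if a = l then 0 else M $$ (?u, b))"
    using assms by (auto simp: sum.delta)
  finally show ?thesis .
qed

lemma transpose_skip_mat_mult_skip_mat:
  assumes "l < n"
  shows "transpose_mat (skip_mat n l) * skip_mat n l = (1\<^sub>m (n - 1) :: 'a::comm_ring_1 mat)"
proof (rule eq_matI)
  fix i j assume ij: "i < dim_row (1\<^sub>m (n - 1) :: 'a mat)" "j < dim_col (1\<^sub>m (n - 1) :: 'a mat)"
  then have "(transpose_mat (skip_mat n l) * skip_mat n l) $$ (i, j) = (skip_mat n l $$ (skip l i, j) :: 'a)"
    by (intro transpose_skip_mat_mult[OF skip_mat_carrier assms]) auto
  also have "\<dots> = 1\<^sub>m (n - 1) $$ (i, j)"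
    using ij skip_less[OF assms, of i] by (auto simp: skip_mat_def skip_def)
  finally show "(transpose_mat (skip_mat n l) * skip_mat n l) $$ (i, j) = (1\<^sub>m (n - 1) :: 'a mat) $$ (i, j)" .
qed (simp_all add: skip_mat_def)

lemma skip_mat_mult_transpose:
  fixes M :: "'a::comm_ring_1 mat"
  assumes M: "M \<in> carrier_mat n m" and l: "l < n" and z: "\<And>b. b < m \<Longrightarrow> M $$ (l, b) = 0"
  shows "skip_mat n l * (transpose_mat (skip_mat n l) * M) = M"
proof -
  have c: "transpose_mat (skip_mat n l) * M \<in> carrier_mat (n - 1) m"
    using mult_carrier_mat[OF transpose_carrier_mat[THEN iffD2, OF skip_mat_carrier] M] .
  show ?thesis
  proof (rule eq_matI)
    fix a b assume ab: "a < dim_row M" "b < dim_col M"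
    then have ab': "a < n" "b < m" using M by auto
    show "(skip_mat n l * (transpose_mat (skip_mat n l) * M)) $$ (a, b) = M $$ (a, b)"
    proof (cases "a = l")
      case True
      then show ?thesis using skip_mat_mult[OF c l ab'] z ab' by simp
    next
      case False
      let ?u = "if a < l then a else a - 1"
      have u: "?u < n - 1" "skip l ?u = a" using False ab' l by (auto simp: skip_def)
      have "(skip_mat n l * (transpose_mat (skip_mat n l) * M)) $$ (a, b)
          = (transpose_mat (skip_mat n l) * M) $$ (?u, b)"
        using skip_mat_mult[OF c l ab'] False by simp
      also have "\<dots> = M $$ (skip l ?u, b)" by (rule transpose_skip_mat_mult[OF M l u(1) ab'(2)])
      finally show ?thesis by (simp only: u(2))
    qed
  qed (use M in \<open>auto simp: skip_mat_def\<close>)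
qed


lemma mult_skip_mat_transpose:
  fixes M :: "'a::comm_ring_1 mat"
  assumes M: "M \<in> carrier_mat m n" and l: "l < n" and z: "\<And>b. b < m \<Longrightarrow> M $$ (b, l) = 0"
  shows "M * skip_mat n l * transpose_mat (skip_mat n l) = M"
proof -
  have cT: "transpose_mat (skip_mat n l) \<in> carrier_mat (n - 1) n"
    using skip_mat_carrier by (rule transpose_carrier_mat[THEN iffD2])
  have "skip_mat n l * (transpose_mat (skip_mat n l) * transpose_mat M) = transpose_mat M"
    by (rule skip_mat_mult_transpose) (use M l z in auto)
  then have "transpose_mat (skip_mat n l * (transpose_mat (skip_mat n l) * transpose_mat M)) = M"
    by simp
  also have "transpose_mat (skip_mat n l * (transpose_mat (skip_mat n l) * transpose_mat M))
      = transpose_mat (transpose_mat (skip_mat n l) * transpose_mat M) * transpose_mat (skip_mat n l)"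
    by (rule transpose_mult[OF skip_mat_carrier mult_carrier_mat[OF cT]]) (use M in auto)
  also have "transpose_mat (transpose_mat (skip_mat n l) * transpose_mat M) = M * skip_mat n l"
    by (subst transpose_mult[OF cT]) (use M in auto)
  finally show ?thesis .
qed

text \<open>
  A unit entry of a differential \<open>D\<close> gives \<open>h\<close> with \<open>h D h = h\<close>; then \<open>1 - D h\<close> and \<open>1 - h D\<close>
  form a chain map, idempotent and homotopic to the identity, whose image omits the two basis
  elements.
\<close>

lemma cancel_unit_entry:
  fixes A :: "nat \<Rightarrow> ('v::finite, 'k::field) mpoly mat"
  assumes A: "gres I dg A" and I: "restrictable_ideal I" and p: "p = Suc i"
    and l: "l < length (dg p)" and k: "k < length (dg (Suc p))"
    and unit: "Poly_Mapping.lookup (A p $$ (l, k)) 0 \<noteq> 0"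
  obtains B where "gres I (dg(p := drop_nth l (dg p), Suc p := drop_nth k (dg (Suc p)))) B"
proof -
  define D where "D = A p"
  define n where "n = length (dg p)"
  define m where "m = length (dg (Suc p))"
  define c where "c = Poly_Mapping.lookup (D $$ (l, k)) 0"
  define h :: "('v, 'k) mpoly mat" where
    "h = mat m n (\<lambda>(a, b). if a = k \<and> b = l then Poly_Mapping.single 0 (inverse c) else 0)"
  define P where "P = 1\<^sub>m n - D * h"
  define Q where "Q = 1\<^sub>m m - h * D"
  let ?Sl = "skip_mat n l :: ('v, 'k) mpoly mat" and ?Sk = "skip_mat m k :: ('v, 'k) mpoly mat"
  define S where "S j = (if j = p then ?Sl else if j = Suc p then Q * ?Sk else 1\<^sub>m (length (dg j)))" for j
  define T where "T j = (if j = p then transpose_mat ?Sl * P else if j = Suc p then transpose_mat ?Sk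
    else 1\<^sub>m (length (dg j)))" for j
  let ?dg' = "dg(p := drop_nth l (dg p), Suc p := drop_nth k (dg (Suc p)))"
  note l = l[folded n_def] and k = k[folded m_def]
  have cA: "A i \<in> carrier_mat (length (dg i)) (length (dg (Suc i)))" for i by (rule gresD(3)[OF A])
  have gD: "gmat (dg p) (dg (Suc p)) D" unfolding D_def by (rule gresD(2)[OF A])
  have cD: "D \<in> carrier_mat n m" using gmat_carrier[OF gD] by (simp add: n_def m_def)
  have c: "c \<noteq> 0" using unit by (simp add: c_def D_def)
  have hom: "homogeneous (D $$ (l, k)) (dg (Suc p) ! k - dg p ! l)"
    using gD l k by (simp add: gmat_def n_def m_def)
  have deg: "dg (Suc p) ! k - dg p ! l = 0" using homogeneous_const[OF hom] c by (simp add: c_def)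
  then have Dlk: "D $$ (l, k) = Poly_Mapping.single 0 c" using hom homogeneous_zero_const[of "D $$ (l, k)"] by (simp add: c_def)
  have inv: "D $$ (l, k) * Poly_Mapping.single 0 (inverse c) = 1"
    "Poly_Mapping.single 0 (inverse c) * D $$ (l, k) = 1"
    using c by (simp_all add: Dlk mult_single)
  have ch: "h \<in> carrier_mat m n" by (simp add: h_def)
  have gh: "gmat (dg (Suc p)) (dg p) h"
    using deg by (auto simp: gmat_def h_def n_def m_def)
  have hD: "(h * D) $$ (a, b) = (if a = k then Poly_Mapping.single 0 (inverse c) * D $$ (l, b) else 0)"
    if "a < m" "b < m" for a b
  proof -
    have "(h * D) $$ (a, b) = (\<Sum>r<n. if r = l then (if a = k then Poly_Mapping.single 0 (inverse c) * D $$ (r, b) else 0) else 0)"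
      unfolding index_mult_mat_sum[OF ch cD that] using that by (intro sum.cong) (auto simp: h_def)
    then show ?thesis using l by simp
  qed
  have Dh: "(D * h) $$ (a, b) = (if b = l then D $$ (a, k) * Poly_Mapping.single 0 (inverse c) else 0)"
    if "a < n" "b < n" for a b
  proof -
    have "(D * h) $$ (a, b) = (\<Sum>r<m. if r = k then (if b = l then D $$ (a, r) * Poly_Mapping.single 0 (inverse c) else 0) else 0)"
      unfolding index_mult_mat_sum[OF cD ch that] using that by (intro sum.cong) (auto simp: h_def)
    then show ?thesis using k by simp
  qed
  have cDh: "D * h \<in> carrier_mat n n" and chD: "h * D \<in> carrier_mat m m"
    using cD ch by auto
  have cP: "P \<in> carrier_mat n n" and cQ: "Q \<in> carrier_mat m m"
    using cDh chD unfolding P_def Q_def by (auto intro: minus_carrier_mat)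
  have P0: "P $$ (l, b) = 0" if "b < n" for b
    using that l cD ch Dh[of l b] inv by (auto simp: P_def simp del: index_mult_mat(1))
  have Q0: "Q $$ (a, k) = 0" if "a < m" for a
    using that k cD ch hD[of a k] inv by (auto simp: Q_def simp del: index_mult_mat(1))
  have cSl: "?Sl \<in> carrier_mat n (n - 1)" and cSk: "?Sk \<in> carrier_mat m (m - 1)"
    by (rule skip_mat_carrier)+
  have cTl: "transpose_mat ?Sl \<in> carrier_mat (n - 1) n" and cTk: "transpose_mat ?Sk \<in> carrier_mat (m - 1) m"
    using cSl cSk by simp_all
  have hS: "h * ?Sl = 0\<^sub>m m (n - 1)"
  proof (rule eq_matI)
    fix a b assume "a < dim_row (0\<^sub>m m (n - 1) :: ('v, 'k) mpoly mat)" "b < dim_col (0\<^sub>m m (n - 1) :: ('v, 'k) mpoly mat)"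
    then have ab: "a < m" "b < n - 1" by auto
    have "(\<Sum>r<n. h $$ (a, r) * ?Sl $$ (r, b)) = 0"
      using ab by (intro sum.neutral) (auto simp: h_def skip_mat_def skip_def)
    then show "(h * ?Sl) $$ (a, b) = 0\<^sub>m m (n - 1) $$ (a, b)"
      using ab by (simp add: index_mult_mat_sum[OF ch cSl] del: index_mult_mat(1))
  qed (use ch cSl in auto)
  have Th: "transpose_mat ?Sk * h = 0\<^sub>m (m - 1) n"
  proof (rule eq_matI)
    fix a b assume "a < dim_row (0\<^sub>m (m - 1) n :: ('v, 'k) mpoly mat)" "b < dim_col (0\<^sub>m (m - 1) n :: ('v, 'k) mpoly mat)"
    then have ab: "a < m - 1" "b < n" by auto
    then show "(transpose_mat ?Sk * h) $$ (a, b) = 0\<^sub>m (m - 1) n $$ (a, b)"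
      using transpose_skip_mat_mult[OF ch k ab] skip_less[OF k ab(1)] by (simp add: h_def skip_def del: index_mult_mat(1))
  qed (use ch cTk in auto)
  have PS: "P * ?Sl = ?Sl"
  proof -
    have "D * h * ?Sl = 0\<^sub>m n (n - 1)"
      by (simp only: assoc_mult_mat[OF cD ch cSl] hS right_mult_zero_mat[OF cD])
    then show ?thesis
      by (simp only: P_def minus_mult_distrib_mat[OF one_carrier_mat cDh cSl] left_mult_one_mat[OF cSl]
          mat_diff_zero[OF cSl])
  qed
  have TQ: "transpose_mat ?Sk * Q = transpose_mat ?Sk"
  proof -
    have "transpose_mat ?Sk * (h * D) = 0\<^sub>m (m - 1) m"
      by (simp only: assoc_mult_mat[OF cTk ch cD, symmetric] Th left_mult_zero_mat[OF cD])
    then show ?thesis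
      by (simp only: Q_def mult_minus_distrib_mat[OF cTk one_carrier_mat chD] right_mult_one_mat[OF cTk]
          mat_diff_zero[OF cTk])
  qed
  have gP: "gmat (dg p) (dg p) P"
    unfolding P_def n_def by (intro gmat_diff gmat_one gmat_mult[OF gD gh])
  have gQ: "gmat (dg (Suc p)) (dg (Suc p)) Q"
    unfolding Q_def m_def by (intro gmat_diff gmat_one gmat_mult[OF gh gD])
  have gS: "gmat (dg j) (?dg' j) (S j)" for j
    unfolding S_def n_def m_def
    by (auto intro!: gmat_mult[OF gQ] gmat_skip_mat gmat_one)
  have gT: "gmat (?dg' j) (dg j) (T j)" for j
    unfolding T_def n_def m_def
    by (auto intro!: gmat_mult[OF _ gP] gmat_skip_mat_transpose gmat_one)
  have TS: "T j * S j = 1\<^sub>m (length (?dg' j))" for j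
  proof -
    consider "j = p" | "j = Suc p" | "j \<noteq> p" "j \<noteq> Suc p" by blast
    then show ?thesis
    proof cases
      case 1
      have "transpose_mat ?Sl * P * ?Sl = 1\<^sub>m (n - 1)"
        by (simp only: assoc_mult_mat[OF cTl cP cSl] PS transpose_skip_mat_mult_skip_mat[OF l])
      then show ?thesis using 1 by (simp add: S_def T_def n_def)
    next
      case 2
      have "transpose_mat ?Sk * (Q * ?Sk) = 1\<^sub>m (m - 1)"
        by (simp only: assoc_mult_mat[OF cTk cQ cSk, symmetric] TQ transpose_skip_mat_mult_skip_mat[OF k])
      then show ?thesis using 2 by (simp add: S_def T_def m_def)
    qed (simp add: S_def T_def)
  qed
  define E where "E j = S j * T j" for j
  have Ep: "E p = P"
    unfolding E_def S_def T_def using skip_mat_mult_transpose[OF cP l P0] by simp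
  have Eq: "E (Suc p) = Q"
    unfolding E_def S_def T_def using mult_skip_mat_transpose[OF cQ k Q0] by simp
  have E1: "E j = 1\<^sub>m (length (dg j))" if "j \<noteq> p" "j \<noteq> Suc p" for j
    using that by (simp add: E_def S_def T_def)
  have comm: "mat_in (level_ideal I j) (A j * E (Suc j) - E j * A j)" for j
  proof -
    consider "j = p" | "j = Suc p" | "Suc j = p" | "j \<noteq> p" "j \<noteq> Suc p" "Suc j \<noteq> p" by blast
    then show ?thesis
    proof cases
      case 1
      have "D * Q = D - D * h * D"
        using mult_minus_distrib_mat[OF cD one_carrier_mat chD] assoc_mult_mat[OF cD ch cD] right_mult_one_mat[OF cD]
        by (simp add: Q_def)
      moreover have "P * D = D - D * h * D"
        using minus_mult_distrib_mat[OF one_carrier_mat cDh cD] left_mult_one_mat[OF cD]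
        by (simp add: P_def)
      ultimately show ?thesis
        using minus_r_inv_mat[of "D * Q"] Ep Eq restrictable_idealD(1)[OF restrictable_level_ideal[OF I]]
        by (simp add: 1 D_def[symmetric] mat_in_def)
    next
      case 2
      have cAq: "A (Suc p) \<in> carrier_mat m (length (dg (Suc (Suc p))))" using cA[of "Suc p"] by (simp add: m_def)
      have "D * A (Suc p) = 0\<^sub>m n (length (dg (Suc (Suc p))))"
        using gres_mult_zero[OF A, of i] by (simp add: D_def p n_def)
      then have "Q * A (Suc p) = A (Suc p)"
        by (simp only: Q_def minus_mult_distrib_mat[OF one_carrier_mat chD cAq] assoc_mult_mat[OF ch cD cAq]
          left_mult_one_mat[OF cAq] right_mult_zero_mat[OF ch] mat_diff_zero[OF cAq])
      moreover have "A (Suc p) * E (Suc (Suc p)) = A (Suc p)"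
        using E1[of "Suc (Suc p)"] right_mult_one_mat[OF cAq] by simp
      ultimately show ?thesis
        using Eq restrictable_idealD(1)[OF restrictable_level_ideal[OF I]] by (simp add: 2 mat_in_def)
    next
      case 3
      then have j: "j = i" by (simp add: p)
      have cAi: "A i \<in> carrier_mat (length (dg i)) n" using cA[of i] by (simp add: n_def p)
      have AD: "mat_in (level_ideal I i) (A i * D)" using gresD(4)[OF A, of i] by (simp add: D_def p)
      have cAD: "A i * D \<in> carrier_mat (length (dg i)) m" by (rule mult_carrier_mat[OF cAi cD])
      have "mat_in (level_ideal I i) (A i * D * h)"
        by (rule mat_in_mult_right[OF restrictable_level_ideal[OF I] cAD ch AD])
      then have "mat_in (level_ideal I i) (- (A i * D * h))"
        by (rule mat_in_uminus[OF restrictable_level_ideal[OF I]])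
      moreover have "A i * P = A i - A i * D * h"
        using mult_minus_distrib_mat[OF cAi one_carrier_mat cDh] assoc_mult_mat[OF cAi cD ch] right_mult_one_mat[OF cAi]
        by (simp add: P_def)
      moreover have "E i = 1\<^sub>m (length (dg i))" by (rule E1) (auto simp: p)
      moreover have "A i - A i * D * h - A i = - (A i * D * h)"
        using cAi mult_carrier_mat[OF cAD ch] by (intro eq_matI) auto
      ultimately show ?thesis using Ep left_mult_one_mat[OF cAi] by (simp add: j p)
    next
      case 4
      then show ?thesis
        using E1[of j] E1[of "Suc j"] left_mult_one_mat[OF cA] right_mult_one_mat[OF cA]
          restrictable_idealD(1)[OF restrictable_level_ideal[OF I]]
        by (simp add: mat_in_def)
    qed
  qed
  have d0: "?dg' 0 = [0]" using gresD(1)[OF A] by (simp add: p)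
  show ?thesis
    by (rule that, rule gres_summand[OF A I d0 gS gT TS comm[unfolded E_def]])
qed

lemma minimal_gres_exists:
  fixes A :: "nat \<Rightarrow> ('v::finite, 'k::field) mpoly mat"
  assumes "gres I dg A" and I: "restrictable_ideal I" and "\<And>i. i \<ge> N \<Longrightarrow> dg i = []"
  shows "\<exists>dg' A'. gres I dg' A' \<and> minimal_diffs A'"
  using assms(1,3)
proof (induction "\<Sum>i<N. length (dg i)" arbitrary: dg A rule: less_induct)
  case less
  note A = less.prems(1)
  show ?case
  proof (cases "minimal_diffs A")
    case False
    then obtain i where "\<not> mat_in {f. Poly_Mapping.lookup f 0 = 0} (A (Suc i))"
      by (auto simp: minimal_diffs_def)
    then obtain l k where lk: "l < length (dg (Suc i))" "k < length (dg (Suc (Suc i)))"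
      "Poly_Mapping.lookup (A (Suc i) $$ (l, k)) 0 \<noteq> 0"
      using mat_in_carrier[OF gresD(3)[OF A]] by blast
    let ?dg' = "dg(Suc i := drop_nth l (dg (Suc i)), Suc (Suc i) := drop_nth k (dg (Suc (Suc i))))"
    obtain B where B: "gres I ?dg' B" using cancel_unit_entry[OF A I refl lk] by blast
    have "Suc i < N" using less.prems(2)[of "Suc i"] lk(1) by (cases "Suc i < N") auto
    then have "(\<Sum>i<N. length (?dg' i)) < (\<Sum>i<N. length (dg i))"
      using lk(1) by (intro sum_strict_mono_ex1) (auto intro!: bexI[of _ "Suc i"])
    moreover have "?dg' j = []" if "j \<ge> N" for j
      using less.prems(2)[OF that] by (auto simp: drop_nth_def)
    ultimately show ?thesis using less.hyps B by blast
  qed (use A in blast)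
qed

section \<open>Regularity of squarefree monomial ideals\<close>

lemma gres_sqf_ideal_empty:
  "gres (sqf_ideal {} :: ('v::finite, 'k::comm_ring_1) mpoly set) (\<lambda>i. if i \<le> 1 then [0] else [])
    (\<lambda>i. if i = 0 then 1\<^sub>m 1 else 0\<^sub>m (if i = 1 then 1 else 0) 0)"
proof -
  let ?I = "sqf_ideal {} :: ('v, 'k) mpoly set"
  let ?dg = "\<lambda>i::nat. if i \<le> 1 then [0] else [] :: int list"
  let ?A = "\<lambda>i::nat. if i = 0 then 1\<^sub>m 1 else 0\<^sub>m (if i = 1 then 1 else 0) 0 :: ('v, 'k) mpoly mat"
  have I: "?I = {0}" by (auto simp: sqf_ideal_def)
  have "gmat (?dg i) (?dg (Suc i)) (?A i)" for i by (auto simp: gmat_def)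
  moreover have "mat_in (level_ideal ?I i) (?A i * ?A (Suc i))" for i by (auto simp: mat_in_def)
  moreover have "\<exists>w\<in>carrier_vec (length (?dg (Suc i))). vec_in (level_ideal ?I i) (?A i *\<^sub>v w - v)"
    if v: "v \<in> carrier_vec (length (?dg i))"
      and cyc: "\<And>j. i = Suc j \<Longrightarrow> vec_in (level_ideal ?I j) (?A j *\<^sub>v v)" for i v
  proof -
    consider "i = 0" | "i = 1" | "i \<ge> 2" by linarith
    then show ?thesis
    proof cases
      case 1
      then show ?thesis using v by (intro bexI[of _ v]) (auto simp: vec_in_def I)
    next
      case 2
      then have v1: "v \<in> carrier_vec 1" using v by simp
      have "vec_in {0} (1\<^sub>m 1 *\<^sub>v v)" using cyc[of 0] 2 by (simp add: I)
      then have "v $ 0 = 0" using v1 by (simp add: vec_in_def one_mult_mat_vec[of v 1, simplified])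
      then show ?thesis using 2 v1 by (intro bexI[of _ "0\<^sub>v 0"]) (auto simp: vec_in_def scalar_prod_def)
    next
      case 3
      then show ?thesis using v by (intro bexI[of _ "0\<^sub>v 0"]) (auto simp: vec_in_def)
    qed
  qed
  ultimately show ?thesis unfolding gres_def by (simp add: I)
qed

lemma gres_cone_sqf_ideal:
  fixes A A' Phi :: "nat \<Rightarrow> ('v::finite, 'k::comm_ring_1) mpoly mat"
  assumes A: "gres (sqf_ideal F) dg A" and A': "gres (sqf_ideal ((\<lambda>D. D - C) ` F)) dg' A'"
    and Phi: "\<And>i. gmat (dg i) (map ((+) (int (card C))) (dg' i)) (Phi i)"
      "Phi 0 = mat 1 1 (\<lambda>_. sqf_monomial C)"
      "\<And>i. mat_in (level_ideal (sqf_ideal F) i) (A i * Phi (Suc i) - Phi i * A' i)"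
  shows "gres (sqf_ideal (insert C F)) (cone_degrees (int (card C)) dg dg') (cone_diff dg' A A' Phi)"
proof (rule gres_cone[OF A _ A' _ _ _ _ _ _ Phi])
  show "\<exists>g h. g \<in> sqf_ideal F \<and> f = g + sqf_monomial C * h"
    if "f \<in> sqf_ideal (insert C F)" for f :: "('v, 'k) mpoly"
    using sqf_ideal_insert[OF that] by metis
  show "(sqf_ideal F :: ('v, 'k) mpoly set) \<subseteq> sqf_ideal (insert C F)"
    by (auto simp: sqf_ideal_def)
qed (auto simp: restrictable_ideal_sqf_ideal sqf_monomial_in_sqf_ideal sqf_ideal_colon)

lemma gres_cone_sqf_ideal_exists:
  fixes A A' :: "nat \<Rightarrow> ('v::finite, 'k::comm_ring_1) mpoly mat"
  assumes A: "gres (sqf_ideal F) dg A" and A': "gres (sqf_ideal ((\<lambda>D. D - C) ` F)) dg' A'"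
  obtains B :: "nat \<Rightarrow> ('v, 'k) mpoly mat" where "gres (sqf_ideal (insert C F)) (cone_degrees (int (card C)) dg dg') B"
proof -
  let ?x = "sqf_monomial C :: ('v, 'k) mpoly" and ?db = "\<lambda>i. map ((+) (int (card C))) (dg' i)"
  have d0: "dg 0 = [0]" "dg' 0 = [0]" using gresD(1)[OF A] gresD(1)[OF A'] by auto
  obtain Phi where Phi: "Phi 0 = mat 1 1 (\<lambda>_. ?x)" "\<And>i. gmat (dg i) (?db i) (Phi i)"
    "\<And>i. mat_in (level_ideal (sqf_ideal F) i) (A i * Phi (Suc i) - Phi i * A' i)"
  proof (rule chain_map_lift[OF A restrictable_ideal_sqf_ideal, where B = A' and db = ?db and Z = "mat 1 1 (\<lambda>_. ?x)"])
    show "gmat (?db i) (?db (Suc i)) (A' i)" for i by (intro gmat_shift gresD(2)[OF A'])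
    show "gmat (dg 0) (?db 0) (mat 1 1 (\<lambda>_. ?x))"
      by (simp add: gmat_def d0 homogeneous_sqf_monomial)
    have c: "A' 0 * A' 1 \<in> carrier_mat 1 (length (dg' 2))"
      using mult_carrier_mat[OF gresD(3)[OF A'] gresD(3)[OF A'], of 0] by (simp add: d0 numeral_2_eq_2)
    have "(A' 0 * A' 1) $$ (0, k) \<in> sqf_ideal ((\<lambda>D. D - C) ` F)" if "k < length (dg' 2)" for k
      using gresD(4)[OF A', of 0] that mat_in_carrier[OF c] by simp
    then have "?x * (A' 0 * A' 1) $$ (0, k) \<in> sqf_ideal F" if "k < length (dg' 2)" for k
      using that by (simp add: sqf_ideal_colon)
    then have "(mat 1 1 (\<lambda>_. ?x) * (A' 0 * A' 1)) $$ (0, k) \<in> sqf_ideal F" if "k < length (dg' 2)" for k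
      using that index_mult_mat_sum[OF _ c, of "mat 1 1 (\<lambda>_. ?x)" 1 0 k] by (simp del: index_mult_mat(1))
    then show "mat_in (sqf_ideal F) (mat 1 1 (\<lambda>_. ?x) * (A' 0 * A' 1))"
      using mat_in_carrier[OF mult_carrier_mat[OF _ c], of "mat 1 1 (\<lambda>_. ?x)" 1] by simp
    show "A' (Suc i) * A' (Suc (Suc i)) = 0\<^sub>m (length (?db (Suc i))) (length (?db (Suc (Suc (Suc i)))))" for i
      using gres_mult_zero[OF A'] by simp
  qed (rule that)
  have "gres (sqf_ideal (insert C F)) (cone_degrees (int (card C)) dg dg') (cone_diff dg' A A' Phi)"
    by (rule gres_cone_sqf_ideal[OF A A']) (fact Phi)+
  then show ?thesis by (rule that)
qed

definition reg_bounded :: "('v::finite, 'k::comm_ring_1) mpoly set \<Rightarrow> int \<Rightarrow> bool" where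
  "reg_bounded I r \<longleftrightarrow> (\<exists>dg A N. gres I dg A \<and> (\<forall>i\<ge>N. dg i = []) \<and>
     (\<forall>i. \<forall>d\<in>set (dg (Suc i)). d - int i \<le> r))"

lemma reg_bounded_mono: "reg_bounded I r \<Longrightarrow> r \<le> r' \<Longrightarrow> reg_bounded I r'"
  unfolding reg_bounded_def by (meson order_trans)

lemma reg_bounded_sqf_ideal_empty: "reg_bounded (sqf_ideal {} :: ('v::finite, 'k::comm_ring_1) mpoly set) 0"
  unfolding reg_bounded_def
  by (rule exI, rule exI, rule exI[of _ 2], rule conjI, rule gres_sqf_ideal_empty) auto

lemma reg_bounded_insert:
  assumes "reg_bounded (sqf_ideal F :: ('v::finite, 'k::comm_ring_1) mpoly set) r"
    and "reg_bounded (sqf_ideal ((\<lambda>D. D - C) ` F) :: ('v, 'k) mpoly set) r'"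
    and le: "r' + int (card C) - 1 \<le> r"
  shows "reg_bounded (sqf_ideal (insert C F) :: ('v, 'k) mpoly set) r"
proof -
  obtain dg N and A :: "nat \<Rightarrow> ('v, 'k) mpoly mat" where A: "gres (sqf_ideal F) dg A" "\<And>i. i \<ge> N \<Longrightarrow> dg i = []"
    "\<And>i d. d \<in> set (dg (Suc i)) \<Longrightarrow> d - int i \<le> r"
    using assms(1) unfolding reg_bounded_def by blast
  obtain dg' N' and A' :: "nat \<Rightarrow> ('v, 'k) mpoly mat" where
    A': "gres (sqf_ideal ((\<lambda>D. D - C) ` F)) dg' A'" "\<And>i. i \<ge> N' \<Longrightarrow> dg' i = []"
    "\<And>i d. d \<in> set (dg' (Suc i)) \<Longrightarrow> d - int i \<le> r'"
    using assms(2) unfolding reg_bounded_def by blast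
  let ?cd = "cone_degrees (int (card C)) dg dg'"
  obtain B where "gres (sqf_ideal (insert C F) :: ('v, 'k) mpoly set) ?cd B"
    using gres_cone_sqf_ideal_exists[OF A(1) A'(1)] by blast
  moreover have "?cd i = []" if "i \<ge> max N (Suc N')" for i
    using that A(2) A'(2) by (cases "(int (card C), dg', i)" rule: cone_shift.cases) (auto simp: cone_degrees_def)
  moreover have "d - int i \<le> r" if d: "d \<in> set (?cd (Suc i))" for d i
  proof (cases i)
    case 0 then show ?thesis using d A(3)[of d 0] by (simp add: cone_degrees_def)
  next
    case (Suc j)
    then consider "d \<in> set (dg (Suc i))" | d' where "d' \<in> set (dg' (Suc j))" "d = int (card C) + d'"
      using d by (auto simp: cone_degrees_def)
    then show ?thesis
    proof cases
      case 2 then show ?thesis using A'(3)[of d' j] le Suc by simp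
    qed (rule A(3))
  qed
  ultimately show ?thesis unfolding reg_bounded_def by blast
qed

lemma reg_bounded_vars:
  assumes F: "reg_bounded (sqf_ideal F :: ('v::finite, 'k::comm_ring_1) mpoly set) r"
    and "\<And>D. D \<in> F \<Longrightarrow> D \<inter> S = {}"
  shows "reg_bounded (sqf_ideal ((\<lambda>x. {x}) ` S \<union> F) :: ('v, 'k) mpoly set) r"
proof -
  have "finite S" by simp
  then show ?thesis using assms(2)
  proof (induction S)
    case (insert x S)
    let ?H = "(\<lambda>x. {x}) ` S \<union> F"
    have IH: "reg_bounded (sqf_ideal ?H :: ('v, 'k) mpoly set) r" using insert by auto
    have "D - {x} = D" if "D \<in> ?H" for D using that insert by auto
    then have "(\<lambda>D. D - {x}) ` ?H = ?H" by force
    then have "reg_bounded (sqf_ideal (insert {x} ?H) :: ('v, 'k) mpoly set) r"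
      using reg_bounded_insert[OF IH, of "{x}" r] IH by simp
    then show ?case by simp
  qed (use F in simp)
qed

lemma cone_diff_mat_in:
  fixes A A' Phi :: "nat \<Rightarrow> ('v::finite, 'k::comm_ring_1) mpoly mat"
  assumes J: "0 \<in> J" "\<And>f. f \<in> J \<Longrightarrow> - f \<in> J"
    and A: "gres I dg A" and A': "gres I' dg' A'" and Phi: "\<And>i. Phi i \<in> carrier_mat (length (dg i)) (length (dg' i))"
    and in_J: "mat_in J (A i)" "i \<noteq> 0 \<Longrightarrow> mat_in J (Phi i)" "\<And>j. i = Suc (Suc j) \<Longrightarrow> mat_in J (A' (Suc j))"
  shows "mat_in J (cone_diff dg' A A' Phi i)"
proof -
  have cA: "A i \<in> carrier_mat (length (dg i)) (length (dg (Suc i)))" by (rule gresD(3)[OF A])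
  have cA': "A' j \<in> carrier_mat (length (dg' j)) (length (dg' (Suc j)))" for j by (rule gresD(3)[OF A'])
  let ?e = "\<lambda>i. length (cone_shift 0 dg' i)"
  have cU: "cone_corner Phi i \<in> carrier_mat (length (dg i)) (?e (Suc i))"
    using Phi[of i] gresD(1)[OF A] by (cases i) (auto simp: cone_corner_def)
  have "mat_in J (cone_corner Phi i)" using in_J(2) J by (auto simp: cone_corner_def mat_in_def)
  moreover have "cone_tail dg' A' i \<in> carrier_mat (?e i) (?e (Suc i)) \<and> mat_in J (cone_tail dg' A' i)"
  proof -
    consider "i = 0" | "i = Suc 0" | j where "i = Suc (Suc j)" by (metis not0_implies_Suc)
    then show ?thesis
    proof cases
      case 3
      then show ?thesis using cA'[of "Suc j"] in_J(3) J(2) by (auto simp: mat_in_def)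
    qed (auto simp: mat_in_def)
  qed
  moreover have "mat_in J (0\<^sub>m (?e i) (dim_col (A i)))" using J by (auto simp: mat_in_def)
  ultimately show ?thesis
    unfolding cone_diff_def using cA
    by (intro mat_in_four_block[where n = "length (dg i)" and m = "length (dg (Suc i))" and n' = "?e i" and m' = "?e (Suc i)"])
      (use cU in_J(1) in auto)
qed

text \<open>The Koszul resolution, as an iterated cone over multiplication by a monomial.\<close>

lemma koszul_resolution:
  fixes M :: "'v::finite set set"
  assumes "disjoint M" "\<And>C. C \<in> M \<Longrightarrow> card C = t" "t > 0" "\<Union>M \<subseteq> W"
  obtains dg and A :: "nat \<Rightarrow> ('v, 'k::comm_ring_1) mpoly mat" where
    "gres (sqf_ideal M) dg A" "minimal_diffs A" "\<And>i. mat_in {f. restrict_vars W f = f} (A i)"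
    "int (card M * t) \<in> set (dg (Suc (card M)))"
proof -
  have "finite M" by simp
  then have "\<exists>dg (A :: nat \<Rightarrow> ('v, 'k) mpoly mat). gres (sqf_ideal M) dg A \<and> minimal_diffs A \<and>
    (\<forall>i. mat_in {f. restrict_vars W f = f} (A i)) \<and> int (card M * t) \<in> set (dg (Suc (card M)))"
    using assms
  proof (induction M)
    case empty
    show ?case
      by (rule exI, rule exI, rule conjI, rule gres_sqf_ideal_empty) (auto simp: minimal_diffs_def mat_in_def)
  next
    case (insert C M)
    have "\<exists>dg (A :: nat \<Rightarrow> ('v, 'k) mpoly mat). gres (sqf_ideal M) dg A \<and> minimal_diffs A \<and>
      (\<forall>i. mat_in {f. restrict_vars W f = f} (A i)) \<and> int (card M * t) \<in> set (dg (Suc (card M)))"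
      using insert.prems by (intro insert.IH) (auto simp: disjoint_def)
    then obtain dg and A :: "nat \<Rightarrow> ('v, 'k) mpoly mat" where
      A: "gres (sqf_ideal M) dg A" "minimal_diffs A" "\<And>i. mat_in {f. restrict_vars W f = f} (A i)"
      "int (card M * t) \<in> set (dg (Suc (card M)))"
      by blast
    have C: "card C = t" "C \<noteq> {}" using insert.prems(2)[of C] insert.prems(3) by auto
    have "D - C = D" if "D \<in> M" for D
      using insert.prems(1) insert.hyps that unfolding disjoint_def by auto
    then have "(\<lambda>D. D - C) ` M = M" by force
    with A(1) have A': "gres (sqf_ideal ((\<lambda>D. D - C) ` M)) dg A" by simp
    let ?x = "sqf_monomial C :: ('v, 'k) mpoly"
    define Phi where "Phi i = ?x \<cdot>\<^sub>m 1\<^sub>m (length (dg i))" for i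
    have d0: "dg 0 = [0]" by (rule gresD(1)[OF A(1)])
    have cA: "A i \<in> carrier_mat (length (dg i)) (length (dg (Suc i)))" for i by (rule gresD(3)[OF A(1)])
    have P1: "gmat (dg i) (map ((+) (int (card C))) (dg i)) (Phi i)" for i
      by (auto simp: gmat_def Phi_def homogeneous_sqf_monomial)
    have cPhi: "Phi i \<in> carrier_mat (length (dg i)) (length (dg i))" for i by (simp add: Phi_def)
    have P2: "Phi 0 = mat 1 1 (\<lambda>_. ?x)" by (intro eq_matI) (auto simp: Phi_def d0)
    have P3: "mat_in (level_ideal (sqf_ideal M) i) (A i * Phi (Suc i) - Phi i * A i)" for i
    proof -
      have "A i * Phi (Suc i) = ?x \<cdot>\<^sub>m A i"
        unfolding Phi_def using mult_smult_distrib[OF cA one_carrier_mat] right_mult_one_mat[OF cA] by simp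
      moreover have "Phi i * A i = ?x \<cdot>\<^sub>m A i"
        unfolding Phi_def using mult_smult_assoc_mat[OF one_carrier_mat cA] left_mult_one_mat[OF cA] by simp
      moreover have "0 \<in> level_ideal (sqf_ideal M :: ('v, 'k) mpoly set) i"
        by (intro restrictable_idealD(1) restrictable_level_ideal restrictable_ideal_sqf_ideal)
      ultimately show ?thesis by (simp add: mat_in_def)
    qed
    let ?cd = "cone_degrees (int (card C)) dg dg" and ?B = "cone_diff dg A A Phi"
    have B: "gres (sqf_ideal (insert C M)) ?cd ?B"
      by (rule gres_cone_sqf_ideal[OF A(1) A' P1 P2 P3])
    have x0: "Poly_Mapping.lookup ?x 0 = 0"
    proof -
      have "sqf_exponent C \<noteq> 0" using C(2) keys_sqf_exponent[of C] by force
      then show ?thesis by (simp add: sqf_monomial_eq lookup_single)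
    qed
    have xW: "restrict_vars W ?x = ?x"
      unfolding restrict_vars_def using insert.prems(4) by (intro restrict_keys_eq_self) auto
    have "minimal_diffs ?B"
      unfolding minimal_diffs_def
    proof
      fix i
      show "mat_in {f. Poly_Mapping.lookup f 0 = 0} (?B (Suc i))"
        using A(2) by (intro cone_diff_mat_in[OF _ _ A(1) A(1) cPhi])
          (auto simp: minimal_diffs_def Phi_def mat_in_def x0)
    qed
    moreover have "mat_in {f. restrict_vars W f = f} (?B i)" for i
    proof (rule cone_diff_mat_in[OF _ _ A(1) A(1) cPhi A(3) _ A(3)])
      show "- f \<in> {f. restrict_vars W f = f}" if "f \<in> {f. restrict_vars W f = f}" for f :: "('v, 'k) mpoly"
        using that restrict_vars_simps(4)[of W 0 f] by simp
    qed (auto simp: Phi_def mat_in_def xW)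
    moreover have "int (card (insert C M) * t) \<in> set (?cd (Suc (card (insert C M))))"
      using A(4) insert.hyps C(1) by (auto simp: cone_degrees_def)
    ultimately show ?case using B by blast
  qed
  then show ?thesis using that by blast
qed

lemma quotient_regularity_eqI:
  fixes F M :: "'v::finite set set"
  assumes bound: "reg_bounded (sqf_ideal F :: ('v, 'k::field) mpoly set) ((int t - 1) * int (card M))"
    and M: "disjoint M" "\<And>C. C \<in> M \<Longrightarrow> card C = t" "t > 0" "M \<subseteq> F"
    and restr: "\<And>C. C \<in> F \<Longrightarrow> C \<subseteq> \<Union>M \<Longrightarrow> C \<in> M"
  shows "quotient_regularity (sqf_ideal F :: ('v, 'k) mpoly set) = (int t - 1) * int (card M)"
proof -
  let ?I = "sqf_ideal F :: ('v, 'k) mpoly set" and ?r = "(int t - 1) * int (card M)"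
  note I = restrictable_ideal_sqf_ideal[of F, where ?'b = 'k]
  obtain dg N and A :: "nat \<Rightarrow> ('v, 'k) mpoly mat" where A: "gres ?I dg A" "\<And>i. i \<ge> N \<Longrightarrow> dg i = []"
    "\<And>i d. d \<in> set (dg (Suc i)) \<Longrightarrow> d - int i \<le> ?r"
    using bound unfolding reg_bounded_def by blast
  define R where "R = resolution_degrees ?I"
  have "\<exists>degs A. minimal_graded_free_resolution ?I degs A"
    using minimal_gres_exists[OF A(1) I A(2)] minimal_graded_free_resolution_of_gres I by blast
  then have "\<exists>A. minimal_graded_free_resolution ?I R A"
    unfolding R_def resolution_degrees_def by (rule someI_ex)
  then obtain B where B: "gres ?I (case_nat [0] R) B" "minimal_diffs B"
    using minimal_gres_of_minimal_graded_free_resolution I by blast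
  have "set (case_nat [0] R (Suc i)) \<subseteq> set (dg (Suc i))" for i
  proof (rule minimal_degrees_subset[OF B(1) I B(2) A(1) I order_refl, of UNIV])
    show "map_mat (restrict_vars UNIV) (B i) = B i" for i
      by (intro eq_matI) (auto simp: restrict_vars_def intro: restrict_keys_eq_self)
    show "restrict_vars UNIV f \<in> ?I" if "f \<in> ?I" for f
      unfolding restrict_vars_def using restrictable_idealD(5)[OF I that] .
  qed
  then have sub: "set (R i) \<subseteq> set (dg (Suc i))" for i by simp
  obtain dgK and K :: "nat \<Rightarrow> ('v, 'k) mpoly mat" where
    K: "gres (sqf_ideal M) dgK K" "minimal_diffs K" "\<And>i. mat_in {f. restrict_vars (\<Union>M) f = f} (K i)"
    "int (card M * t) \<in> set (dgK (Suc (card M)))"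
    using koszul_resolution[OF M(1-3) order_refl] by blast
  have "set (dgK (Suc (card M))) \<subseteq> set (case_nat [0] R (Suc (card M)))"
  proof (rule minimal_degrees_subset[OF K(1) restrictable_ideal_sqf_ideal K(2) B(1) I, of "\<Union>M"])
    show "sqf_ideal M \<subseteq> ?I" using M(4) unfolding sqf_ideal_def by blast
    show "map_mat (restrict_vars (\<Union>M)) (K i) = K i" for i
      using K(3)[of i] by (intro eq_matI) (auto simp: mat_in_def)
    show "restrict_vars (\<Union>M) f \<in> sqf_ideal M" if "f \<in> ?I" for f
      by (rule restrict_vars_sqf_ideal[OF that]) (use restr in blast)
  qed
  then have top: "int (card M * t) \<in> set (R (card M))" using K(4) by auto
  have count: "count_list xs j \<noteq> 0 \<longleftrightarrow> j \<in> set xs" for xs and j :: int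
    by (simp add: count_list_0_iff)
  let ?S = "{j - int i |i j. graded_betti ?I i j \<noteq> 0}"
  have S: "?S = {j - int i |i j. j \<in> set (R i)}"
    by (simp only: graded_betti_def R_def[symmetric] count)
  have "?S \<subseteq> (\<Union>i<N. (\<lambda>j. j - int i) ` set (dg (Suc i)))"
  proof
    fix s assume "s \<in> ?S"
    then obtain i j where ij: "s = j - int i" "j \<in> set (R i)" unfolding S by blast
    then have "j \<in> set (dg (Suc i))" using sub by blast
    moreover from this have "i < N" using A(2)[of "Suc i"] by (cases "i < N") auto
    ultimately show "s \<in> (\<Union>i<N. (\<lambda>j. j - int i) ` set (dg (Suc i)))" using ij by blast
  qed
  then have "finite ?S" by (rule finite_subset) auto
  moreover have "s \<le> ?r" if "s \<in> ?S" for s using that A(3) sub unfolding S by blast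
  moreover have "?r \<in> ?S"
    unfolding S using top by (intro CollectI exI[of _ "card M"] exI[of _ "int (card M * t)"]) (auto simp: algebra_simps)
  ultimately show ?thesis unfolding quotient_regularity_def by (intro Max_eqI)
qed

section \<open>Connected vertex sets\<close>

lemma induced_connected_cut:
  assumes "induced_connected E W" "X \<subseteq> W" "X \<noteq> {}" "X \<noteq> W"
  shows "\<exists>a\<in>X. \<exists>b\<in>W - X. {a, b} \<in> E"
proof -
  obtain u w where uw: "u \<in> X" "w \<in> W" "w \<notin> X" using assms by blast
  then have "(u, w) \<in> {(a, b). {a, b} \<in> induced_edges E W}\<^sup>*"
    using assms by (auto simp: induced_connected_def)
  then have "w \<in> X \<or> (\<exists>a\<in>X. \<exists>b\<in>W - X. {a, b} \<in> E)"
    by (induction rule: rtrancl_induct) (use uw in \<open>auto simp: induced_edges_def\<close>)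
  then show ?thesis using uw by blast
qed

lemma induced_connected_cutI:
  assumes "W \<noteq> {}"
    and cut: "\<And>X. X \<subseteq> W \<Longrightarrow> X \<noteq> {} \<Longrightarrow> X \<noteq> W \<Longrightarrow> \<exists>a\<in>X. \<exists>b\<in>W - X. {a, b} \<in> E"
  shows "induced_connected E W"
  unfolding induced_connected_def
proof (intro conjI ballI)
  fix u v assume u: "u \<in> W" and v: "v \<in> W"
  let ?R = "{(a, b). {a, b} \<in> induced_edges E W}"
  let ?X = "{w \<in> W. (u, w) \<in> ?R\<^sup>*}"
  have "?X = W"
  proof (rule ccontr)
    assume "?X \<noteq> W"
    then obtain a b where ab: "a \<in> ?X" "b \<in> W - ?X" "{a, b} \<in> E" using cut[of ?X] u by blast
    then have "(a, b) \<in> ?R" by (auto simp: induced_edges_def)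
    then have "(u, b) \<in> ?R\<^sup>*" using ab(1) by (auto intro: rtrancl_into_rtrancl)
    then show False using ab(2) by blast
  qed
  then show "(u, v) \<in> ?R\<^sup>*" using v by blast
qed (rule assms(1))

definition simplicial :: "'v set set \<Rightarrow> 'v set \<Rightarrow> 'v \<Rightarrow> bool" where
  "simplicial E W v \<longleftrightarrow>
     (\<forall>a\<in>W. \<forall>b\<in>W. {v, a} \<in> E \<longrightarrow> {v, b} \<in> E \<longrightarrow> a \<noteq> b \<longrightarrow> {a, b} \<in> E)"

lemma induced_connected_remove_simplicial:
  assumes C: "induced_connected E C" and sub: "C \<subseteq> W" and v: "simplicial E W v" "v \<in> C" "C \<noteq> {v}"
  shows "induced_connected E (C - {v})"
proof (rule induced_connected_cutI)
  show "C - {v} \<noteq> {}" using v by blast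
  fix X assume X: "X \<subseteq> C - {v}" "X \<noteq> {}" "X \<noteq> C - {v}"
  obtain a b where ab: "a \<in> X" "b \<in> C - X" "{a, b} \<in> E"
    using induced_connected_cut[OF C, of X] X v by blast
  obtain a' b' where ab': "a' \<in> insert v X" "b' \<in> C - insert v X" "{a', b'} \<in> E"
    using induced_connected_cut[OF C, of "insert v X"] X v by blast
  show "\<exists>a\<in>X. \<exists>b\<in>C - {v} - X. {a, b} \<in> E"
  proof (cases "b = v \<and> a' = v")
    case True
    then have "{a, b'} \<in> E"
      using v(1) ab ab' X(1) sub unfolding simplicial_def by (auto simp: insert_commute)
    then show ?thesis using ab ab' by blast
  qed (use ab ab' in blast)
qed

lemma induced_connected_insert:
  assumes C: "induced_connected E C" and c: "c \<in> C" "{c, u} \<in> E"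
  shows "induced_connected E (insert u C)"
proof (rule induced_connected_cutI)
  fix X assume X: "X \<subseteq> insert u C" "X \<noteq> {}" "X \<noteq> insert u C"
  show "\<exists>a\<in>X. \<exists>b\<in>insert u C - X. {a, b} \<in> E"
  proof -
    have c': "{u, c} \<in> E" using c by (simp add: insert_commute)
    consider "X \<inter> C = {}" | "C \<subseteq> X" | "X \<inter> C \<noteq> {}" "\<not> C \<subseteq> X" by blast
    then show ?thesis
    proof cases
      case 1
      then have "u \<in> X" "c \<in> insert u C - X" using X c by auto
      then show ?thesis using c' by blast
    next
      case 2
      then have "c \<in> X" "u \<in> insert u C - X" using X c by auto
      then show ?thesis using c by blast
    next
      case 3
      then obtain a b where "a \<in> X \<inter> C" "b \<in> C - X \<inter> C" "{a, b} \<in> E"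
        using induced_connected_cut[OF C, of "X \<inter> C"] by blast
      then show ?thesis by blast
    qed
  qed
qed simp

section \<open>Simplicial vertices of chordal graphs\<close>

lemma rtrancl_walk:
  assumes "(a, b) \<in> R\<^sup>*"
  obtains zs where "zs \<noteq> []" "hd zs = a" "last zs = b" "successively (\<lambda>u v. (u, v) \<in> R) zs"
    "\<And>z. z \<in> set zs \<Longrightarrow> (a, z) \<in> R\<^sup>*"
proof -
  have "\<exists>zs. zs \<noteq> [] \<and> hd zs = a \<and> last zs = b \<and> successively (\<lambda>u v. (u, v) \<in> R) zs \<and>
    (\<forall>z\<in>set zs. (a, z) \<in> R\<^sup>*)"
    using assms
  proof (induction rule: rtrancl_induct)
    case base
    show ?case by (intro exI[of _ "[a]"]) auto
  next
    case (step b c)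
    then obtain zs where "zs \<noteq> []" "hd zs = a" "last zs = b" "successively (\<lambda>u v. (u, v) \<in> R) zs"
      "\<forall>z\<in>set zs. (a, z) \<in> R\<^sup>*" by blast
    with step.hyps show ?case
      by (intro exI[of _ "zs @ [c]"]) (auto simp: successively_append_iff intro: rtrancl_into_rtrancl)
  qed
  then show ?thesis using that by blast
qed

lemma successively_iff_nth:
  "successively P xs \<longleftrightarrow> (\<forall>i. Suc i < length xs \<longrightarrow> P (xs ! i) (xs ! Suc i))"
proof (induction P xs rule: successively.induct)
  case (3 P x y xs)
  show ?case unfolding successively.simps 3 by (auto simp: nth_Cons split: nat.splits)
qed auto

text \<open>
  A shortest walk from \<open>s\<close> to \<open>s'\<close> with interior in \<open>B\<close> has no chord; closing it up through \<open>x\<close>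
  gives an induced cycle.
\<close>

lemma chordal_separator_adjacent:
  fixes E :: "'v set set"
  assumes E: "simple_graph E" "chordal E"
    and xs: "{x, s} \<in> E" "{x, s'} \<in> E" "s \<noteq> s'"
    and B: "x \<notin> B" "\<And>b. b \<in> B \<Longrightarrow> {x, b} \<notin> E"
    and walk: "set zs0 \<subseteq> B" "successively (\<lambda>u v. {u, v} \<in> E) (s # zs0 @ [s'])"
  shows "{s, s'} \<in> E"
proof (rule ccontr)
  assume nadj: "{s, s'} \<notin> E"
  have irr: "{a, a} \<notin> E" for a using E(1) by (auto simp: simple_graph_def)
  define good where "good zs \<longleftrightarrow> set zs \<subseteq> B \<and> successively (\<lambda>u v. {u, v} \<in> E) (s # zs @ [s'])" for zs
  have "good zs0" using walk by (simp add: good_def)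
  then obtain zs where zs: "good zs" and min: "\<And>zs'. good zs' \<Longrightarrow> length zs \<le> length zs'"
    using ex_has_least_nat[of good zs0 length] by blast
  define ys where "ys = s # zs @ [s']"
  define n where "n = length ys"
  have ne: "zs \<noteq> []" using zs nadj by (auto simp: good_def)
  have n: "n \<ge> 3" "n = length zs + 2" using ne by (cases zs; simp add: n_def ys_def)+
  have sB: "s \<notin> B" "s' \<notin> B" using B(2) xs by auto
  have adj: "{ys ! i, ys ! Suc i} \<in> E" if "Suc i < n" for i
    using zs that by (auto simp: good_def successively_iff_nth ys_def n_def)
  have ends: "ys ! 0 = s" "ys ! (n - 1) = s'" by (simp_all add: ys_def n nth_append)
  have inner: "ys ! i \<in> B" if "0 < i" "i < n - 1" for i
  proof -
    have "ys ! i = zs ! (i - 1)" using that by (auto simp: ys_def n nth_Cons nth_append split: nat.splits)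
    then show ?thesis using that zs n by (auto simp: good_def)
  qed
  have nochord: "{ys ! k, ys ! j} \<notin> E" if kj: "Suc k < j" "j < n" for k j
  proof
    assume e: "{ys ! k, ys ! j} \<in> E"
    let ?zs = "take k zs @ drop (j - 1) zs"
    have eq: "s # ?zs @ [s'] = take (Suc k) ys @ drop j ys"
      using kj n by (cases j) (auto simp: ys_def)
    have P: "successively (\<lambda>u v. {u, v} \<in> E) (take (Suc k) ys)" "successively (\<lambda>u v. {u, v} \<in> E) (drop j ys)"
      using adj kj by (auto simp: successively_iff_nth n_def)
    have "last (take (Suc k) ys) = ys ! k" "hd (drop j ys) = ys ! j"
      using kj by (auto simp: n_def hd_drop_conv_nth take_Suc_conv_app_nth)
    with P e have "successively (\<lambda>u v. {u, v} \<in> E) (s # ?zs @ [s'])"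
      unfolding eq by (simp add: successively_append_iff)
    then have "good ?zs"
      using zs set_take_subset[of k zs] set_drop_subset[of "j - 1" zs] by (auto simp: good_def)
    from min[OF this] show False using kj n by simp
  qed
  have dist: "ys ! i \<noteq> ys ! j" if "i < j" "j < n" for i j
  proof
    assume eq: "ys ! i = ys ! j"
    show False
    proof (cases i)
      case 0
      then have s: "ys ! j = s" using eq ends(1) by simp
      show False
      proof (cases "j = n - 1")
        case True
        then show False using s ends(2) xs(3) by metis
      next
        case False
        then have "ys ! j \<in> B" using that 0 by (intro inner) linarith+
        then show False using s sB(1) by metis
      qed
    next
      case (Suc i')
      then show False using nochord[of i' j] adj[of i'] that eq by auto
    qed
  qed
  have xys: "{x, ys ! i} \<notin> E" if "0 < i" "i < n - 1" for i
    using B(2) inner[OF that] by blast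
  have x: "x \<notin> set ys"
  proof
    assume "x \<in> set ys"
    then consider "x = s" | "x = s'" | "x \<in> B" using zs by (auto simp: ys_def good_def)
    then show False using irr xs(1,2) B(1) by cases auto
  qed
  let ?cs = "x # ys"
  have "distinct ys"
    unfolding distinct_conv_nth using dist by (metis n_def linorder_neqE_nat)
  then have d: "distinct ?cs" using x by simp
  have len: "length ?cs = Suc n" by (simp add: n_def)
  have "induced_edges E (set ?cs) = {{?cs ! i, ?cs ! (Suc i mod length ?cs)} |i. i < length ?cs}" (is "?L = ?R")
  proof (intro equalityI subsetI)
    fix e assume e: "e \<in> ?L"
    then have "e \<in> E" "e \<subseteq> set ?cs" by (auto simp: induced_edges_def)
    moreover from this obtain u v where uv: "e = {u, v}" "u \<noteq> v"
      using E(1) by (auto simp: simple_graph_def card_2_iff)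
    ultimately obtain i0 j0 where "i0 < Suc n" "j0 < Suc n" "u = ?cs ! i0" "v = ?cs ! j0"
      by (metis insert_subset in_set_conv_nth len)
    then obtain i j where ij: "i < j" "j < Suc n" "e = {?cs ! i, ?cs ! j}"
      using uv by (metis insert_commute linorder_neqE_nat)
    show "e \<in> ?R"
    proof (cases i)
      case 0
      then obtain j' where j: "j = Suc j'" using ij(1) by (cases j) auto
      have "j' = 0 \<or> j' = n - 1"
      proof (rule ccontr)
        assume "\<not> ?thesis"
        then have "0 < j'" "j' < n - 1" using ij(2) j by linarith+
        then have "{x, ys ! j'} \<notin> E" by (rule xys)
        then show False using ij(3) \<open>e \<in> E\<close> 0 j by simp
      qed
      then show ?thesis
      proof
        assume "j' = 0"
        then have "e = {?cs ! 0, ?cs ! (Suc 0 mod length ?cs)}" using ij 0 j n by (simp add: n_def[symmetric])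
        then show ?thesis by blast
      next
        assume "j' = n - 1"
        then have "j = n" using j n by simp
        moreover have "Suc n mod length ?cs = 0" unfolding len by simp
        ultimately have "e = {?cs ! n, ?cs ! (Suc n mod length ?cs)}"
          unfolding ij(3) 0 by (simp only:) (rule insert_commute)
        moreover have "n < length ?cs" using len by simp
        ultimately show ?thesis by (intro CollectI exI[of _ n] conjI)
      qed
    next
      case (Suc i')
      then obtain j' where j: "j = Suc j'" using ij(1) by (cases j) auto
      have "\<not> Suc i' < j'" using nochord[of i' j'] ij \<open>e \<in> E\<close> Suc j by auto
      then have "j = Suc i" using ij(1) Suc j by simp
      then have "e = {?cs ! i, ?cs ! (Suc i mod length ?cs)}" using ij(2,3) unfolding len by simp
      moreover have "i < length ?cs" using ij(1,2) len by linarith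
      ultimately show ?thesis by (intro CollectI exI[of _ i] conjI)
    qed
  next
    fix e assume "e \<in> ?R"
    then obtain i where i: "i < Suc n" "e = {?cs ! i, ?cs ! (Suc i mod Suc n)}" unfolding len by blast
    have "e \<subseteq> set ?cs"
      using i len nth_mem[of i ?cs] nth_mem[of "Suc i mod Suc n" ?cs] by auto
    moreover have "e \<in> E"
    proof -
      consider "i = 0" | "i = n" | i' where "i = Suc i'" "Suc i' < n" using i(1) by (cases i) force+
      then show ?thesis
      proof cases
        case 1
        then have "e = {x, s}" using i(2) ends n by simp
        then show ?thesis using xs by simp
      next
        case 2
        then have "e = {s', x}" using i(2) ends n by (cases n) auto
        then show ?thesis using xs by (simp add: insert_commute)
      next
        case 3
        then have "e = {ys ! i', ys ! Suc i'}" using i(2) by simp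
        then show ?thesis using adj 3 by simp
      qed
    qed
    ultimately show "e \<in> ?L" by (simp add: induced_edges_def)
  qed
  then have "induced_cycle E ?cs" using d n by (simp add: induced_cycle_def n_def)
  then show False using E(2) n by (auto simp: chordal_def n_def)
qed

lemma chordal_simplicial_nonadjacent:
  fixes E :: "'v::finite set set"
  assumes E: "simple_graph E" "chordal E"
    and "x \<in> W" "y \<in> W" "x \<noteq> y" "{x, y} \<notin> E"
  shows "\<exists>v\<in>W. v \<noteq> x \<and> {x, v} \<notin> E \<and> simplicial E W v"
  using assms(3-)
proof (induction "card W" arbitrary: W x y rule: less_induct)
  case less
  note x = less.prems(1) and y = less.prems(2-)
  define U where "U = {u \<in> W. u \<noteq> x \<and> {x, u} \<notin> E}"
  define R where "R = {(a, b). a \<in> U \<and> b \<in> U \<and> {a, b} \<in> E}"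
  define B where "B = {z \<in> U. (y, z) \<in> R\<^sup>*}"
  define S where "S = {s \<in> W. {x, s} \<in> E \<and> (\<exists>b\<in>B. {b, s} \<in> E)}"
  have yB: "y \<in> B" using y by (auto simp: B_def U_def)
  have BU: "B \<subseteq> U" by (auto simp: B_def)
  have symR: "sym (R\<^sup>*)" by (intro sym_rtrancl symI) (auto simp: R_def insert_commute)
  have closed: "u \<in> B" if "b \<in> B" "u \<in> U" "{b, u} \<in> E" for b u
    using that by (auto simp: B_def R_def intro: rtrancl_into_rtrancl)
  have nbr: "w \<in> B \<union> S" if "b \<in> B" "w \<in> W" "{b, w} \<in> E" for b w
  proof (cases "{x, w} \<in> E")
    case True then show ?thesis using that by (auto simp: S_def)
  next
    case False
    have "w \<noteq> x" using that BU by (auto simp: U_def insert_commute)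
    then show ?thesis using closed that False by (auto simp: U_def)
  qed
  have clique: "{s, s'} \<in> E" if s: "s \<in> S" "s' \<in> S" "s \<noteq> s'" for s s'
  proof -
    obtain b b' where b: "b \<in> B" "{b, s} \<in> E" "b' \<in> B" "{b', s'} \<in> E" using s by (auto simp: S_def)
    have "(b, b') \<in> R\<^sup>*"
      using b symD[OF symR, of y b] by (auto simp: B_def intro: rtrancl_trans)
    then obtain zs where zs: "zs \<noteq> []" "hd zs = b" "last zs = b'" "successively (\<lambda>u v. (u, v) \<in> R) zs"
      "\<And>z. z \<in> set zs \<Longrightarrow> (b, z) \<in> R\<^sup>*" by (erule rtrancl_walk)
    have U: "z \<in> U" if "(b, z) \<in> R\<^sup>*" for z
      using that by (induction rule: rtrancl_induct) (use b BU in \<open>auto simp: R_def\<close>)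
    have "set zs \<subseteq> B"
      using zs(5) U b(1) by (auto simp: B_def intro: rtrancl_trans)
    moreover have "successively (\<lambda>u v. {u, v} \<in> E) zs"
      using zs(4) by (rule successively_mono) (auto simp: R_def)
    then have "successively (\<lambda>u v. {u, v} \<in> E) (s # zs @ [s'])"
      using zs(1-3) b by (auto simp: successively_append_iff successively_Cons insert_commute)
    ultimately show ?thesis
      using chordal_separator_adjacent[OF E, of x s s' B zs] s BU by (auto simp: S_def U_def)
  qed
  let ?W = "B \<union> S"
  have xW: "x \<notin> ?W" using E(1) BU by (auto simp: S_def U_def simple_graph_def)
  have "?W \<subseteq> W" using BU by (auto simp: S_def U_def)
  then have smaller: "card ?W < card W" using xW x by (intro psubset_card_mono) auto
  have "\<exists>v\<in>B. simplicial E ?W v"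
  proof (cases "\<exists>p\<in>?W. \<exists>q\<in>?W. p \<noteq> q \<and> {p, q} \<notin> E")
    case True
    then obtain p q where pq: "p \<in> ?W" "q \<in> ?W" "p \<noteq> q" "{p, q} \<notin> E"
      "p \<in> S \<or> \<not> (\<exists>p\<in>S. \<exists>q\<in>?W. p \<noteq> q \<and> {p, q} \<notin> E)" by (metis UnCI)
    from less.hyps[OF smaller pq(1-4)] obtain v where
      v: "v \<in> ?W" "v \<noteq> p" "{p, v} \<notin> E" "simplicial E ?W v" by blast
    have "v \<notin> S" using pq(1,5) clique v by (metis insert_commute)
    then show ?thesis using v by blast
  next
    case False
    then show ?thesis using yB unfolding simplicial_def by blast
  qed
  then obtain v where v: "v \<in> B" "simplicial E ?W v" by blast
  then have "simplicial E W v" using nbr unfolding simplicial_def by blast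
  then show ?case using v(1) BU by (auto simp: U_def)
qed

lemma chordal_simplicial_exists:
  fixes E :: "'v::finite set set"
  assumes "simple_graph E" "chordal E" "W \<noteq> {}"
  obtains v where "v \<in> W" "simplicial E W v"
proof (cases "\<exists>x\<in>W. \<exists>y\<in>W. x \<noteq> y \<and> {x, y} \<notin> E")
  case True
  then show ?thesis using chordal_simplicial_nonadjacent[OF assms(1,2)] that by blast
next
  case False
  then show ?thesis using assms(3) that unfolding simplicial_def by blast
qed

section \<open>Connected ideals of chordal graphs\<close>

definition t_connected_in :: "nat \<Rightarrow> 'v set set \<Rightarrow> 'v set \<Rightarrow> 'v set set" where
  "t_connected_in t E W = {C \<in> t_connected_sets t E. C \<subseteq> W}"

lemma t_connected_inD:
  "C \<in> t_connected_in t E W \<Longrightarrow> card C = t \<and> induced_connected E C \<and> C \<noteq> {} \<and> C \<subseteq> W"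
  by (auto simp: t_connected_in_def t_connected_sets_def induced_connected_def)

lemma t_connected_in_subset_eq:
  fixes C :: "'v::finite set"
  assumes "C \<in> t_connected_in t E W" "D \<in> t_connected_in t E W'" "D \<subseteq> C"
  shows "D = C"
  using assms t_connected_inD[OF assms(1)] t_connected_inD[OF assms(2)]
  by (intro card_subset_eq) auto

lemma t_induced_matching_insert:
  fixes E :: "'v::finite set set"
  assumes E: "simple_graph E" and M: "t_induced_matching t E M" and C: "C \<in> t_connected_sets t E"
    and disj: "\<Union>M \<inter> C = {}" and far: "\<And>a b. a \<in> C \<Longrightarrow> b \<in> \<Union>M \<Longrightarrow> {a, b} \<notin> E"
  shows "t_induced_matching t E (insert C M)"
proof -
  have "disjoint (insert C M)" using M disj by (auto simp: t_induced_matching_def disjoint_def)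
  moreover have "induced_edges E (\<Union>(insert C M)) = (\<Union>D\<in>insert C M. induced_edges E D)"
  proof (intro equalityI subsetI)
    fix e assume "e \<in> induced_edges E (\<Union>(insert C M))"
    then have e: "e \<in> E" "e \<subseteq> C \<union> \<Union>M" by (auto simp: induced_edges_def)
    obtain a b where ab: "e = {a, b}" using E e(1) by (auto simp: simple_graph_def card_2_iff)
    have "e \<subseteq> C \<or> e \<subseteq> \<Union>M" using e far[of a b] far[of b a] by (auto simp: ab insert_commute)
    then have "e \<in> induced_edges E C \<or> e \<in> induced_edges E (\<Union>M)" using e by (auto simp: induced_edges_def)
    then show "e \<in> (\<Union>D\<in>insert C M. induced_edges E D)" using M by (auto simp: t_induced_matching_def)
  qed (auto simp: induced_edges_def)
  ultimately show ?thesis using M C by (auto simp: t_induced_matching_def)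
qed

lemma t_induced_matching_empty: "simple_graph E \<Longrightarrow> t_induced_matching t E {}"
  by (auto simp: t_induced_matching_def induced_edges_def simple_graph_def)

text \<open>
  Adding the generators through a simplicial vertex \<open>v\<close> one at a time, each colon ideal by \<open>C\<close> is
  generated by the neighbours of \<open>C\<close> and the connected sets far from \<open>C\<close>, whatever the order.
\<close>

lemma colon_through_simplicial:
  fixes E :: "'v::finite set set"
  assumes E: "simple_graph E" and t: "t \<ge> 2" and v: "v \<in> W" "simplicial E W v"
    and C: "C \<in> t_connected_in t E W" "v \<in> C" "C \<notin> S" and S: "S \<subseteq> t_connected_in t E W"
  defines "N \<equiv> {u \<in> W - C. \<exists>c\<in>C. {c, u} \<in> E}"
  shows "sqf_ideal ((\<lambda>D. D - C) ` (S \<union> t_connected_in t E (W - {v})))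
    = (sqf_ideal ((\<lambda>x. {x}) ` N \<union> t_connected_in t E (W - C - N)) :: ('v, 'k::comm_ring_1) mpoly set)"
proof (rule sqf_ideal_eqI)
  note Cd = t_connected_inD[OF C(1)]
  fix X assume "X \<in> (\<lambda>D. D - C) ` (S \<union> t_connected_in t E (W - {v}))"
  then obtain D where D: "X = D - C" "D \<in> S \<union> t_connected_in t E (W - {v})" by blast
  then have DW: "D \<in> t_connected_in t E W" using S by (auto simp: t_connected_in_def)
  note Dd = t_connected_inD[OF DW]
  have "D \<noteq> C" using D(2) C by (auto simp: t_connected_in_def)
  show "\<exists>Y\<in>(\<lambda>x. {x}) ` N \<union> t_connected_in t E (W - C - N). Y \<subseteq> X"
  proof (cases "D \<inter> N = {}")
    case True
    have "D \<inter> C = {}"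
    proof (rule ccontr)
      assume ne: "D \<inter> C \<noteq> {}"
      have "\<not> D \<subseteq> C" using t_connected_in_subset_eq[OF C(1) DW] \<open>D \<noteq> C\<close> by blast
      then obtain a b where "a \<in> D \<inter> C" "b \<in> D - D \<inter> C" "{a, b} \<in> E"
        using induced_connected_cut[of E D "D \<inter> C"] ne Dd by blast
      then show False using True Dd by (auto simp: N_def)
    qed
    then have "D \<in> t_connected_in t E (W - C - N)" using DW True by (auto simp: t_connected_in_def)
    then show ?thesis using D(1) \<open>D \<inter> C = {}\<close> by blast
  next
    case False
    then show ?thesis using D(1) by (auto simp: N_def)
  qed
next
  note Cd = t_connected_inD[OF C(1)]
  fix Y assume "Y \<in> (\<lambda>x. {x}) ` N \<union> t_connected_in t E (W - C - N)"
  then consider x where "Y = {x}" "x \<in> N" | "Y \<in> t_connected_in t E (W - C - N)" by blast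
  then show "\<exists>X\<in>(\<lambda>D. D - C) ` (S \<union> t_connected_in t E (W - {v})). X \<subseteq> Y"
  proof cases
    case 1
    have Cv: "C \<noteq> {v}" using Cd t by auto
    have conn: "induced_connected E (C - {v})"
      using induced_connected_remove_simplicial[of E C W v] Cd v C(2) Cv by blast
    obtain c where c: "c \<in> C" "{c, x} \<in> E" using 1 by (auto simp: N_def)
    have "\<exists>c\<in>C - {v}. {c, x} \<in> E"
    proof (cases "c = v")
      case True
      obtain b where b: "b \<in> C - {v}" "{v, b} \<in> E"
        using induced_connected_cut[of E C "{v}"] Cd C(2) Cv by auto
      have "{b, x} \<in> E"
        using v(2) b c True 1 Cd unfolding simplicial_def N_def by blast
      then show ?thesis using b by blast
    qed (use c in blast)
    then have "induced_connected E (insert x (C - {v}))" using induced_connected_insert[OF conn] by blast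
    moreover have "card (insert x (C - {v})) = t"
    proof -
      have "x \<notin> C - {v}" using 1(2) by (simp add: N_def)
      then have "card (insert x (C - {v})) = Suc (card (C - {v}))" by simp
      then show ?thesis using Cd C(2) t by simp
    qed
    moreover have "insert x (C - {v}) \<subseteq> W - {v}" using 1(2) Cd C(2) unfolding N_def by blast
    ultimately have "insert x (C - {v}) \<in> t_connected_in t E (W - {v})"
      by (simp add: t_connected_in_def t_connected_sets_def)
    then have "insert x (C - {v}) - C \<in> (\<lambda>D. D - C) ` (S \<union> t_connected_in t E (W - {v}))"
      by (intro imageI UnI2)
    moreover have "insert x (C - {v}) - C \<subseteq> Y" using 1(1) by blast
    ultimately show ?thesis by (rule bexI[rotated])
  next
    case 2
    then have "Y \<in> t_connected_in t E (W - {v})" using C(2) by (auto simp: t_connected_in_def)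
    then have "Y - C \<in> (\<lambda>D. D - C) ` (S \<union> t_connected_in t E (W - {v}))"
      by (intro imageI UnI2)
    then show ?thesis by (rule bexI[rotated]) blast
  qed
qed

lemma reg_bounded_t_connected:
  fixes E :: "'v::finite set set"
  assumes E: "simple_graph E" "chordal E" and t: "t \<ge> 2"
    and "\<And>M. t_induced_matching t E M \<Longrightarrow> \<Union>M \<subseteq> W \<Longrightarrow> card M \<le> k"
  shows "reg_bounded (sqf_ideal (t_connected_in t E W) :: ('v, 'k::comm_ring_1) mpoly set) ((int t - 1) * int k)"
  using assms(4)
proof (induction "card W" arbitrary: W k rule: less_induct)
  case less
  show ?case
  proof (cases "W = {}")
    case True
    then have "t_connected_in t E W = {}" using t_connected_inD[of _ t E W] by blast
    then show ?thesis using reg_bounded_mono[OF reg_bounded_sqf_ideal_empty, of "(int t - 1) * int k"] t by simp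
  next
    case False
    obtain v where v: "v \<in> W" "simplicial E W v" using chordal_simplicial_exists[OF E False] by blast
    let ?F = "t_connected_in t E (W - {v})"
    let ?G = "{C \<in> t_connected_in t E W. v \<in> C}"
    have "reg_bounded (sqf_ideal (S \<union> ?F) :: ('v, 'k) mpoly set) ((int t - 1) * int k)"
      if "S \<subseteq> ?G" for S
    proof -
      have "finite S" by simp
      then show ?thesis using that
      proof (induction S)
        case empty
        have "card (W - {v}) < card W" using v(1) by (intro psubset_card_mono) auto
        then show ?case using less.hyps[of "W - {v}" k] less.prems by simp blast
      next
        case (insert C S)
        let ?N = "{u \<in> W - C. \<exists>c\<in>C. {c, u} \<in> E}"
        have C: "C \<in> t_connected_in t E W" "v \<in> C" using insert.prems by auto
        have SW: "S \<subseteq> t_connected_in t E W" using insert.prems by auto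
        note Cd = t_connected_inD[OF C(1)]
        have Ct: "C \<in> t_connected_sets t E" using C(1) by (simp add: t_connected_in_def)
        have bound: "card M + 1 \<le> k" if M: "t_induced_matching t E M" "\<Union>M \<subseteq> W - C - ?N" for M
        proof -
          have "t_induced_matching t E (insert C M)"
            by (rule t_induced_matching_insert[OF E(1) M(1) Ct]) (use M(2) in blast)+
          moreover have "C \<notin> M" using Cd M(2) by blast
          ultimately show ?thesis using less.prems[of "insert C M"] Cd M(2) by auto
        qed
        have k: "k \<ge> 1" using bound[OF t_induced_matching_empty[OF E(1)]] by simp
        have "card (W - C - ?N) < card W" using Cd by (intro psubset_card_mono) auto
        then have "reg_bounded (sqf_ideal (t_connected_in t E (W - C - ?N)) :: ('v, 'k) mpoly set)
            ((int t - 1) * int (k - 1))"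
        proof (rule less.hyps)
          fix M assume "t_induced_matching t E M" "\<Union>M \<subseteq> W - C - ?N"
          then have "card M + 1 \<le> k" by (rule bound)
          then show "card M \<le> k - 1" by linarith
        qed
        then have "reg_bounded (sqf_ideal ((\<lambda>x. {x}) ` ?N \<union> t_connected_in t E (W - C - ?N)) :: ('v, 'k) mpoly set)
            ((int t - 1) * int (k - 1))"
          by (rule reg_bounded_vars) (auto simp: t_connected_in_def)
        then have "reg_bounded (sqf_ideal ((\<lambda>D. D - C) ` (S \<union> ?F)) :: ('v, 'k) mpoly set)
            ((int t - 1) * int (k - 1))"
          unfolding colon_through_simplicial[OF E(1) t v C insert.hyps(2) SW] .
        moreover have "reg_bounded (sqf_ideal (S \<union> ?F) :: ('v, 'k) mpoly set) ((int t - 1) * int k)"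
          using insert by simp
        moreover have "(int t - 1) * int (k - 1) + int (card C) - 1 \<le> (int t - 1) * int k"
          using Cd k by (simp add: of_nat_diff algebra_simps)
        ultimately have "reg_bounded (sqf_ideal (insert C (S \<union> ?F)) :: ('v, 'k) mpoly set) ((int t - 1) * int k)"
          by (intro reg_bounded_insert)
        then show ?case by simp
      qed
    qed
    moreover have "?G \<union> ?F = t_connected_in t E W" by (auto simp: t_connected_in_def)
    ultimately show ?thesis by (metis order_refl)
  qed
qed

theorem theorem3p6:
  fixes E :: "'v::finite set set" and t :: nat
  assumes "simple_graph E" and "chordal E" and "t \<ge> 2"
  shows "quotient_regularity (t_connected_ideal t E :: ('v, 'k::field) mpoly set)
    = (int t - 1) * int (t_induced_matching_number t E)"
proof -
  let ?F = "t_connected_in t E UNIV" and ?N = "card ` {M. t_induced_matching t E M}"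
  have F: "?F = t_connected_sets t E" by (auto simp: t_connected_in_def)
  have "Max ?N \<in> ?N" using t_induced_matching_empty[OF assms(1), of t] by (intro Max_in) auto
  then obtain M where M: "t_induced_matching t E M" "card M = t_induced_matching_number t E"
    by (auto simp: t_induced_matching_number_def)
  have "card M' \<le> card M" if "t_induced_matching t E M'" for M'
    unfolding M(2) t_induced_matching_number_def using that by (intro Max_ge) auto
  then have "reg_bounded (sqf_ideal ?F :: ('v, 'k) mpoly set) ((int t - 1) * int (card M))"
    by (intro reg_bounded_t_connected[OF assms])
  then have "quotient_regularity (sqf_ideal ?F :: ('v, 'k) mpoly set) = (int t - 1) * int (card M)"
  proof (rule quotient_regularity_eqI)
    show "disjoint M" "M \<subseteq> ?F" using M(1) F by (auto simp: t_induced_matching_def)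
    then show "card C = t" if "C \<in> M" for C using that t_connected_inD by blast
    show "t > 0" using assms(3) by simp
    fix C assume C: "C \<in> ?F" "C \<subseteq> \<Union>M"
    note Cd = t_connected_inD[OF C(1)]
    then obtain D where D: "D \<in> M" "C \<inter> D \<noteq> {}" using C(2) by blast
    have "C \<subseteq> D"
    proof (rule ccontr)
      assume "\<not> C \<subseteq> D"
      then obtain a b where ab: "a \<in> C \<inter> D" "b \<in> C - C \<inter> D" "{a, b} \<in> E"
        using induced_connected_cut[of E C "C \<inter> D"] Cd D(2) by blast
      then have "{a, b} \<in> induced_edges E (\<Union>M)" using C(2) by (auto simp: induced_edges_def)
      also have "induced_edges E (\<Union>M) = (\<Union>C\<in>M. induced_edges E C)"
        using M(1) by (simp add: t_induced_matching_def)
      finally obtain D' where D': "D' \<in> M" "{a, b} \<subseteq> D'"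
        by (auto simp: induced_edges_def)
      then have "a \<in> D' \<inter> D" using ab(1) by simp
      then have "D' = D" using disjointD[OF \<open>disjoint M\<close> D'(1) D(1)] by (metis empty_iff)
      then show False using D'(2) ab(2) by simp
    qed
    then show "C \<in> M"
      using t_connected_in_subset_eq[OF _ C(1)] D(1) \<open>M \<subseteq> ?F\<close> by blast
  qed
  then show ?thesis
    by (simp only: t_connected_ideal_def ideal_generated_sqf F M(2))
qed

end
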